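(* Let $n>1$ and let $O\sqcup C=P\setminus A$ be any partition. (1) For every $\mathbf d=(d_1,\dots,d_l)$ with $1\le d_1<\dots<d_l\le n-1$, the set of monomials $$X_{i^1_1,\dots,i^1_{k_1}}\cdots X_{i^m_1,\dots,i^m_{k_m}}\in S_{\mathbf d}$$ with $k_1\ge\dots\ge k_m$ for which the Young tableau with $j$th column $(i^j_1,\dots,i^j_{k_j})$, $1\le j\le m$, is $(O,C)$-semistandard projects to a basis of the Plücker algebra $S_{\mathbf d}/I_{\mathbf d}\simeq R_{\mathbf d}$. (2) For every integral dominant weight $\lambda=(a_1,\dots,a_{n-1})$ the polytope $\mathcal O_{O,C}(\lambda)$ is unimodularly equivalent to the convex hull of the points $x(Y)$ over all $(O,C)$-semistandard tableaux $Y$ of shape $\lambda$, i.e. with exactly $a_i$ columns of height $i$ for each $i$.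
   Context: **Poset and permutations.** $P=\{(i,j):1\le i\le j\le n\}$ is ordered by $(i,j)\preceq(i',j')$ iff $i\le i'$ and $j\le j'$. $A=\{(1,1),\dots,(n,n)\}$. $\mathcal J$ is the set of order ideals (lower sets) of $(P,\prec)$, $\mathcal J_k=\{J\in\mathcal J:|J\cap A|=k\}$. For $J\in\mathcal J$ put $M_{O,C}(J)=(J\cap(O\cup A))\cup\max_\prec(J)$, where $\max_\prec(J)$ is the set of $\prec$-maximal elements of $J$, and let $x_{O,C}(J)\in\mathbb R^P$ be the indicator vector of $M_{O,C}(J)$. For $M\subset P$ let $w_M\in\mathcal S_n$ be the product of the transpositions $s_{i,j}=(i\ j)$ over $(i,j)\in M$ (with $s_{i,i}=\mathrm{id}$), ordered by $i$ increasing from left to right and, within a given $i$, by $j$ increasing from left to right; in a product the rightmost factor acts first. Put $w^J=w_{M_{O,C}(J)}$. **The permutations $\sigma_i$.** For $(i,j)\in P$ let $\langle(i,j)\rangle\in\mathcal J$ be the principal order ideal $\{p\preceq(i,j)\}$. For $1\le i,j\le n$ set $r(i,j)=w^{\langle(i,j)\rangle}(i)$ if $i\le j$ and $r(i,j)=w_O(j)$ if $i>j$. For every $i$ the numbers $r(i,1),\dots,r(i,n)$ form a permutation of $[1,n]$; $\sigma_i$ denotes the inverse permutation, so $\sigma_i(r(i,j))=j$. **$(O,C)$-tuples.** For $1\le k\le n-1$ a tuple $(i_1,\dots,i_k)$ of pairwise distinct integers in $[1,n]$ is an $(O,C)$-tuple if $\sigma_j(i_j)\ge j$ for $1\le j\le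 k$ and, for any $1\le j<l\le k$, either $\sigma_{j+1}(i_j)=j$ or $\sigma_{j+1}(i_j)>\sigma_l(i_l)$. **$(O,C)$-semistandard tableaux.** Let $Y$ be a Young tableau in English notation with $m$ columns, the $i$th column of height $k_i$ ($k_1\ge\dots\ge k_m$), and let $Y_{i,j}$ be the element in the $j$th cell from the top of the $i$th column. $Y$ is $(O,C)$-semistandard if (a) $(Y_{i,1},\dots,Y_{i,k_i})$ is an $(O,C)$-tuple for every $i\in[1,m]$, and (b) for any $i'\le i$ in $[1,m]$ and $j\in[1,k_i]$ there exists $j'\in[j,k_{i'}]$ with $\sigma_{j'}(Y_{i',j'})\ge\sigma_j(Y_{i,j})$. For a Young tableau $Y$ let $x(Y)\in\mathbb R^{\overline P}$, $\overline P=\{(i,j):i\in[1,n-1],j\in[1,n]\}$, be the point for which $x(Y)_{i,j}$ is the number of elements equal to $j$ in row $i$ of $Y$. **Plücker algebra.** $S_{\mathbf d}=\mathbb C[X_{i_1,\dots,i_k}]_{k\in\mathbf d,\,1\le i_1<\dots<i_k\le n}$, with the convention $X_{i_1,\dots,i_k}=(-1)^\sigma X_{i_{\sigma(1)},\dots,i_{\sigma(k)}}$ for $\sigma\in\mathcal S_k$. $I_{\mathbf d}$ is the kernel and $R_{\mathbf d}$ the image of the map $S_{\mathbf d}\to\mathbb C[z_{i,j}]_{1\le i\le n-1,1\le j\le n}$ sending $X_{i_1,\dots,i_k}$ to the minor $D_{i_1,\dots,i_k}$ of $(z_{i,j})$ on rows $1,\dots,k$ and columns $i_1,\dots,i_k$.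 **Polytopes.** Integral dominant weights of $\mathfrak{sl}_n$ are tuples $\lambda=(a_1,\dots,a_{n-1})\in\mathbb Z_{\ge0}^{n-1}$, $\lambda=\sum a_i\omega_i$. The marked chain-order polytope $\mathcal O_{O,C}(\omega_k)\subset\mathbb R^P$ is the convex hull of the $x_{O,C}(J)$, $J\in\mathcal J_k$, and $\mathcal O_{O,C}(\lambda)$ is the Minkowski sum $a_1\mathcal O_{O,C}(\omega_1)+\dots+a_{n-1}\mathcal O_{O,C}(\omega_{n-1})$. Two lattice polytopes are unimodularly equivalent if there is an affine isomorphism between their affine spans that maps one polytope onto the other and identifies the sets of integer points of the affine spans. *)

theory Defs
  imports
    "HOL-Analysis.Finite_Function_Topology"
    "HOL-Analysis.Convex"
    "HOL-Algebra.Embedded_Algebras"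
    "HOL-Algebra.QuotRing"
    "HOL-Combinatorics.Permutations"
    "Jordan_Normal_Form.Determinant"
begin

section \<open>The poset and its order ideals\<close>

definition posetP :: "nat \<Rightarrow> (nat \<times> nat) set" where
  "posetP n = {(i, j). 1 \<le> i \<and> i \<le> j \<and> j \<le> n}"

definition diagA :: "nat \<Rightarrow> (nat \<times> nat) set" where
  "diagA n = {(i, i) | i. 1 \<le> i \<and> i \<le> n}"

definition pleq :: "nat \<times> nat \<Rightarrow> nat \<times> nat \<Rightarrow> bool" (infix \<open>\<preceq>\<^sub>P\<close> 50) where
  "p \<preceq>\<^sub>P q \<longleftrightarrow> fst p \<le> fst q \<and> snd p \<le> snd q"

definition order_ideals :: "nat \<Rightarrow> (nat \<times> nat) set set" where
  "order_ideals n =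
     {J. J \<subseteq> posetP n \<and> (\<forall>p\<in>J. \<forall>q\<in>posetP n. q \<preceq>\<^sub>P p \<longrightarrow> q \<in> J)}"

definition order_ideals_k :: "nat \<Rightarrow> nat \<Rightarrow> (nat \<times> nat) set set" where
  "order_ideals_k n k = {J \<in> order_ideals n. card (J \<inter> diagA n) = k}"

definition principal_ideal :: "nat \<Rightarrow> nat \<times> nat \<Rightarrow> (nat \<times> nat) set" where
  "principal_ideal n p = {q \<in> posetP n. q \<preceq>\<^sub>P p}"

definition max_elems :: "(nat \<times> nat) set \<Rightarrow> (nat \<times> nat) set" where
  "max_elems J = {p \<in> J. \<not> (\<exists>q\<in>J. p \<preceq>\<^sub>P q \<and> p \<noteq> q)}"

text \<open>
  For a partition of the off-diagonal part of the poset into an order part \<open>U\<close> and a chain part,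
  everything below depends on the partition only through \<open>U\<close>; the chain part is therefore
  not an argument.
\<close>

definition ideal_marks :: "nat \<Rightarrow> (nat \<times> nat) set \<Rightarrow> (nat \<times> nat) set \<Rightarrow> (nat \<times> nat) set" where
  "ideal_marks n U J = (J \<inter> (U \<union> diagA n)) \<union> max_elems J"


section \<open>The permutations\<close>

text \<open>
  The list below enumerates \<open>M\<close> by increasing \<open>i\<close> and, for fixed \<open>i\<close>, by increasing \<open>j\<close>.
  In the resulting composition the last transposition of the list acts first.
\<close>

definition perm_of :: "nat \<Rightarrow> (nat \<times> nat) set \<Rightarrow> nat \<Rightarrow> nat" where
  "perm_of n M =
     foldr (\<lambda>(i, j) f. Transposition.transpose i j \<circ> f)
       [(i, j). i \<leftarrow> [1..<Suc n], j \<leftarrow> [i..<Suc n], (i, j) \<in> M] id"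

definition rfun :: "nat \<Rightarrow> (nat \<times> nat) set \<Rightarrow> nat \<Rightarrow> nat \<Rightarrow> nat" where
  "rfun n U i j =
     (if i \<le> j then perm_of n (ideal_marks n U (principal_ideal n (i, j))) i
      else perm_of n U j)"

definition sigma :: "nat \<Rightarrow> (nat \<times> nat) set \<Rightarrow> nat \<Rightarrow> nat \<Rightarrow> nat" where
  "sigma n U i = inv_into {1..n} (rfun n U i)"


section \<open>Semistandard tableaux\<close>

text \<open>
  Positions in tuples and tableaux are counted from 1. A tableau is the list of its columns, from
  left to right, each column being listed from top to bottom.
\<close>

definition oc_tuple :: "nat \<Rightarrow> (nat \<times> nat) set \<Rightarrow> nat list \<Rightarrow> bool" where
  "oc_tuple n U t \<longleftrightarrow>
     (let k = length t; e = (\<lambda>j. t ! (j - 1)) in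
        1 \<le> k \<and> k \<le> n - 1 \<and> distinct t \<and> set t \<subseteq> {1..n} \<and>
        (\<forall>j\<in>{1..k}. sigma n U j (e j) \<ge> j) \<and>
        (\<forall>j l. 1 \<le> j \<and> j < l \<and> l \<le> k \<longrightarrow>
           sigma n U (j + 1) (e j) = j \<or> sigma n U (j + 1) (e j) > sigma n U l (e l)))"

definition col_height :: "nat list list \<Rightarrow> nat \<Rightarrow> nat" where
  "col_height Y i = length (Y ! (i - 1))"

definition entry :: "nat list list \<Rightarrow> nat \<Rightarrow> nat \<Rightarrow> nat" where
  "entry Y i j = Y ! (i - 1) ! (j - 1)"

definition young_tableau :: "nat list list \<Rightarrow> bool" where
  "young_tableau Y \<longleftrightarrow> sorted_wrt (\<ge>) (map length Y) \<and> [] \<notin> set Y"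

definition oc_semistandard :: "nat \<Rightarrow> (nat \<times> nat) set \<Rightarrow> nat list list \<Rightarrow> bool" where
  "oc_semistandard n U Y \<longleftrightarrow>
     young_tableau Y \<and>
     (\<forall>c\<in>set Y. oc_tuple n U c) \<and>
     (\<forall>i\<in>{1..length Y}. \<forall>i'\<in>{1..i}. \<forall>j\<in>{1..col_height Y i}.
        \<exists>j'\<in>{j..col_height Y i'}.
          sigma n U j' (entry Y i' j') \<ge> sigma n U j (entry Y i j))"

definition has_shape :: "nat \<Rightarrow> (nat \<Rightarrow> nat) \<Rightarrow> nat list list \<Rightarrow> bool" where
  "has_shape n a Y \<longleftrightarrow> (\<forall>k\<in>{1..n - 1}. count_list (map length Y) k = a k)"


section \<open>Polynomial rings over the complex numbers\<close>

text \<open>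
  A polynomial in variables of type \<open>'v\<close> is a finitely supported function from exponent
  vectors to coefficients; the product of the type class is the convolution product. The
  polynomial ring in a set \<open>V\<close> of variables is a subring of this ring.
\<close>

type_synonym 'v cpoly = "('v \<Rightarrow>\<^sub>0 nat) \<Rightarrow>\<^sub>0 complex"

definition cconst :: "complex \<Rightarrow> 'v cpoly" where
  "cconst c = Poly_Mapping.single 0 c"

definition cvar :: "'v \<Rightarrow> 'v cpoly" where
  "cvar v = Poly_Mapping.single (Poly_Mapping.single v 1) 1"

definition poly_ring :: "'v set \<Rightarrow> 'v cpoly ring" where
  "poly_ring V =
     \<lparr>carrier = {p. \<forall>m\<in>Poly_Mapping.keys p. Poly_Mapping.keys m \<subseteq> V},
      monoid.mult = (*), one = 1, zero = 0, add = (+)\<rparr>"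

definition poly_subst :: "('v \<Rightarrow> 'w cpoly) \<Rightarrow> 'v cpoly \<Rightarrow> 'w cpoly" where
  "poly_subst f p =
     (\<Sum>m\<in>Poly_Mapping.keys p. cconst (Poly_Mapping.lookup p m) *
        (\<Prod>v\<in>Poly_Mapping.keys m. f v ^ Poly_Mapping.lookup m v))"


section \<open>The Pluecker algebra\<close>

text \<open>
  The variables are indexed by strictly increasing lists. The variable of an arbitrary tuple is
  expressed by these through the sign convention; it vanishes if an index is repeated.
\<close>

definition pluecker_ring :: "nat \<Rightarrow> nat list \<Rightarrow> nat list cpoly ring" where
  "pluecker_ring n d =
     poly_ring {t. sorted_wrt (<) t \<and> set t \<subseteq> {1..n} \<and> length t \<in> set d}"

definition pluecker_var :: "nat list \<Rightarrow> nat list cpoly" where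
  "pluecker_var t =
     (if distinct t
      then of_int (sign (THE s. s permutes {..<length t} \<and> permute_list s t = sort t)) *
             cvar (sort t)
      else 0)"

definition matrix_poly_ring :: "nat \<Rightarrow> (nat \<times> nat) cpoly ring" where
  "matrix_poly_ring n = poly_ring ({1..n - 1} \<times> {1..n})"

definition minor :: "nat list \<Rightarrow> (nat \<times> nat) cpoly" where
  "minor t =
     Determinant.det
       (Matrix.mat (length t) (length t) (\<lambda>(r, c). cvar (r + 1, t ! c)))"

definition pluecker_map :: "nat list cpoly \<Rightarrow> (nat \<times> nat) cpoly" where
  "pluecker_map = poly_subst minor"

definition pluecker_ideal :: "nat \<Rightarrow> nat list \<Rightarrow> nat list cpoly set" where
  "pluecker_ideal n d = a_kernel (pluecker_ring n d) (matrix_poly_ring n) pluecker_map"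

definition pluecker_algebra :: "nat \<Rightarrow> nat list \<Rightarrow> nat list cpoly set ring" where
  "pluecker_algebra n d = pluecker_ring n d Quot pluecker_ideal n d"

definition pluecker_proj :: "nat \<Rightarrow> nat list \<Rightarrow> nat list cpoly \<Rightarrow> nat list cpoly set" where
  "pluecker_proj n d p = pluecker_ideal n d +>\<^bsub>pluecker_ring n d\<^esub> p"

definition pluecker_scalars :: "nat \<Rightarrow> nat list \<Rightarrow> nat list cpoly set set" where
  "pluecker_scalars n d = range (\<lambda>c. pluecker_proj n d (cconst c))"

text \<open>Bases, possibly infinite, of a ring \<open>R\<close> as a vector space over a subfield \<open>K\<close>.\<close>

definition vs_basis :: "('a, 'b) ring_scheme \<Rightarrow> 'a set \<Rightarrow> 'a set \<Rightarrow> bool" where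
  "vs_basis R K B \<longleftrightarrow>
     B \<subseteq> carrier R \<and>
     (\<forall>us. distinct us \<and> set us \<subseteq> B \<longrightarrow> ring.independent R K us) \<and>
     carrier R = (\<Union>us\<in>{us. set us \<subseteq> B}. ring.Span R K us)"

definition tableau_monomial :: "nat list list \<Rightarrow> nat list cpoly" where
  "tableau_monomial Y = prod_list (map pluecker_var Y)"

definition semistandard_monomials ::
    "nat \<Rightarrow> (nat \<times> nat) set \<Rightarrow> nat list \<Rightarrow> nat list cpoly set" where
  "semistandard_monomials n U d =
     {tableau_monomial Y | Y. oc_semistandard n U Y \<and> length ` set Y \<subseteq> set d}"


section \<open>Polytopes\<close>

text \<open>
  The space of real vectors indexed by a finite set \<open>S\<close> is represented by the finitely supported
  real functions vanishing outside \<open>S\<close>.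
\<close>

definition coord_vec :: "'a set \<Rightarrow> ('a \<Rightarrow> real) \<Rightarrow> 'a \<Rightarrow>\<^sub>0 real" where
  "coord_vec S f = (\<Sum>p\<in>S. Poly_Mapping.single p (f p))"

lemma lookup_coord_vec:
  assumes "finite S"
  shows "Poly_Mapping.lookup (coord_vec S f) p = (if p \<in> S then f p else 0)"
  using assms by (simp add: coord_vec_def lookup_sum lookup_single when_def)

definition ideal_point :: "nat \<Rightarrow> (nat \<times> nat) set \<Rightarrow> (nat \<times> nat) set \<Rightarrow> (nat \<times> nat) \<Rightarrow>\<^sub>0 real" where
  "ideal_point n U J = coord_vec (posetP n) (\<lambda>p. if p \<in> ideal_marks n U J then 1 else 0)"

definition fundamental_polytope ::
    "nat \<Rightarrow> (nat \<times> nat) set \<Rightarrow> nat \<Rightarrow> ((nat \<times> nat) \<Rightarrow>\<^sub>0 real) set" where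
  "fundamental_polytope n U k = convex hull (ideal_point n U ` order_ideals_k n k)"

text \<open>The sum below is the Minkowski sum of sets.\<close>

definition marked_chain_order_polytope ::
    "nat \<Rightarrow> (nat \<times> nat) set \<Rightarrow> (nat \<Rightarrow> nat) \<Rightarrow> ((nat \<times> nat) \<Rightarrow>\<^sub>0 real) set" where
  "marked_chain_order_polytope n U a =
     (\<Sum>k\<in>{1..n - 1}. (\<lambda>x. real (a k) *\<^sub>R x) ` fundamental_polytope n U k)"

definition tableau_point :: "nat \<Rightarrow> nat list list \<Rightarrow> (nat \<times> nat) \<Rightarrow>\<^sub>0 real" where
  "tableau_point n Y =
     coord_vec ({1..n - 1} \<times> {1..n})
       (\<lambda>(i, j). real (card {c \<in> {1..length Y}. i \<le> col_height Y c \<and> entry Y c i = j}))"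

definition tableau_polytope ::
    "nat \<Rightarrow> (nat \<times> nat) set \<Rightarrow> (nat \<Rightarrow> nat) \<Rightarrow> ((nat \<times> nat) \<Rightarrow>\<^sub>0 real) set" where
  "tableau_polytope n U a =
     convex hull {tableau_point n Y | Y. oc_semistandard n U Y \<and> has_shape n a Y}"

definition integer_points :: "('a \<Rightarrow>\<^sub>0 real) set" where
  "integer_points = {x. \<forall>p. Poly_Mapping.lookup x p \<in> \<int>}"

definition unimodularly_equivalent ::
    "('a \<Rightarrow>\<^sub>0 real) set \<Rightarrow> ('b \<Rightarrow>\<^sub>0 real) set \<Rightarrow> bool" where
  "unimodularly_equivalent Q Q' \<longleftrightarrow>
     (\<exists>f. bij_betw f (affine hull Q) (affine hull Q') \<and>
          (\<forall>x\<in>affine hull Q. \<forall>y\<in>affine hull Q. \<forall>u.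
             f ((1 - u) *\<^sub>R x + u *\<^sub>R y) = (1 - u) *\<^sub>R f x + u *\<^sub>R f y) \<and>
          f ` Q = Q' \<and>
          f ` (affine hull Q \<inter> integer_points) = affine hull Q' \<inter> integer_points)"

end

theory Submission
  imports Defs
begin

text \<open>
  The permutations \<open>\<sigma>\<^sub>i\<close> have a simple description: \<open>r(i,-)\<close> is the product \<open>u\<^sub>i\<close> of the row
  permutations of the order part above row \<open>i\<close> (\<open>rfun_eq_rows_above\<close>), and passing from
  \<open>\<sigma>\<^sub>i\<close> to \<open>\<sigma>\<^sub>i\<^sub>+\<^sub>1\<close> rotates the order elements of row \<open>i\<close> together with the diagonal. For a tuple
  \<open>t\<close> put \<open>e\<^sub>j = \<sigma>\<^sub>j(t\<^sub>j)\<close>. The conditions on a tuple say exactly that \<open>e\<^sub>j\<close> is the last mark in row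
  \<open>j\<close> of the ideal \<open>J(t)\<close> generated by all \<open>(j, e\<^sub>j)\<close>. In this way the tuples of length \<open>k\<close>
  correspond to the ideals with \<open>k\<close> diagonal elements, and the semistandard tableaux to the
  decreasing chains of ideals.

  For the basis, each variable \<open>z\<^sub>i\<^sub>,\<^sub>a\<close> is given a weight that grows geometrically with \<open>i\<close> and, within
  a row, favours small \<open>\<sigma>\<^sub>i(a) \<ge> i\<close>. With respect to it the minor of every tuple has the diagonal term as
  leading term (\<open>leads_minor\<close>), so a product of minors has the point \<open>x(Y)\<close> of its tableau as
  leading exponent. A linear unitriangular map takes \<open>x(Y)\<close> to the sum of the indicators of the marks
  of the ideals of the columns, and a chain of ideals can be recovered from these numbers of marks.
  Hence different semistandard tableaux have different leading exponents, and their products of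
  minors are linearly independent.

  That they also span follows by counting. Classical straightening shows that the products over
  the classical semistandard tableaux of a shape span all products of minors of this shape
  (\<open>minor_product_in_span_classical\<close>). The classical tableaux correspond to chains of ideals as well,
  so there are no more of them than there are semistandard tableaux of the new kind
  (\<open>span_classical_subset_standard\<close>).

  For the polytopes, the unitriangular map takes the points of the semistandard tableaux of shape
  \<open>\<lambda>\<close> to the sums of vertices of the fundamental polytopes over chains of ideals. The marked
  chain-order polytope is the convex hull of the sums over arbitrary families of ideals. These are
  the same sums: the product of minors of an arbitrary family of tuples is a combination of
  standard products, so its leading exponent is the exponent of one of them
  (\<open>exponent_is_standard\<close>).
\<close>

section \<open>The permutations attached to the rows\<close>

definition row_cycle :: "nat \<Rightarrow> nat list \<Rightarrow> nat \<Rightarrow> nat" where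
  "row_cycle i js = foldr (\<lambda>j f. Transposition.transpose i j \<circ> f) js id"

lemma row_cycle_simps [simp]:
  "row_cycle i [] = id"
  "row_cycle i (j # js) = Transposition.transpose i j \<circ> row_cycle i js"
  by (simp_all add: row_cycle_def)

lemma row_cycle_append: "row_cycle i (js @ ks) = row_cycle i js \<circ> row_cycle i ks"
  by (induction js) (simp_all add: comp_assoc)

lemma row_cycle_permutes: "row_cycle i js permutes insert i (set js)"
proof (induction js)
  case Nil
  show ?case by (simp only: row_cycle_simps permutes_id)
next
  case (Cons j js)
  have "row_cycle i js permutes insert i (set (j # js))"
    using Cons by (rule permutes_subset) auto
  then show ?case
    by (auto intro!: permutes_compose permutes_swap_id simp del: comp_apply)
qed

text \<open>
  Read backwards, the product is a single cycle: it takes \<open>i\<close> to the first element of the list, each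
  element of the list to the next one, and the last one to \<open>i\<close>. Stating this by inequalities avoids
  any reference to list indices.
\<close>

lemma row_cycle_next:
  assumes "sorted_wrt (<) js" "\<forall>j\<in>set js. i < j" "y \<in> insert i (set js)"
  defines "x \<equiv> row_cycle i js y"
  shows "y = i \<and> (\<forall>v\<in>set js. v \<le> x) \<or>
         y \<in> set js \<and> x < y \<and> (\<forall>v\<in>set js. v \<le> x \<or> y \<le> v)"
  using assms(1-3) unfolding x_def
proof (induction js)
  case Nil
  then show ?case by simp
next
  case (Cons j js)
  let ?x = "row_cycle i js y"
  show ?case
  proof (cases "y = j")
    case True
    have "j \<notin> insert i (set js)" using Cons.prems by auto
    then have "?x = j" using row_cycle_permutes[of i js] True by (simp add: permutes_not_in)
    then show ?thesis using True Cons.prems by auto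
  next
    case False
    then have y: "y \<in> insert i (set js)" using Cons.prems by auto
    then have x: "?x \<in> insert i (set js)"
      using permutes_in_image[OF row_cycle_permutes[of i js]] by simp
    have IH: "y = i \<and> (\<forall>v\<in>set js. v \<le> ?x) \<or>
         y \<in> set js \<and> ?x < y \<and> (\<forall>v\<in>set js. v \<le> ?x \<or> y \<le> v)"
      using Cons.prems y by (intro Cons.IH) auto
    show ?thesis
    proof (cases "?x = i")
      case True
      then show ?thesis using IH Cons.prems by force
    next
      case False
      then have xj: "?x \<in> set js" "j < ?x" using x Cons.prems by auto
      then have "row_cycle i (j # js) y = ?x"
        using False by (simp add: transpose_apply_other)
      then show ?thesis using IH xj by auto
    qed
  qed
qed

definition row_perm :: "nat \<Rightarrow> (nat \<times> nat) set \<Rightarrow> nat \<Rightarrow> nat \<Rightarrow> nat" where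
  "row_perm n M i = row_cycle i [j \<leftarrow> [Suc i..<Suc n]. (i, j) \<in> M]"

definition rows_above :: "nat \<Rightarrow> (nat \<times> nat) set \<Rightarrow> nat \<Rightarrow> nat \<Rightarrow> nat" where
  "rows_above n M i = foldr (\<lambda>i f. row_perm n M i \<circ> f) [1..<i] id"

lemma rows_above_1 [simp]: "rows_above n M (Suc 0) = id"
  by (simp add: rows_above_def)

lemma foldr_comp_id: "foldr (\<lambda>i f. g i \<circ> f) xs h = foldr (\<lambda>i f. g i \<circ> f) xs id \<circ> h"
  by (induction xs) (simp_all add: comp_assoc)

lemma rows_above_Suc:
  "1 \<le> i \<Longrightarrow> rows_above n M (Suc i) = rows_above n M i \<circ> row_perm n M i"
  by (simp add: rows_above_def foldr_comp_id[of _ _ "row_perm n M i"])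

lemma perm_of_eq_rows_above: "perm_of n M = rows_above n M (Suc n)"
proof -
  let ?F = "\<lambda>(i, j) f. Transposition.transpose i j \<circ> f"
  have row: "foldr ?F (concat (map (\<lambda>j. if (i, j) \<in> M then [(i, j)] else []) js)) f
      = row_cycle i [j \<leftarrow> js. (i, j) \<in> M] \<circ> f" for i :: nat and js f
    by (induction js) (auto simp: comp_assoc)
  have diag: "row_cycle i [j \<leftarrow> [i..<Suc n]. (i, j) \<in> M] = row_perm n M i"
    if "i \<in> set [1..<Suc n]" for i
    using that by (auto simp: row_perm_def upt_conv_Cons simp del: upt_Suc)
  have all: "foldr ?F (concat (map (\<lambda>i. concat (map (\<lambda>j. if (i, j) \<in> M then [(i, j)] else [])
        [i..<Suc n])) is)) id = foldr (\<lambda>i f. row_perm n M i \<circ> f) is id"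
    if "set is \<subseteq> set [1..<Suc n]" for "is"
    using that
  proof (induction "is")
    case (Cons i "is")
    let ?row = "\<lambda>i. concat (map (\<lambda>j. if (i, j) \<in> M then [(i, j)] else []) [i..<Suc n])"
    have i: "i \<in> set [1..<Suc n]" and sub: "set is \<subseteq> set [1..<Suc n]" using Cons.prems by auto
    have "foldr ?F (concat (map ?row (i # is))) id
        = foldr ?F (?row i) (foldr ?F (concat (map ?row is)) id)" by simp
    also have "\<dots> = row_perm n M i \<circ> foldr ?F (concat (map ?row is)) id"
      by (simp only: row diag[OF i])
    also have "\<dots> = row_perm n M i \<circ> foldr (\<lambda>i f. row_perm n M i \<circ> f) is id"
      by (simp only: Cons.IH[OF sub])
    also have "\<dots> = foldr (\<lambda>i f. row_perm n M i \<circ> f) (i # is) id" by simp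
    finally show ?case .
  qed simp
  show ?thesis
    unfolding perm_of_def rows_above_def by (rule all) simp
qed

lemma row_perm_permutes: "1 \<le> i \<Longrightarrow> i \<le> n \<Longrightarrow> row_perm n M i permutes {i..n}"
  unfolding row_perm_def by (rule permutes_subset[OF row_cycle_permutes]) auto

lemma rows_above_permutes: "i \<le> Suc n \<Longrightarrow> rows_above n M i permutes {1..n}"
proof (induction i)
  case 0
  have "rows_above n M 0 = id" by (simp add: rows_above_def)
  then show ?case by (simp only: permutes_id)
next
  case (Suc i)
  show ?case
  proof (cases "i = 0")
    case True
    then show ?thesis by (simp only: rows_above_1 permutes_id)
  next
    case False
    have "row_perm n M i permutes {1..n}"
      using False Suc.prems by (intro permutes_subset[OF row_perm_permutes]) auto
    moreover have "rows_above n M i permutes {1..n}" using Suc by simp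
    moreover have "rows_above n M (Suc i) = rows_above n M i \<circ> row_perm n M i"
      using False by (intro rows_above_Suc) simp
    ultimately show ?thesis by (simp only: permutes_compose)
  qed
qed

lemma row_perm_next:
  assumes "y = i \<or> (i, y) \<in> M \<and> i < y \<and> y \<le> n"
  defines "x \<equiv> row_perm n M i y"
  shows "y = i \<and> (\<forall>v. (i, v) \<in> M \<and> i < v \<and> v \<le> n \<longrightarrow> v \<le> x) \<or>
         (i, y) \<in> M \<and> i < y \<and> y \<le> n \<and> x < y \<and>
           (\<forall>v. (i, v) \<in> M \<and> i < v \<and> v \<le> n \<longrightarrow> v \<le> x \<or> y \<le> v)"
proof -
  let ?js = "[j \<leftarrow> [Suc i..<Suc n]. (i, j) \<in> M]"
  have set: "set ?js = {v. (i, v) \<in> M \<and> i < v \<and> v \<le> n}" by auto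
  have "sorted_wrt (<) ?js" by (intro sorted_wrt_filter) (simp only: sorted_wrt_upt)
  then have "y = i \<and> (\<forall>v\<in>set ?js. v \<le> x) \<or>
         y \<in> set ?js \<and> x < y \<and> (\<forall>v\<in>set ?js. v \<le> x \<or> y \<le> v)"
    unfolding x_def row_perm_def using assms(1)
    by (intro row_cycle_next) (auto simp del: upt_Suc)
  then show ?thesis unfolding set by auto
qed

lemma row_perm_fix: "x \<noteq> i \<Longrightarrow> (i, x) \<notin> M \<Longrightarrow> row_perm n M i x = x"
  unfolding row_perm_def by (rule permutes_not_in[OF row_cycle_permutes]) auto

text \<open>
  Truncating the rows to columns at most \<open>j\<close> does not change the orbit of a value that is at
  most \<open>j\<close>: in its row, a value right of the diagonal moves only to the left.
\<close>

lemma row_perm_le: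
  assumes "i < x" "x \<le> n" "1 \<le> i"
  shows "row_perm n M i x \<le> x" "i \<le> row_perm n M i x"
proof -
  have "row_perm n M i x \<le> x \<and> i \<le> row_perm n M i x"
  proof (cases "(i, x) \<in> M")
    case True
    then have "row_perm n M i x \<le> x" using row_perm_next[of x i M n] assms by auto
    moreover have "row_perm n M i x \<in> {i..n}"
      using permutes_in_image[OF row_perm_permutes[of i n M], of x] assms by simp
    ultimately show ?thesis by simp
  qed (use assms row_perm_fix in auto)
  then show "row_perm n M i x \<le> x" "i \<le> row_perm n M i x" by auto
qed

lemma row_perm_truncate:
  assumes "\<And>v. i < v \<Longrightarrow> v \<le> n \<Longrightarrow> (i, v) \<in> M' \<longleftrightarrow> (i, v) \<in> M \<and> v \<le> j"
    and "i < x" "x \<le> j" "j \<le> n"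
  shows "row_perm n M' i x = row_perm n M i x"
proof -
  let ?js = "[v \<leftarrow> [Suc i..<Suc j]. (i, v) \<in> M]" and ?ks = "[v \<leftarrow> [Suc j..<Suc n]. (i, v) \<in> M]"
  have split: "[Suc i..<Suc n] = [Suc i..<Suc j] @ [Suc j..<Suc n]"
    using assms upt_add_eq_append[of "Suc i" "Suc j" "n - j"] by simp
  have 1: "[v \<leftarrow> [Suc i..<Suc j]. (i, v) \<in> M'] = ?js"
    using assms by (intro filter_cong) auto
  have 2: "[v \<leftarrow> [Suc j..<Suc n]. (i, v) \<in> M'] = []"
    using assms by (auto simp: filter_empty_conv simp del: upt_Suc)
  have "row_cycle i ?ks x = x"
    by (rule permutes_not_in[OF row_cycle_permutes]) (use assms in auto)
  then show ?thesis
    unfolding row_perm_def split by (simp add: 1 2 row_cycle_append del: upt_Suc)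
qed

lemma rows_above_truncate:
  assumes "\<And>i' v. 1 \<le> i' \<Longrightarrow> i' < i \<Longrightarrow> i' < v \<Longrightarrow> v \<le> n \<Longrightarrow>
      (i', v) \<in> M' \<longleftrightarrow> (i', v) \<in> M \<and> v \<le> j"
    and "i \<le> x" "x \<le> j" "j \<le> n"
  shows "rows_above n M' i x = rows_above n M i x"
  using assms
proof (induction i arbitrary: x)
  case 0
  then show ?case by (simp add: rows_above_def)
next
  case (Suc i)
  show ?case
  proof (cases "i = 0")
    case False
    have "row_perm n M' i x = row_perm n M i x"
      using Suc.prems False by (intro row_perm_truncate[of i n M' M j]) auto
    moreover have "row_perm n M i x \<le> x" "i \<le> row_perm n M i x"
      using row_perm_le[of i x n M] Suc.prems False by auto
    moreover have "rows_above n M' i (row_perm n M i x) = rows_above n M i (row_perm n M i x)"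
      by (rule Suc.IH) (use Suc.prems calculation in auto)
    ultimately show ?thesis using False by (simp add: rows_above_Suc)
  qed simp
qed

text \<open>
  A row permutation fixes every value that is less than the number of its row.
\<close>

lemma rows_above_stable:
  assumes "1 \<le> i" "i \<le> k" "x < i"
  shows "rows_above n M k x = rows_above n M i x"
  using assms(2)
proof (induction k rule: dec_induct)
  case (step k)
  have "row_perm n M k x = x"
    unfolding row_perm_def
    by (rule permutes_not_in[OF row_cycle_permutes]) (use step assms in auto)
  then show ?case using step assms by (simp add: rows_above_Suc)
qed simp

lemma max_elems_principal_ideal:
  "p \<in> posetP n \<Longrightarrow> max_elems (principal_ideal n p) = {p}"
  unfolding max_elems_def principal_ideal_def pleq_def
  by (auto intro: prod_eqI)

text \<open>
  In the marks of the principal ideal of \<open>(i, j)\<close>, row \<open>i\<close> takes \<open>i\<close> to \<open>j\<close>, and from there on only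
  elements of the order part in columns up to \<open>j\<close> matter. So the ideals drop out of the definition
  of \<open>\<sigma>\<^sub>i\<close>.
\<close>

lemma rfun_eq_rows_above:
  assumes U: "U \<subseteq> posetP n - diagA n" and ij: "1 \<le> i" "i \<le> n" "1 \<le> j" "j \<le> n"
  shows "rfun n U i j = rows_above n U i j"
proof (cases "i \<le> j")
  case True
  let ?M = "ideal_marks n U (principal_ideal n (i, j))"
  have p: "(i, j) \<in> posetP n" using True ij by (simp add: posetP_def)
  have M: "?M = {(i', v). (i', v) \<in> posetP n \<and> i' \<le> i \<and> v \<le> j \<and> ((i', v) \<in> U \<or> i' = v)} \<union> {(i, j)}"
    unfolding ideal_marks_def max_elems_principal_ideal[OF p]
    by (auto simp: principal_ideal_def pleq_def diagA_def posetP_def)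
  have below: "rows_above n ?M (Suc n) i = rows_above n ?M (Suc i) i"
  proof (rule rows_above_stable)
  qed (use ij in auto)
  have "row_perm n ?M i i = j"
  proof (cases "i = j")
    case True
    then have "[v \<leftarrow> [Suc i..<Suc n]. (i, v) \<in> ?M] = []"
      unfolding M by (auto simp: filter_empty_conv simp del: upt_Suc)
    then show ?thesis using True by (simp add: row_perm_def)
  next
    case False
    have split: "[Suc i..<Suc n] = [Suc i..<j] @ [j] @ [Suc j..<Suc n]"
      using True False ij upt_add_eq_append[of "Suc i" "j" "Suc n - j"]
      by (simp add: upt_conv_Cons del: upt_Suc)
    have 1: "[v \<leftarrow> [Suc j..<Suc n]. (i, v) \<in> ?M] = []"
      unfolding M by (auto simp: filter_empty_conv simp del: upt_Suc)
    have 2: "(i, j) \<in> ?M" by (simp add: M)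
    have "row_cycle i [v \<leftarrow> [Suc i..<j]. (i, v) \<in> ?M] j = j"
      by (rule permutes_not_in[OF row_cycle_permutes]) (use True False in auto)
    then show ?thesis unfolding row_perm_def split using 1 2
      by (simp add: row_cycle_append del: upt_Suc)
  qed
  moreover have "rows_above n ?M i j = rows_above n U i j"
    by (rule rows_above_truncate[where j=j])
      (use U True ij in \<open>auto simp: M posetP_def diagA_def\<close>)
  ultimately show ?thesis using True below ij
    by (simp add: rfun_def perm_of_eq_rows_above rows_above_Suc)
next
  case False
  then show ?thesis using ij rows_above_stable[of i "Suc n" j n U]
    by (simp add: rfun_def perm_of_eq_rows_above)
qed


section \<open>Tuples and order ideals\<close>

definition tuple_pos :: "nat \<Rightarrow> (nat \<times> nat) set \<Rightarrow> nat list \<Rightarrow> nat \<Rightarrow> nat" where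
  "tuple_pos n U t j = sigma n U j (t ! (j - 1))"

definition tuple_ideal :: "nat \<Rightarrow> (nat \<times> nat) set \<Rightarrow> nat list \<Rightarrow> (nat \<times> nat) set" where
  "tuple_ideal n U t = {(i, v) \<in> posetP n. \<exists>l\<in>{i..length t}. v \<le> tuple_pos n U t l}"

locale order_part =
  fixes n :: nat and U :: "(nat \<times> nat) set"
  assumes n_gt_1: "n > 1" and U_subset: "U \<subseteq> posetP n - diagA n"
begin

abbreviation "pos \<equiv> tuple_pos n U"
abbreviation "ideal_of \<equiv> tuple_ideal n U"
abbreviation "tau \<equiv> rows_above n U"

lemma U_D: "(i, v) \<in> U \<Longrightarrow> 1 \<le> i \<and> i < v \<and> v \<le> n"
  using U_subset by (force simp: posetP_def diagA_def)

lemma sigma_rows_above: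
  assumes "1 \<le> i" "i \<le> n" "j \<in> {1..n}"
  shows "sigma n U i (tau i j) = j"
proof -
  have "inj_on (rfun n U i) {1..n}"
  proof (subst inj_on_cong)
    show "rfun n U i a = tau i a" if "a \<in> {1..n}" for a
      using rfun_eq_rows_above[OF U_subset] that assms by simp
    show "inj_on (tau i) {1..n}"
      using rows_above_permutes[of i n U] assms permutes_inj_on by (metis le_SucI)
  qed
  then have "inv_into {1..n} (rfun n U i) (rfun n U i j) = j"
    using assms by (intro inv_into_f_f) auto
  then show ?thesis using rfun_eq_rows_above[OF U_subset, of i j] assms by (simp add: sigma_def)
qed

lemma
  assumes "1 \<le> i" "i \<le> n" "a \<in> {1..n}"
  shows rows_above_sigma: "tau i (sigma n U i a) = a"
    and sigma_range: "sigma n U i a \<in> {1..n}"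
proof -
  have perm: "tau i permutes {1..n}" using assms by (intro rows_above_permutes) simp
  then obtain j where j: "j \<in> {1..n}" "a = tau i j"
    using assms permutes_image by (metis imageE)
  then have "sigma n U i a = j" using sigma_rows_above assms by simp
  then show "tau i (sigma n U i a) = a" "sigma n U i a \<in> {1..n}" using j by auto
qed

lemma sigma_inj:
  "1 \<le> i \<Longrightarrow> i \<le> n \<Longrightarrow> a \<in> {1..n} \<Longrightarrow> b \<in> {1..n} \<Longrightarrow> sigma n U i a = sigma n U i b \<Longrightarrow> a = b"
  using rows_above_sigma by metis

lemma row_perm_sigma_Suc:
  assumes "1 \<le> i" "i < n" "a \<in> {1..n}"
  shows "row_perm n U i (sigma n U (Suc i) a) = sigma n U i a"
proof -
  let ?y = "sigma n U (Suc i) a"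
  have y: "?y \<in> {1..n}" using assms by (intro sigma_range) auto
  have "row_perm n U i permutes {1..n}"
    using assms by (intro permutes_subset[OF row_perm_permutes]) auto
  then have z: "row_perm n U i ?y \<in> {1..n}" using permutes_in_image y by metis
  have "tau i (row_perm n U i ?y) = a"
    using rows_above_sigma[of "Suc i" a] assms by (simp add: rows_above_Suc)
  then show ?thesis using sigma_rows_above[of i "row_perm n U i ?y"] z assms by simp
qed

text \<open>
  Passing from \<open>\<sigma>\<^sub>i\<close> to \<open>\<sigma>\<^sub>i\<^sub>+\<^sub>1\<close> rotates the order elements of row \<open>i\<close>: each of them moves
  to the next one on its right, and the last one moves to the diagonal.
\<close>

lemma sigma_Suc_fix:
  assumes "1 \<le> i" "i < n" "a \<in> {1..n}" "sigma n U i a \<noteq> i" "(i, sigma n U i a) \<notin> U"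
  shows "sigma n U (Suc i) a = sigma n U i a"
proof -
  let ?y = "sigma n U (Suc i) a" and ?js = "[j \<leftarrow> [Suc i..<Suc n]. (i, j) \<in> U]"
  have "row_perm n U i ?y = sigma n U i a" using row_perm_sigma_Suc assms by simp
  moreover have "row_perm n U i ?y = ?y"
    unfolding row_perm_def
  proof (rule permutes_not_in[OF row_cycle_permutes])
    show "?y \<notin> insert i (set ?js)"
    proof
      assume "?y \<in> insert i (set ?js)"
      then have "row_perm n U i ?y \<in> insert i (set ?js)"
        unfolding row_perm_def using permutes_in_image[OF row_cycle_permutes] by metis
      then show False using row_perm_sigma_Suc[of i a] assms by (auto simp del: upt_Suc)
    qed
  qed
  ultimately show ?thesis by simp
qed

lemma sigma_Suc_next:
  assumes "1 \<le> i" "i < n" "a \<in> {1..n}" "sigma n U i a = i \<or> (i, sigma n U i a) \<in> U"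
  shows "sigma n U (Suc i) a = i \<and> (\<forall>v. (i, v) \<in> U \<longrightarrow> v \<le> sigma n U i a) \<or>
         (i, sigma n U (Suc i) a) \<in> U \<and> sigma n U i a < sigma n U (Suc i) a \<and>
           (\<forall>v. (i, v) \<in> U \<longrightarrow> v \<le> sigma n U i a \<or> sigma n U (Suc i) a \<le> v)"
proof -
  let ?y = "sigma n U (Suc i) a"
  have x: "row_perm n U i ?y = sigma n U i a" using row_perm_sigma_Suc assms by simp
  have "?y = i \<or> (i, ?y) \<in> U"
    using x assms row_perm_fix[of ?y i U n] by metis
  then have "?y = i \<or> (i, ?y) \<in> U \<and> i < ?y \<and> ?y \<le> n" using U_D by auto
  from row_perm_next[OF this] show ?thesis unfolding x using U_D by auto
qed

lemma sigma_Suc_small: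
  assumes "1 \<le> i" "i < n" "a \<in> {1..n}" "sigma n U i a < i"
  shows "sigma n U (Suc i) a = sigma n U i a"
  using sigma_Suc_fix[OF assms(1-3)] assms(4) U_D by force

lemma sigma_Suc_large:
  assumes "1 \<le> i" "i < n" "a \<in> {1..n}"
  shows "sigma n U (Suc i) a = i \<or> sigma n U i a \<le> sigma n U (Suc i) a"
  using sigma_Suc_fix[OF assms] sigma_Suc_next[OF assms] by fastforce

text \<open>
  The conditions on a tuple, expressed by its positions. They say that the position in each
  row is the mark furthest to the right which the ideal generated by all positions has in this row.
\<close>

definition position_tuple :: "nat list \<Rightarrow> bool" where
  "position_tuple t \<longleftrightarrow> 1 \<le> length t \<and> length t \<le> n - 1 \<and> set t \<subseteq> {1..n} \<and>
     (\<forall>j\<in>{1..length t}. j \<le> pos t j) \<and>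
     (\<forall>j l. 1 \<le> j \<and> j < l \<and> l \<le> length t \<longrightarrow> pos t l < pos t j \<or>
        (pos t j = j \<or> (j, pos t j) \<in> U) \<and>
          (\<forall>v. (j, v) \<in> U \<and> v \<le> pos t l \<longrightarrow> v \<le> pos t j))"

lemma tuple_nth_range:
  "set t \<subseteq> {1..n} \<Longrightarrow> 1 \<le> j \<Longrightarrow> j \<le> length t \<Longrightarrow> t ! (j - 1) \<in> {1..n}"
  using nth_mem[of "j - 1" t] by fastforce

lemma tuple_pos_range:
  "set t \<subseteq> {1..n} \<Longrightarrow> 1 \<le> j \<Longrightarrow> j \<le> length t \<Longrightarrow> length t \<le> n - 1 \<Longrightarrow> pos t j \<in> {1..n}"
  unfolding tuple_pos_def by (intro sigma_range tuple_nth_range) auto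

text \<open>
  The left-hand side is the form in which the condition on a pair of rows occurs in the definition of
  a tuple. If the position of \<open>a\<close> in row \<open>j\<close> is an order or diagonal element, then \<open>\<sigma>\<^sub>j\<^sub>+\<^sub>1(a)\<close> is the next
  order element of that row, and it exceeds \<open>w\<close> if and only if no order element lies to the right of
  the position and not beyond \<open>w\<close>. Otherwise \<open>\<sigma>\<^sub>j\<^sub>+\<^sub>1(a)\<close> is the position itself.
\<close>

lemma next_condition:
  assumes "1 \<le> j" "j < n" "a \<in> {1..n}" "j \<le> sigma n U j a" "j < w"
  shows "(sigma n U (j + 1) a = j \<or> sigma n U (j + 1) a > w) \<longleftrightarrow>
     w < sigma n U j a \<or> (sigma n U j a = j \<or> (j, sigma n U j a) \<in> U) \<and>
       (\<forall>v. (j, v) \<in> U \<and> v \<le> w \<longrightarrow> v \<le> sigma n U j a)"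
proof (cases "sigma n U j a = j \<or> (j, sigma n U j a) \<in> U")
  case True
  let ?x = "sigma n U j a" and ?y = "sigma n U (Suc j) a"
  consider "?y = j" "\<forall>v. (j, v) \<in> U \<longrightarrow> v \<le> ?x"
    | "(j, ?y) \<in> U" "?x < ?y" "\<forall>v. (j, v) \<in> U \<longrightarrow> v \<le> ?x \<or> ?y \<le> v"
    using sigma_Suc_next[OF assms(1-3) True] by blast
  then show ?thesis
  proof cases
    case 1
    then show ?thesis using True by simp
  next
    case 2
    then have "j < ?y" using U_D by blast
    show ?thesis
    proof (cases "w < ?y")
      case True
      then show ?thesis using 2 \<open>?x = j \<or> (j, ?x) \<in> U\<close> by fastforce
    next
      case False
      then show ?thesis using 2 \<open>j < ?y\<close> by (metis Suc_eq_plus1 leD less_irrefl not_le order_less_trans)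
    qed
  qed
next
  case False
  then show ?thesis using sigma_Suc_fix[OF assms(1-3)] assms by auto
qed

text \<open>
  Seen from a later row, an entry has either been moved to the left of the diagonal, where no further
  row acts on it, or it lies to the right of all later positions, because from row to row it can only
  move to the right. This separates the entries of a tuple, and it makes the diagonal term of the
  corresponding minor its leading term.
\<close>

lemma position_tuple_later:
  assumes t: "position_tuple t" and jl: "1 \<le> j" "j < l" "l \<le> length t"
  shows "sigma n U l (t ! (j - 1)) < l \<or>
     (\<forall>l'. j < l' \<and> l' \<le> length t \<longrightarrow> pos t l' < sigma n U l (t ! (j - 1)))"
proof -
  have k: "length t \<le> n - 1" and set: "set t \<subseteq> {1..n}" using t by (auto simp: position_tuple_def)
  let ?a = "t ! (j - 1)"
  have a: "?a \<in> {1..n}" using tuple_nth_range[OF set] jl by simp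
  have "Suc j \<le> l" using jl by simp
  then show ?thesis using jl(3)
  proof (induction l rule: dec_induct)
    case base
    have "sigma n U (j + 1) ?a = j \<or> sigma n U (j + 1) ?a > pos t l'"
      if "j < l'" "l' \<le> length t" for l'
    proof (subst next_condition)
      show "j \<le> sigma n U j ?a"
        using t jl base by (auto simp: position_tuple_def tuple_pos_def)
      have "l' \<le> pos t l'" using t that jl by (auto simp: position_tuple_def)
      then show "j < pos t l'" using that by simp
      show "pos t l' < sigma n U j ?a \<or> (sigma n U j ?a = j \<or> (j, sigma n U j ?a) \<in> U) \<and>
         (\<forall>v. (j, v) \<in> U \<and> v \<le> pos t l' \<longrightarrow> v \<le> sigma n U j ?a)"
        using t jl that unfolding position_tuple_def tuple_pos_def by blast
    qed (use jl base k a in auto)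
    then show ?case by auto
  next
    case (step l)
    have l: "1 \<le> l" "l < n" using step jl k by auto
    show ?case
    proof (cases "sigma n U l ?a < l")
      case True
      then show ?thesis using sigma_Suc_small[OF l a] by simp
    next
      case False
      then have "\<forall>l'. j < l' \<and> l' \<le> length t \<longrightarrow> pos t l' < sigma n U l ?a"
        using step by simp
      then show ?thesis using sigma_Suc_large[OF l a] by (auto intro: less_le_trans)
    qed
  qed
qed

lemma position_tuple_distinct:
  assumes t: "position_tuple t"
  shows "distinct t"
proof -
  have "t ! i \<noteq> t ! l" if "i < l" "l < length t" for i l
  proof
    assume eq: "t ! i = t ! l"
    have "Suc l \<le> pos t (Suc l)" using t that by (auto simp: position_tuple_def)
    moreover have "pos t (Suc l) = sigma n U (Suc l) (t ! (Suc i - 1))"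
      using eq by (simp add: tuple_pos_def)
    ultimately show False using position_tuple_later[OF t, of "Suc i" "Suc l"] that by force
  qed
  then show ?thesis by (auto simp: distinct_conv_nth) (metis nat_neq_iff)
qed

lemma oc_tuple_iff: "oc_tuple n U t \<longleftrightarrow> position_tuple t"
proof (cases "1 \<le> length t \<and> length t \<le> n - 1 \<and> set t \<subseteq> {1..n} \<and>
    (\<forall>j\<in>{1..length t}. j \<le> pos t j)")
  case True
  have "(sigma n U (j + 1) (t ! (j - 1)) = j \<or> sigma n U (j + 1) (t ! (j - 1)) > pos t l) \<longleftrightarrow>
     pos t l < pos t j \<or> (pos t j = j \<or> (j, pos t j) \<in> U) \<and>
       (\<forall>v. (j, v) \<in> U \<and> v \<le> pos t l \<longrightarrow> v \<le> pos t j)"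
    if "1 \<le> j" "j < l" "l \<le> length t" for j l
  proof -
    have "l \<le> pos t l" using True that by auto
    then show ?thesis
      using next_condition[of j "t ! (j - 1)" "pos t l"] tuple_nth_range[of t j] True that
      by (auto simp: tuple_pos_def)
  qed
  then have "oc_tuple n U t \<longleftrightarrow> distinct t \<and> position_tuple t"
    using True unfolding oc_tuple_def position_tuple_def Let_def tuple_pos_def[symmetric] by meson
  then show ?thesis using position_tuple_distinct by blast
next
  case False
  then show ?thesis unfolding oc_tuple_def position_tuple_def Let_def tuple_pos_def by meson
qed

lemma oc_tupleD:
  assumes "oc_tuple n U t"
  shows "1 \<le> length t" "length t \<le> n - 1" "length t < n" "distinct t" "set t \<subseteq> {1..n}"
    "\<And>j. 1 \<le> j \<Longrightarrow> j \<le> length t \<Longrightarrow> j \<le> pos t j"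
    "\<And>j. 1 \<le> j \<Longrightarrow> j \<le> length t \<Longrightarrow> pos t j \<le> n"
  using assms position_tuple_distinct[of t] tuple_pos_range[of t] n_gt_1
  unfolding oc_tuple_iff position_tuple_def by (auto; fastforce)+

lemma oc_tuple_cond:
  assumes "oc_tuple n U t" "1 \<le> j" "j < l" "l \<le> length t"
  shows "pos t l < pos t j \<or> (pos t j = j \<or> (j, pos t j) \<in> U) \<and>
     (\<forall>v. (j, v) \<in> U \<and> v \<le> pos t l \<longrightarrow> v \<le> pos t j)"
  using assms unfolding oc_tuple_iff position_tuple_def by blast

lemma mem_tuple_ideal:
  "(i, v) \<in> ideal_of t \<longleftrightarrow> 1 \<le> i \<and> i \<le> v \<and> v \<le> n \<and> (\<exists>l\<in>{i..length t}. v \<le> pos t l)"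
  by (auto simp: tuple_ideal_def posetP_def)

text \<open>
  An element outside the order part and the diagonal is marked only if it is maximal, hence only at
  the position of its row; conversely, such a position is maximal because all later positions are
  smaller. As a result the marks are a linear function of the indicators of the positions.
\<close>

lemma marks_tuple_ideal:
  assumes t: "oc_tuple n U t"
  shows "(i, v) \<in> ideal_marks n U (ideal_of t) \<longleftrightarrow> 1 \<le> i \<and> i \<le> length t \<and> i \<le> v \<and>
     (if (i, v) \<in> U \<union> diagA n then v \<le> pos t i else v = pos t i)"
    (is "_ \<in> ideal_marks n U ?J \<longleftrightarrow> ?R")
proof
  assume "(i, v) \<in> ideal_marks n U ?J"
  then consider "(i, v) \<in> ?J" "(i, v) \<in> U \<union> diagA n"
    | "(i, v) \<in> max_elems ?J" "(i, v) \<notin> U \<union> diagA n"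
    by (auto simp: ideal_marks_def max_elems_def)
  then show ?R
  proof cases
    case 1
    then obtain l where l: "1 \<le> i" "i \<le> v" "i \<le> l" "l \<le> length t" "v \<le> pos t l"
      by (auto simp: mem_tuple_ideal)
    have "v \<le> pos t i"
    proof (cases "l = i")
      case False
      then show ?thesis
        using oc_tuple_cond[OF t, of i l] oc_tupleD(6)[OF t, of i] l 1 by (auto simp: diagA_def)
    qed (use l in simp)
    then show ?thesis using 1 l by auto
  next
    case 2
    then have "(i, v) \<in> ?J" by (simp add: max_elems_def)
    then obtain l where l: "1 \<le> i" "i \<le> v" "i \<le> l" "l \<le> length t" "v \<le> pos t l"
      by (auto simp: mem_tuple_ideal)
    then have "(l, pos t l) \<in> ?J"
      using oc_tupleD(6,7)[OF t, of l] by (auto simp: mem_tuple_ideal)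
    then have "(i, v) = (l, pos t l)" using 2 l by (auto simp: max_elems_def pleq_def)
    then show ?thesis using 2 l by auto
  qed
next
  assume R: ?R
  have p: "i \<le> pos t i" "pos t i \<le> n" using oc_tupleD(6,7)[OF t, of i] R by auto
  then have J: "(i, v) \<in> ?J" using R by (auto simp: mem_tuple_ideal split: if_splits)
  show "(i, v) \<in> ideal_marks n U ?J"
  proof (cases "(i, v) \<in> U \<union> diagA n")
    case False
    then have v: "v = pos t i" using R by simp
    have "(i', v') = (i, v)" if q: "(i', v') \<in> ?J" "i \<le> i'" "v \<le> v'" for i' v'
    proof -
      obtain l where l: "i' \<le> l" "l \<le> length t" "v' \<le> pos t l"
        using q by (auto simp: mem_tuple_ideal)
      have "l = i"
      proof (rule ccontr)
        assume "l \<noteq> i"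
        then have "i < l" using l q by simp
        have "(i, i) \<in> diagA n" using R p by (simp add: diagA_def)
        then have "pos t i \<noteq> i" "(i, pos t i) \<notin> U" using False v by auto
        then have "pos t l < pos t i"
          using oc_tuple_cond[OF t, of i l] R \<open>i < l\<close> l by blast
        then show False using q l v by linarith
      qed
      then have "i' = i" "v' \<le> v" using l q v by auto
      then show ?thesis using q by simp
    qed
    then have "(i, v) \<in> max_elems ?J" using J by (fastforce simp: max_elems_def pleq_def)
    then show ?thesis by (simp add: ideal_marks_def)
  qed (use J in \<open>simp add: ideal_marks_def\<close>)
qed

lemma diag_tuple_ideal:
  assumes t: "oc_tuple n U t"
  shows "(i, i) \<in> ideal_of t \<longleftrightarrow> 1 \<le> i \<and> i \<le> length t"
proof
  assume "1 \<le> i \<and> i \<le> length t"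
  then show "(i, i) \<in> ideal_of t"
    using oc_tupleD(3,6)[OF t] by (auto simp: mem_tuple_ideal intro!: bexI[of _ i])
qed (auto simp: mem_tuple_ideal)

lemma card_diagonal:
  assumes diag: "\<And>i. (i, i) \<in> J \<longleftrightarrow> 1 \<le> i \<and> i \<le> k" and k: "k \<le> n"
  shows "card (J \<inter> diagA n) = k"
proof -
  have "J \<inter> diagA n = (\<lambda>i. (i, i)) ` {1..k}"
  proof (rule Set.set_eqI)
    fix p :: "nat \<times> nat"
    obtain i v where p: "p = (i, v)" by (cases p)
    show "p \<in> J \<inter> diagA n \<longleftrightarrow> p \<in> (\<lambda>i. (i, i)) ` {1..k}"
      unfolding p using diag[of i] k by (cases "i = v") (auto simp: diagA_def)
  qed
  then show ?thesis by (simp add: card_image inj_on_def)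
qed

lemma order_ideals_kI:
  assumes J: "J \<subseteq> posetP n" and diag: "\<And>i. (i, i) \<in> J \<longleftrightarrow> 1 \<le> i \<and> i \<le> k" "k \<le> n"
    and down: "\<And>i v i' v'. (i, v) \<in> J \<Longrightarrow> 1 \<le> i' \<Longrightarrow> i' \<le> v' \<Longrightarrow> i' \<le> i \<Longrightarrow> v' \<le> v \<Longrightarrow> (i', v') \<in> J"
  shows "J \<in> order_ideals_k n k"
proof -
  have "q \<in> J" if "p \<in> J" "q \<in> posetP n" "q \<preceq>\<^sub>P p" for p q
    using that down[of "fst p" "snd p" "fst q" "snd q"] by (auto simp: posetP_def pleq_def)
  then show ?thesis using J card_diagonal[OF diag] by (auto simp: order_ideals_k_def order_ideals_def)
qed

lemma order_ideal_down:
  assumes J: "J \<in> order_ideals n" "(i, v) \<in> J" and le: "1 \<le> i'" "i' \<le> v'" "i' \<le> i" "v' \<le> v"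
  shows "(i', v') \<in> J"
proof -
  have "(i, v) \<in> posetP n" using J by (auto simp: order_ideals_def)
  then have "(i', v') \<in> posetP n" using le by (auto simp: posetP_def)
  moreover have "(i', v') \<preceq>\<^sub>P (i, v)" using le by (simp add: pleq_def)
  ultimately show ?thesis using J unfolding order_ideals_def by blast
qed

lemma tuple_ideal_mem:
  assumes t: "oc_tuple n U t"
  shows "ideal_of t \<in> order_ideals_k n (length t)"
proof (rule order_ideals_kI)
  show "ideal_of t \<subseteq> posetP n" by (auto simp: tuple_ideal_def)
  show "(i, i) \<in> ideal_of t \<longleftrightarrow> 1 \<le> i \<and> i \<le> length t" for i by (rule diag_tuple_ideal[OF t])
  show "length t \<le> n" using oc_tupleD(3)[OF t] by simp
  fix i v i' v' assume iv: "(i, v) \<in> ideal_of t" and le: "1 \<le> i'" "i' \<le> v'" "i' \<le> i" "v' \<le> v"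
  then obtain l where "v \<le> n" "l \<in> {i..length t}" "v \<le> pos t l" by (auto simp: mem_tuple_ideal)
  then have "l \<in> {i'..length t}" "v' \<le> pos t l" "v' \<le> n" using le by auto
  then show "(i', v') \<in> ideal_of t" using le unfolding mem_tuple_ideal by blast
qed

text \<open>
  The position in a row is the last mark of the ideal in this row, and the length is the number of
  its diagonal elements.
\<close>

lemma tuple_ideal_inj:
  assumes t: "oc_tuple n U t" and t': "oc_tuple n U t'"
    and eq: "ideal_of t = ideal_of t'"
  shows "t = t'"
proof (rule nth_equalityI)
  have "1 \<le> i \<and> i \<le> length t \<longleftrightarrow> 1 \<le> i \<and> i \<le> length t'" for i
    using diag_tuple_ideal[OF t, of i] diag_tuple_ideal[OF t', of i] eq by metis
  from this[of "length t"] this[of "length t'"] show len: "length t = length t'"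
    using oc_tupleD(1)[OF t] oc_tupleD(1)[OF t'] by linarith
  fix j assume j: "j < length t"
  let ?i = "Suc j"
  have "(?i, pos t ?i) \<in> ideal_marks n U (ideal_of t)"
    unfolding marks_tuple_ideal[OF t] using j oc_tupleD(6)[OF t, of ?i] by auto
  then have "pos t ?i \<le> pos t' ?i"
    unfolding eq marks_tuple_ideal[OF t'] by (auto split: if_splits)
  moreover have "(?i, pos t' ?i) \<in> ideal_marks n U (ideal_of t')"
    unfolding marks_tuple_ideal[OF t'] using j len oc_tupleD(6)[OF t', of ?i] by auto
  then have "pos t' ?i \<le> pos t ?i"
    unfolding eq[symmetric] marks_tuple_ideal[OF t] by (auto split: if_splits)
  ultimately have "pos t ?i = pos t' ?i" by simp
  moreover have "t ! j \<in> {1..n}" "t' ! j \<in> {1..n}"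
    using tuple_nth_range[of t ?i] tuple_nth_range[of t' ?i] oc_tupleD(5)[OF t] oc_tupleD(5)[OF t']
      j len by auto
  ultimately show "t ! j = t' ! j"
    using sigma_inj[of ?i "t ! j" "t' ! j"] j oc_tupleD(3)[OF t] by (simp add: tuple_pos_def)
qed

lemma order_ideal_diag:
  assumes J: "J \<in> order_ideals_k n k"
  shows "(i, i) \<in> J \<longleftrightarrow> 1 \<le> i \<and> i \<le> k"
proof -
  define I where "I = {i. (i, i) \<in> J}"
  have JP: "J \<subseteq> posetP n" using J by (auto simp: order_ideals_k_def order_ideals_def)
  then have I: "I \<subseteq> {1..n}" by (auto simp: I_def posetP_def)
  then have fin: "finite I" by (rule finite_subset) simp
  have "J \<inter> diagA n = (\<lambda>i. (i, i)) ` I" using JP by (auto simp: I_def diagA_def posetP_def)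
  moreover have "card ((\<lambda>i. (i, i)) ` I) = card I" by (subst card_image) (auto simp: inj_on_def)
  ultimately have card: "card I = k" using J by (simp add: order_ideals_k_def)
  have ideal: "J \<in> order_ideals n" using J by (simp add: order_ideals_k_def)
  have down: "{1..i} \<subseteq> I" if "i \<in> I" for i
    using that order_ideal_down[OF ideal, of i i] by (auto simp: I_def)
  have "I = {1..k}"
  proof (cases "I = {}")
    case False
    then have "Max I \<in> I" "\<And>i. i \<in> I \<Longrightarrow> i \<le> Max I" using fin by auto
    then have "I = {1..Max I}" using down[of "Max I"] I by fastforce
    then show ?thesis using card by (metis card_atLeastAtMost add_diff_cancel_right' Suc_eq_plus1)
  qed (use card in auto)
  moreover have "(i, i) \<in> J \<longleftrightarrow> i \<in> I" by (simp add: I_def)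
  ultimately show ?thesis by simp
qed

text \<open>
  Conversely, every ideal comes from a tuple. If the last element of row \<open>i\<close> is maximal, it is the
  position \<open>e i\<close>; otherwise \<open>e i\<close> is the last order or diagonal element of the row.
\<close>

lemma order_ideal_tuple:
  assumes J: "J \<in> order_ideals_k n k" and k: "1 \<le> k" "k \<le> n - 1"
  obtains t where "oc_tuple n U t" "length t = k" "ideal_of t = J"
proof -
  have JP: "J \<subseteq> posetP n" using J by (auto simp: order_ideals_k_def order_ideals_def)
  have "J \<in> order_ideals n" using J by (simp add: order_ideals_k_def)
  note down = order_ideal_down[OF this]
  define m where "m i = Max {v. (i, v) \<in> J}" for i
  have fin: "finite {v. (i, v) \<in> J}" for i
    by (rule finite_subset[of _ "{1..n}"]) (use JP in \<open>auto simp: posetP_def\<close>)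
  have diag: "(i, i) \<in> J" if "1 \<le> i" "i \<le> k" for i using order_ideal_diag[OF J] that by simp
  have mJ: "(i, m i) \<in> J" if "1 \<le> i" "i \<le> k" for i
    using Max_in[OF fin, of i] diag[OF that] by (auto simp: m_def)
  have mmax: "v \<le> m i" if "(i, v) \<in> J" for i v
    using Max_ge[OF fin] that by (simp add: m_def)
  have m_range: "i \<le> m i" "m i \<le> n" if "1 \<le> i" "i \<le> k" for i
    using mJ[OF that] JP by (auto simp: posetP_def)
  define e where "e i = (if (Suc i, m i) \<in> J then Max {v. (v = i \<or> (i, v) \<in> U) \<and> v \<le> m i} else m i)" for i
  have e1: "(Suc i, m i) \<notin> J \<Longrightarrow> e i = m i" for i by (simp add: e_def)
  have e2: "e i = i \<or> (i, e i) \<in> U" "e i \<le> m i" "\<And>v. v = i \<or> (i, v) \<in> U \<Longrightarrow> v \<le> m i \<Longrightarrow> v \<le> e i"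
    if "1 \<le> i" "i \<le> k" "(Suc i, m i) \<in> J" for i
  proof -
    let ?E = "{v. (v = i \<or> (i, v) \<in> U) \<and> v \<le> m i}"
    have fE: "finite ?E" by (rule finite_subset[of _ "{..m i}"]) auto
    have eq: "e i = Max ?E" using that by (simp add: e_def)
    have "i \<in> ?E" using m_range(1)[of i] that by simp
    then have "Max ?E \<in> ?E" using fE by (intro Max_in) auto
    then show "e i = i \<or> (i, e i) \<in> U" "e i \<le> m i" unfolding eq by auto
    show "v \<le> e i" if "v = i \<or> (i, v) \<in> U" "v \<le> m i" for v
      unfolding eq using fE that by (intro Max_ge) auto
  qed
  have e_le: "e i \<le> m i" and e_ge: "i \<le> e i" if "1 \<le> i" "i \<le> k" for i
  proof -
    show "e i \<le> m i" using e1[of i] e2(2)[of i] that by (cases "(Suc i, m i) \<in> J") auto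
    show "i \<le> e i"
      using e1[of i] e2(3)[of i i] m_range[of i] that by (cases "(Suc i, m i) \<in> J") auto
  qed
  define t where "t = map (\<lambda>i. tau i (e i)) [1..<Suc k]"
  have len: "length t = k" by (simp add: t_def)
  have e_range: "e i \<in> {1..n}" if "1 \<le> i" "i \<le> k" for i
    using e_le[OF that] e_ge[OF that] m_range[OF that] that by simp
  have pos: "pos t i = e i" if "1 \<le> i" "i \<le> k" for i
  proof -
    have "t ! (i - 1) = tau i (e i)"
      using that by (auto simp: t_def nth_append simp del: upt_Suc)
    then show ?thesis using sigma_rows_above[of i "e i"] that k e_range[OF that] by (simp add: tuple_pos_def)
  qed
  have "position_tuple t"
    unfolding position_tuple_def len
  proof (intro conjI ballI allI impI)
    show "set t \<subseteq> {1..n}"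
    proof
      fix a assume "a \<in> set t"
      then obtain i where i: "1 \<le> i" "i \<le> k" "a = tau i (e i)"
        by (auto simp: t_def simp del: upt_Suc)
      moreover have "tau i permutes {1..n}" using i k by (intro rows_above_permutes) simp
      ultimately show "a \<in> {1..n}" using permutes_in_image e_range by metis
    qed
    fix j l assume jl: "1 \<le> j \<and> j < l \<and> l \<le> k"
    have ml: "(l, m l) \<in> J" "l \<le> m l" "e l \<le> m l" using mJ[of l] m_range[of l] e_le[of l] jl by auto
    have "(j, m l) \<in> J" "(Suc j, m l) \<in> J" using down[OF ml(1)] ml jl by auto
    then have mjl: "m l \<le> m j" "(Suc j, m j) \<notin> J \<Longrightarrow> m l \<noteq> m j" using mmax by auto
    show "pos t l < pos t j \<or> (pos t j = j \<or> (j, pos t j) \<in> U) \<and>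
          (\<forall>v. (j, v) \<in> U \<and> v \<le> pos t l \<longrightarrow> v \<le> pos t j)"
    proof (cases "(Suc j, m j) \<in> J")
      case True
      then show ?thesis using e2[of j] jl ml mjl pos[of j] pos[of l] by auto
    next
      case False
      then show ?thesis using e1[of j] jl ml mjl pos[of j] pos[of l] by auto
    qed
  qed (use k pos e_ge in auto)
  then have oc: "oc_tuple n U t" by (simp add: oc_tuple_iff)
  have "(i, v) \<in> ideal_of t \<longleftrightarrow> (i, v) \<in> J" for i v
  proof
    assume "(i, v) \<in> ideal_of t"
    then obtain l where l: "1 \<le> i" "i \<le> v" "i \<le> l" "l \<le> k" "v \<le> e l"
      using pos len by (auto simp: mem_tuple_ideal)
    then show "(i, v) \<in> J" using down[OF mJ[of l]] e_le[of l] by auto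
  next
    assume iv: "(i, v) \<in> J"
    then have r: "1 \<le> i" "i \<le> v" "v \<le> n" using JP by (auto simp: posetP_def)
    then have "(i, i) \<in> J" using down[OF iv] by auto
    then have ik: "i \<le> k" using order_ideal_diag[OF J] by simp
    \<comment> \<open>The lowest row that the last column of row \<open>i\<close> meets has its maximal element there.\<close>
    define l where "l = Max {l. (l, m i) \<in> J}"
    have finl: "finite {l. (l, m i) \<in> J}"
      by (rule finite_subset[of _ "{1..n}"]) (use JP in \<open>auto simp: posetP_def\<close>)
    have "(l, m i) \<in> J" using Max_in[OF finl] mJ[OF r(1) ik] unfolding l_def by blast
    have il: "i \<le> l" using Max_ge[OF finl] mJ[OF r(1) ik] unfolding l_def by blast
    have "(Suc l, m i) \<notin> J" using Max_ge[OF finl, of "Suc l"] unfolding l_def by auto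
    have "l \<le> m i" using \<open>(l, m i) \<in> J\<close> JP by (auto simp: posetP_def)
    then have "(l, l) \<in> J" using down[OF \<open>(l, m i) \<in> J\<close>] r il by auto
    then have lk: "1 \<le> l" "l \<le> k" using order_ideal_diag[OF J] by auto
    have "(i, m l) \<in> J" using down[OF mJ[OF lk]] r il m_range[OF lk] by auto
    then have "m l = m i" using mmax[of i "m l"] mmax[OF \<open>(l, m i) \<in> J\<close>] by simp
    then have "e l = m i" using e1[of l] \<open>(Suc l, m i) \<notin> J\<close> by simp
    then have "v \<le> pos t l" using mmax[OF iv] pos lk by simp
    then show "(i, v) \<in> ideal_of t" using r il lk len by (auto simp: mem_tuple_ideal)
  qed
  then have "ideal_of t = J" by auto
  then show thesis using that oc len by blast
qed

end

section \<open>Complex polynomials as a vector space\<close>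

abbreviation "lookup \<equiv> Poly_Mapping.lookup"
abbreviation "keys \<equiv> Poly_Mapping.keys"
abbreviation "single \<equiv> Poly_Mapping.single"

definition cscale :: "complex \<Rightarrow> 'v cpoly \<Rightarrow> 'v cpoly" where
  "cscale c p = cconst c * p"

lemma cconst_simps [simp]:
  "cconst 0 = 0" "cconst 1 = 1" "cconst (a + b) = cconst a + cconst b"
  "cconst (a * b) = cconst a * cconst b" "cconst (- a) = - cconst a"
  by (simp_all add: cconst_def single_add mult_single single_uminus)

lemma cconst_of_int: "cconst (of_int k) = of_int k"
  by (simp add: cconst_def)

lemma cconst_of_nat: "cconst (of_nat k) = of_nat k"
  by (simp add: cconst_def)

interpretation cpoly: vector_space "cscale :: complex \<Rightarrow> 'v cpoly \<Rightarrow> 'v cpoly"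
  by unfold_locales (simp_all add: cscale_def algebra_simps)

lemma cscale_mult: "cscale c p * q = cscale c (p * q)"
  by (simp add: cscale_def mult.assoc)

lemma span_mult_right:
  assumes "p \<in> cpoly.span S" "\<And>s. s \<in> S \<Longrightarrow> s * r \<in> cpoly.span T"
  shows "p * r \<in> cpoly.span T"
  using assms(1)
proof (induction p rule: cpoly.span_induct_alt)
  case base
  then show ?case by (simp add: cpoly.span_zero)
next
  case (step c s p)
  then show ?case
    by (simp add: distrib_right cscale_mult assms(2) cpoly.span_add cpoly.span_scale)
qed

lemma lookup_cscale: "lookup (cscale c p) m = c * lookup p m"
proof -
  have "cscale c p = Poly_Mapping.map ((*) c) p"
    by (simp add: cscale_def cconst_def mult_map_scale_conv_mult)
  then show ?thesis by (simp add: map.rep_eq when_def)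
qed

lemma cpoly_eq_neg_imp_0:
  fixes p :: "'v cpoly"
  assumes "p = - p"
  shows "p = 0"
proof (rule poly_mapping_eqI)
  fix m
  have "lookup p m = - lookup p m" using assms by (metis lookup_uminus)
  then show "lookup p m = lookup 0 m" by simp
qed


section \<open>Minors and the exchange relation\<close>

definition minor_fun :: "nat \<Rightarrow> (nat \<Rightarrow> nat) \<Rightarrow> (nat \<times> nat) cpoly" where
  "minor_fun k f = Determinant.det (Matrix.mat k k (\<lambda>(r, c). cvar (r + 1, f c)))"

lemma minor_eq_minor_fun: "minor t = minor_fun (length t) (\<lambda>c. t ! c)"
  by (simp add: minor_def minor_fun_def)

lemma minor_fun_cong: "(\<And>c. c < k \<Longrightarrow> f c = g c) \<Longrightarrow> minor_fun k f = minor_fun k g"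
  unfolding minor_fun_def by (intro arg_cong[where f = Determinant.det] cong_mat) auto

lemma minor_fun_expand:
  "minor_fun k f = (\<Sum>p | p permutes {0..<k}. of_int (sign p) * (\<Prod>c<k. cvar (p c + 1, f c)))"
proof -
  let ?A = "Matrix.mat k k (\<lambda>(r, c). cvar (r + 1, f c)) :: (nat \<times> nat) cpoly mat"
  have "p c < k" if "p permutes {0..<k}" "c < k" for p c
    using permutes_in_image[OF that(1), of c] that(2) by simp
  then show ?thesis
    unfolding minor_fun_def
    by (subst det_col[of ?A k]) (auto intro!: sum.cong prod.cong arg_cong2[where f = "(*)"])
qed

lemma minor_fun_permute:
  assumes "p permutes {0..<k}"
  shows "minor_fun k (f \<circ> p) = of_int (sign p) * minor_fun k f"
proof -
  let ?A = "Matrix.mat k k (\<lambda>(c, r). cvar (r + 1, f c)) :: (nat \<times> nat) cpoly mat"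
  have tr: "minor_fun k g = Determinant.det (Matrix.mat k k (\<lambda>(c, r). cvar (r + 1, g c)))" for g
    unfolding minor_fun_def
    by (subst det_transpose[symmetric, of _ k]) (auto intro!: arg_cong[where f = Determinant.det])
  have "Matrix.mat k k (\<lambda>(c, r). cvar (r + 1, (f \<circ> p) c)) = Matrix.mat k k (\<lambda>(i, j). ?A $$ (p i, j))"
    using permutes_in_image[OF assms] by (intro cong_mat) auto
  then show ?thesis using det_permute_rows[of ?A k p] assms by (simp add: tr)
qed

lemma minor_fun_transpose:
  assumes "a < k" "b < k" "a \<noteq> b"
  shows "minor_fun k (f \<circ> Transposition.transpose a b) = - minor_fun k f"
  using assms minor_fun_permute[OF permutes_swap_id, of a k b f] by (simp add: sign_swap_id)

lemma minor_fun_not_inj: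
  assumes "\<not> inj_on f {..<k}"
  shows "minor_fun k f = 0"
proof -
  obtain a b where ab: "a < k" "b < k" "a \<noteq> b" "f a = f b" using assms by (auto simp: inj_on_def)
  have "f \<circ> Transposition.transpose a b = f" using ab by (auto simp: transpose_def)
  then show ?thesis using minor_fun_transpose[OF ab(1-3), of f] by (intro cpoly_eq_neg_imp_0) simp
qed

lemma minor_sort: "minor t \<in> {minor (sort t), - minor (sort t)}"
proof -
  obtain p where p: "p permutes {..<length (sort t)}" "permute_list p (sort t) = t"
    using mset_eq_permutation[of t "sort t"] by auto
  have "minor t = minor_fun (length t) ((\<lambda>c. sort t ! c) \<circ> p)"
    unfolding minor_eq_minor_fun
    by (rule minor_fun_cong) (use p permute_list_nth[OF p(1)] in auto)
  also have "\<dots> = of_int (sign p) * minor (sort t)"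
    using minor_fun_permute[of p "length t" "\<lambda>c. sort t ! c"] p(1)
    by (simp add: minor_eq_minor_fun lessThan_atLeast0)
  finally show ?thesis by (auto simp: sign_def)
qed

definition shuffle_term :: "nat \<Rightarrow> nat \<Rightarrow> (nat \<Rightarrow> nat) \<Rightarrow> (nat \<Rightarrow> nat) \<Rightarrow> (nat \<times> nat) cpoly" where
  "shuffle_term p q w s =
     of_int (sign s) * (minor_fun p (w \<circ> s) * minor_fun q (\<lambda>c. w (s (p + c))))"

lemma signed_sum_repeated_row:
  fixes r w :: "nat \<Rightarrow> nat"
  assumes W: "finite W" and xy: "x \<in> W" "y \<in> W" "x \<noteq> y" "r x = r y"
  shows "(\<Sum>s | s permutes W. of_int (sign s) * (\<Prod>a\<in>W. cvar (r a, w (s a)))) = (0 :: (nat \<times> nat) cpoly)"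
    (is "?S = 0")
proof (rule cpoly_eq_neg_imp_0)
  let ?t = "Transposition.transpose x y"
  let ?f = "\<lambda>s. of_int (sign s) * (\<Prod>a\<in>W. cvar (r a, w (s a))) :: (nat \<times> nat) cpoly"
  have t: "?t permutes W" using xy by (intro permutes_swap_id)
  have "?S = (\<Sum>s | s permutes W. ?f (s \<circ> ?t))"
  proof (rule sum.reindex_bij_witness[of _ "\<lambda>s. s \<circ> ?t" "\<lambda>s. s \<circ> ?t"])
    show "s \<circ> ?t \<in> {s. s permutes W}" if "s \<in> {s. s permutes W}" for s
      using that permutes_compose[OF t] by simp
    then show "s \<circ> ?t \<in> {s. s permutes W}" if "s \<in> {s. s permutes W}" for s using that .
  qed (simp_all add: comp_assoc)
  also have "\<dots> = (\<Sum>s | s permutes W. - ?f s)"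
  proof (rule sum.cong)
    fix s assume "s \<in> {s. s permutes W}"
    then have s: "permutation s" using W by (auto intro: permutes_imp_permutation)
    have "sign (s \<circ> ?t) = - sign s"
      using xy by (simp add: sign_compose[OF s] permutation_swap_id sign_swap_id)
    moreover have "(\<Prod>a\<in>W. cvar (r a, w ((s \<circ> ?t) a))) = (\<Prod>a\<in>W. cvar (r a, w (s a)) :: (nat \<times> nat) cpoly)"
    proof (rule prod.reindex_bij_witness[of _ ?t ?t])
      fix a assume "a \<in> W"
      have "r (?t a) = r a" using xy by (auto simp: transpose_def)
      then show "cvar (r (?t a), w (s (?t a))) = cvar (r a, w ((s \<circ> ?t) a))" by simp
    qed (use permutes_in_image[OF t] in auto)
    ultimately show "?f (s \<circ> ?t) = - ?f s" by simp
  qed simp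
  finally show "?S = - ?S" by (simp add: sum_negf)
qed

text \<open>
  The antisymmetrisation of a product of two minors over \<open>p + 1\<close> columns vanishes: both minors live in
  the first \<open>p\<close> rows, so in each term of the expansion two of these columns meet the same row, and
  exchanging them reverses the sign.
\<close>

lemma sum_shuffle_terms:
  assumes iq: "i < q" "q \<le> p"
  shows "(\<Sum>s | s permutes {i..p + i}. shuffle_term p q w s) = 0"
proof -
  let ?W = "{i..p + i}"
  let ?P = "{t. t permutes {0..<p}}" and ?Q = "{t. t permutes {0..<q}}"
  define r where "r t u x = (if x < p then t x + 1 else u (x - p) + 1)" for t u :: "nat \<Rightarrow> nat" and x
  define z where "z t u s x = (cvar (r t u x, w (s x)) :: (nat \<times> nat) cpoly)" for t u s x
  have expand: "shuffle_term p q w s = (\<Sum>t\<in>?P. \<Sum>u\<in>?Q. of_int (sign t) * of_int (sign u) *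
      (\<Prod>x\<in>{..<p + q} - ?W. z t u id x) * (of_int (sign s) * (\<Prod>x\<in>?W. z t u s x)))"
    if s: "s permutes ?W" for s
  proof -
    have "(\<Prod>c<p. cvar (t c + 1, (w \<circ> s) c)) * (\<Prod>c<q. cvar (u c + 1, w (s (p + c))))
      = (\<Prod>x\<in>{..<p + q} - ?W. z t u id x) * (\<Prod>x\<in>?W. z t u s x)" for t u
    proof -
      have 1: "(\<Prod>c<p. cvar (t c + 1, (w \<circ> s) c)) = (\<Prod>x\<in>{..<p}. z t u s x)"
        by (rule prod.cong) (auto simp: z_def r_def)
      have 2: "(\<Prod>c<q. cvar (u c + 1, w (s (p + c)))) = (\<Prod>x\<in>{p..<p + q}. z t u s x)"
        by (rule prod.reindex_bij_witness[of _ "\<lambda>x. x - p" "\<lambda>c. p + c"]) (auto simp: z_def r_def)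
      have "(\<Prod>x\<in>{..<p}. z t u s x) * (\<Prod>x\<in>{p..<p + q}. z t u s x) = (\<Prod>x\<in>{..<p + q}. z t u s x)"
        by (subst prod.union_disjoint[symmetric]) (auto intro!: prod.cong)
      also have "\<dots> = (\<Prod>x\<in>{..<p + q} - ?W. z t u s x) * (\<Prod>x\<in>?W. z t u s x)"
        using iq by (intro prod.subset_diff) auto
      also have "(\<Prod>x\<in>{..<p + q} - ?W. z t u s x) = (\<Prod>x\<in>{..<p + q} - ?W. z t u id x)"
        using permutes_not_in[OF s] by (intro prod.cong) (auto simp: z_def)
      finally show ?thesis using 1 2 by simp
    qed
    then show ?thesis
      unfolding shuffle_term_def minor_fun_expand
      unfolding sum_product
      unfolding sum_distrib_left
      by (intro sum.cong refl) (simp add: algebra_simps)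
  qed
  have zero: "(\<Sum>s | s permutes ?W. of_int (sign s) * (\<Prod>x\<in>?W. z t u s x)) = 0"
    if t: "t \<in> ?P" and u: "u \<in> ?Q" for t u
  proof -
    have "r t u ` ?W \<subseteq> {1..p}"
    proof
      fix y assume "y \<in> r t u ` ?W"
      then obtain x where x: "x \<in> ?W" "y = r t u x" by auto
      show "y \<in> {1..p}"
      proof (cases "x < p")
        case True
        then have "t x < p" using t permutes_in_image[of t "{0..<p}" x] by auto
        then show ?thesis using True x by (simp add: r_def)
      next
        case False
        then have "u (x - p) < q" using u iq x permutes_in_image[of u "{0..<q}" "x - p"] by auto
        then show ?thesis using False x iq by (simp add: r_def)
      qed
    qed
    then have "card (r t u ` ?W) \<le> p" using card_mono[of "{1..p}" "r t u ` ?W"] by simp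
    then have "\<not> inj_on (r t u) ?W" using card_image[of "r t u" ?W] by force
    then obtain x y where xy: "x \<in> ?W" "y \<in> ?W" "x \<noteq> y" "r t u x = r t u y"
      unfolding inj_on_def by blast
    show ?thesis unfolding z_def by (rule signed_sum_repeated_row[OF finite_atLeastAtMost xy])
  qed
  have "(\<Sum>s | s permutes ?W. shuffle_term p q w s)
     = (\<Sum>s | s permutes ?W. \<Sum>t\<in>?P. \<Sum>u\<in>?Q. of_int (sign t) * of_int (sign u) *
      (\<Prod>x\<in>{..<p + q} - ?W. z t u id x) * (of_int (sign s) * (\<Prod>x\<in>?W. z t u s x)))"
    by (rule sum.cong) (auto simp: expand)
  also have "\<dots> = (\<Sum>t\<in>?P. \<Sum>u\<in>?Q. of_int (sign t) * of_int (sign u) *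
      (\<Prod>x\<in>{..<p + q} - ?W. z t u id x) * (\<Sum>s | s permutes ?W. of_int (sign s) * (\<Prod>x\<in>?W. z t u s x)))"
    by (subst sum.swap, rule sum.cong, simp, subst sum.swap, simp add: sum_distrib_left)
  also have "\<dots> = 0" using zero by (intro sum.neutral ballI) simp
  finally show ?thesis .
qed

text \<open>
  Exchanging two positions that belong to the same minor changes the sign of this minor and the sign
  of the permutation. Hence all permutations that preserve the two blocks of columns contribute the
  same term.
\<close>

lemma shuffle_term_transpose:
  assumes g: "permutation g" and xy: "x \<noteq> y"
    and block: "x < p \<and> y < p \<or> x \<in> {p..<p + q} \<and> y \<in> {p..<p + q}"
  shows "shuffle_term p q w (g \<circ> Transposition.transpose x y) = shuffle_term p q w g"
proof -
  let ?t = "Transposition.transpose x y"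
  have sign: "sign (g \<circ> ?t) = - sign g"
    using xy by (simp add: sign_compose[OF g] permutation_swap_id sign_swap_id)
  from block show ?thesis
  proof
    assume "x < p \<and> y < p"
    then have "minor_fun p (w \<circ> (g \<circ> ?t)) = - minor_fun p (w \<circ> g)"
      using minor_fun_transpose[of x p y "w \<circ> g"] xy by (simp add: comp_assoc)
    moreover have "minor_fun q (\<lambda>c. w ((g \<circ> ?t) (p + c))) = minor_fun q (\<lambda>c. w (g (p + c)))"
      using \<open>x < p \<and> y < p\<close> by (intro minor_fun_cong) (simp add: transpose_def)
    ultimately show ?thesis by (simp add: shuffle_term_def sign)
  next
    assume B: "x \<in> {p..<p + q} \<and> y \<in> {p..<p + q}"
    have "minor_fun p (w \<circ> (g \<circ> ?t)) = minor_fun p (w \<circ> g)"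
      using B by (intro minor_fun_cong) (auto simp: transpose_def)
    moreover have "(\<lambda>c. w ((g \<circ> ?t) (p + c)))
        = (\<lambda>c. w (g (p + c))) \<circ> Transposition.transpose (x - p) (y - p)"
      using B by (auto simp: transpose_def fun_eq_iff)
    then have "minor_fun q (\<lambda>c. w ((g \<circ> ?t) (p + c))) = - minor_fun q (\<lambda>c. w (g (p + c)))"
      using minor_fun_transpose[of "x - p" q "y - p" "\<lambda>c. w (g (p + c))"] B xy by auto
    ultimately show ?thesis by (simp add: shuffle_term_def sign)
  qed
qed

lemma shuffle_term_block:
  assumes "h permutes B" "finite B" "B \<subseteq> {..<p} \<or> B \<subseteq> {p..<p + q}" "permutation g"
  shows "shuffle_term p q w (g \<circ> h) = shuffle_term p q w g"
  using assms(1,2,4)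
proof (induction h arbitrary: g rule: permutes_induct)
  case id
  then show ?case by (metis comp_id)
next
  case (swap a b h)
  let ?t = "Transposition.transpose a b"
  have "permutation (g \<circ> ?t)"
    using swap by (intro permutation_compose permutation_swap_id)
  then have "shuffle_term p q w (g \<circ> ?t \<circ> h) = shuffle_term p q w (g \<circ> ?t)"
    by (rule swap.IH)
  also have "\<dots> = shuffle_term p q w g"
    using swap assms(3) by (intro shuffle_term_transpose) auto
  finally show ?case by (simp only: comp_assoc)
qed

lemma shuffle_term_preserving:
  assumes h: "h permutes {i..p + i}" "h ` {i..<p} = {i..<p}" and iq: "i < q"
  shows "shuffle_term p q w h = shuffle_term p q w id"
proof -
  define h1 where "h1 x = (if x \<in> {i..<p} then h x else x)" for x
  define h2 where "h2 x = (if x \<in> {p..p + i} then h x else x)" for x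
  have inj: "inj h" using h(1) by (rule permutes_inj)
  then have inj_on: "inj_on h S" for S by (rule inj_on_subset) simp
  have W: "h ` {i..p + i} = {i..p + i}" using h(1) by (rule permutes_image)
  have hB: "h ` {p..p + i} \<subseteq> {p..p + i}" if "i \<le> p"
  proof
    fix y assume "y \<in> h ` {p..p + i}"
    then obtain x where x: "x \<in> {p..p + i}" "y = h x" by auto
    have "y \<in> {i..p + i}" using W x that by auto
    moreover have "y \<notin> {i..<p}"
    proof
      assume "y \<in> {i..<p}"
      then have "h x \<in> h ` {i..<p}" using h(2) x by simp
      then show False using inj x by (auto simp: inj_image_mem_iff)
    qed
    ultimately show "y \<in> {p..p + i}" by simp
  qed
  show ?thesis
  proof (cases "i \<le> p")
    case True
    have "h1 permutes {i..<p}"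
    proof (rule bij_imp_permutes)
      have "bij_betw h {i..<p} {i..<p}" using h(2) inj_on by (simp add: bij_betw_def)
      then show "bij_betw h1 {i..<p} {i..<p}" by (subst bij_betw_cong[of _ _ h]) (auto simp: h1_def)
    qed (auto simp: h1_def)
    moreover have "h2 permutes {p..p + i}"
    proof (rule bij_imp_permutes)
      have "h ` {p..p + i} = {p..p + i}"
        using hB[OF True] inj_on by (intro card_subset_eq) (simp_all add: card_image)
      then have "bij_betw h {p..p + i} {p..p + i}" using inj_on by (simp add: bij_betw_def)
      then show "bij_betw h2 {p..p + i} {p..p + i}" by (subst bij_betw_cong[of _ _ h]) (auto simp: h2_def)
    qed (auto simp: h2_def)
    moreover have "h = id \<circ> h1 \<circ> h2"
    proof
      fix x
      consider "x \<in> {i..<p}" | "x \<in> {p..p + i}" | "x \<notin> {i..p + i}" by fastforce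
      then show "h x = (id \<circ> h1 \<circ> h2) x"
      proof cases
        case 2
        then have "h x \<in> h ` {p..p + i}" by (rule imageI)
        then have "h x \<in> {p..p + i}" using hB[OF True] by blast
        then show ?thesis using 2 by (simp add: h1_def h2_def)
      next
        case 3
        then show ?thesis using permutes_not_in[OF h(1)] by (auto simp: h1_def h2_def)
      qed (auto simp: h1_def h2_def)
    qed
    moreover have "permutation (id \<circ> h1)"
      using \<open>h1 permutes {i..<p}\<close> permutes_imp_permutation[of "{i..<p}" h1] by simp
    moreover have "{p..p + i} \<subseteq> {p..<p + q}" "{i..<p} \<subseteq> {..<p}" using iq by auto
    ultimately show ?thesis
      using shuffle_term_block[of h2 "{p..p + i}" p q "id \<circ> h1" w]
        shuffle_term_block[of h1 "{i..<p}" p q id w] permutation_id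
      by (metis finite_atLeastAtMost finite_atLeastLessThan)
  next
    case False
    then have "{i..p + i} \<subseteq> {p..<p + q}" using iq by auto
    then have "shuffle_term p q w (id \<circ> h) = shuffle_term p q w id"
      by (intro shuffle_term_block[OF h(1)] permutation_id) auto
    then show ?thesis by simp
  qed
qed


text \<open>
  The columns from place \<open>i\<close> on in \<open>a\<close> and up to place \<open>i\<close> in \<open>b\<close> are one more than the first minor
  has rows, so antisymmetrising over them gives zero. Every shuffle that does not preserve the blocks
  brings one of \<open>b 0 < \<dots> < b i\<close> to the left in exchange for one of the larger \<open>a i < a (i + 1) < \<dots>\<close>;
  so it decreases the sum of the left column. Solving for the remaining, equal terms divides by their
  number.
\<close>

lemma minor_exchange:
  assumes a: "sorted_wrt (<) a" and b: "sorted_wrt (<) b"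
    and i: "i < length b" "length b \<le> length a" "b ! i < a ! i"
  defines "T \<equiv> {minor a' * minor b' | a' b'. sorted_wrt (<) a' \<and> sorted_wrt (<) b' \<and>
      length a' = length a \<and> length b' = length b \<and> set a' \<union> set b' \<subseteq> set a \<union> set b \<and>
      sum_list a' < sum_list a \<and> sum_list a' + sum_list b' = sum_list a + sum_list b}"
  shows "minor a * minor b \<in> cpoly.span T"
proof -
  let ?p = "length a" and ?q = "length b"
  define w where "w x = (if x < ?p then a ! x else b ! (x - ?p))" for x
  let ?W = "{i..?p + i}" and ?A = "{i..<?p}"
  let ?F = "shuffle_term ?p ?q w"
  let ?S1 = "{s. s permutes ?W \<and> s ` ?A = ?A}" and ?S2 = "{s. s permutes ?W \<and> s ` ?A \<noteq> ?A}"
  have fin: "finite {s. s permutes ?W}" by (simp add: finite_permutations)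
  have ip: "i < ?p" using i by simp
  have wA: "a ! i \<le> w x" if "x \<in> ?A" for x
    using that a by (cases "x = i") (auto simp: w_def sorted_wrt_iff_nth_less intro: less_imp_le)
  have wB: "w x < a ! i" if "x \<in> ?W - ?A" for x
  proof -
    have "b ! (x - ?p) \<le> b ! i"
      using that b i by (cases "x - ?p = i") (auto simp: sorted_wrt_iff_nth_less intro: less_imp_le)
    then show ?thesis using that i ip by (auto simp: w_def)
  qed
  have w_perm: "mset (map (\<lambda>x. w (s x)) [0..<?p + ?q]) = mset (a @ b)" if "s permutes ?W" for s
  proof -
    have "s permutes {0..<?p + ?q}" using that i by (intro permutes_subset[OF that]) auto
    then have "image_mset s (mset_set {0..<?p + ?q}) = mset_set {0..<?p + ?q}"
      by (rule permutes_image_mset)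
    then have perm: "image_mset s (mset [0..<?p + ?q]) = mset [0..<?p + ?q]" by simp
    have word: "map w [0..<?p + ?q] = a @ b"
      by (rule nth_equalityI) (auto simp: w_def nth_append)
    have "mset (map (\<lambda>x. w (s x)) [0..<?p + ?q]) = image_mset w (image_mset s (mset [0..<?p + ?q]))"
      by (simp only: mset_map image_mset.compositionality comp_def)
    also have "\<dots> = mset (map w [0..<?p + ?q])" by (simp only: perm mset_map)
    finally show ?thesis by (simp only: word)
  qed
  have id: "?F id = minor a * minor b"
  proof -
    have "minor_fun ?p (w \<circ> id) = minor a" "minor_fun ?q (\<lambda>c. w (id (?p + c))) = minor b"
      unfolding minor_eq_minor_fun by (auto intro!: minor_fun_cong simp: w_def)
    then show ?thesis by (simp add: shuffle_term_def)
  qed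
  have other: "?F s \<in> cpoly.span T" if s: "s permutes ?W" "s ` ?A \<noteq> ?A" for s
  proof -
    define l r where "l = map (\<lambda>x. w (s x)) [0..<?p]" and "r = map (\<lambda>x. w (s (?p + x))) [0..<?q]"
    have "minor_fun ?p (w \<circ> s) = minor l" "minor_fun ?q (\<lambda>c. w (s (?p + c))) = minor r"
      unfolding minor_eq_minor_fun by (auto intro!: minor_fun_cong simp: l_def r_def)
    then have F: "?F s = of_int (sign s) * (minor l * minor r)" by (simp add: shuffle_term_def)
    have zero: "minor t = 0" if "\<not> distinct t" for t
      unfolding minor_eq_minor_fun
      by (rule minor_fun_not_inj) (use that in \<open>auto simp: distinct_conv_nth inj_on_def\<close>)
    show ?thesis
    proof (cases "distinct l \<and> distinct r")
      case False
      then show ?thesis using zero by (auto simp: F cpoly.span_zero)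
    next
      case True
      have "[0..<?p + ?q] = [0..<?p] @ map (\<lambda>x. ?p + x) [0..<?q]"
        by (rule nth_equalityI) (auto simp: nth_append)
      then have "map (\<lambda>x. w (s x)) [0..<?p + ?q] = l @ r" by (simp add: l_def r_def)
      then have mset: "mset (l @ r) = mset (a @ b)" using w_perm[OF s(1)] by simp
      have sets: "set l \<union> set r = set a \<union> set b" using mset_eq_setD[OF mset] by simp
      have sum: "sum_list l + sum_list r = sum_list a + sum_list b"
        using arg_cong[OF mset, of sum_mset] by (simp add: sum_mset_sum_list)
      have "sum_list l < sum_list a"
      proof -
        have inj: "inj s" using s(1) by (rule permutes_inj)
        have inj_on: "inj_on s S" for S using inj by (rule inj_on_subset) simp
        have sW: "s ` ?W = ?W" using s(1) by (rule permutes_image)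
        have "s ` ?A \<subseteq> s ` ?W" by (rule image_mono) auto
        then have sub: "s ` ?A \<subseteq> ?W" using sW by simp
        have card: "card (s ` ?A) = card ?A" using inj_on by (simp add: card_image)
        have cardD: "card (s ` ?A - ?A) = card (?A - s ` ?A)"
          using card by (simp add: card_Diff_subset_Int Int_commute)
        have "s ` ?A - ?A \<noteq> {}"
          using s(2) card card_subset_eq[of ?A "s ` ?A"] by auto
        have "(\<Sum>x\<in>s ` ?A - ?A. w x) < (\<Sum>x\<in>s ` ?A - ?A. a ! i)"
          using \<open>s ` ?A - ?A \<noteq> {}\<close> sub wB by (intro sum_strict_mono) auto
        also have "\<dots> = (\<Sum>x\<in>?A - s ` ?A. a ! i)" using cardD by simp
        also have "\<dots> \<le> (\<Sum>x\<in>?A - s ` ?A. w x)" using wA by (intro sum_mono) auto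
        finally have less: "(\<Sum>x\<in>s ` ?A - ?A. w x) < (\<Sum>x\<in>?A - s ` ?A. w x)" .
        have "(\<Sum>x\<in>s ` ?A. w x) = (\<Sum>x\<in>s ` ?A - ?A. w x) + (\<Sum>x\<in>s ` ?A \<inter> ?A. w x)"
          using sum.Int_Diff[of "s ` ?A" w ?A] by simp
        moreover have "(\<Sum>x\<in>?A. w x) = (\<Sum>x\<in>?A - s ` ?A. w x) + (\<Sum>x\<in>s ` ?A \<inter> ?A. w x)"
          using sum.Int_Diff[of ?A w "s ` ?A"] by (simp add: Int_commute)
        ultimately have lt: "(\<Sum>x\<in>?A. w (s x)) < (\<Sum>x\<in>?A. w x)"
          using less inj_on by (simp add: sum.reindex)
        have split: "(\<Sum>x\<in>{0..<?p}. g x) = (\<Sum>x\<in>{0..<i}. g x) + (\<Sum>x\<in>?A. g x)" for g :: "nat \<Rightarrow> nat"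
          using ip by (simp add: sum.atLeastLessThan_concat)
        have "sum_list l = (\<Sum>x\<in>{0..<?p}. w (s x))" by (simp add: l_def sum_list_distinct_conv_sum_set)
        also have "\<dots> = (\<Sum>x\<in>{0..<i}. w (s x)) + (\<Sum>x\<in>?A. w (s x))" by (rule split)
        also have "(\<Sum>x\<in>{0..<i}. w (s x)) = (\<Sum>x\<in>{0..<i}. w x)"
          using permutes_not_in[OF s(1)] by (intro sum.cong) auto
        also have "\<dots> + (\<Sum>x\<in>?A. w (s x)) < (\<Sum>x\<in>{0..<i}. w x) + (\<Sum>x\<in>?A. w x)" using lt by simp
        also have "\<dots> = (\<Sum>x\<in>{0..<?p}. w x)" by (rule split[symmetric])
        also have "\<dots> = sum_list a" by (auto simp: sum_list_sum_nth w_def intro: sum.cong)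
        finally show ?thesis .
      qed
      moreover have "sum_list (sort t) = sum_list t" for t :: "nat list"
        by (metis mset_sort sum_mset_sum_list)
      moreover have "length l = ?p" "length r = ?q" by (simp_all add: l_def r_def)
      ultimately have "minor (sort l) * minor (sort r) \<in> T"
        unfolding T_def using True sets sum
        by (intro CollectI exI[of _ "sort l"] exI[of _ "sort r"]) (simp add: strict_sorted_iff)
      then have "minor (sort l) * minor (sort r) \<in> cpoly.span T" by (rule cpoly.span_base)
      moreover from this have "- (minor (sort l) * minor (sort r)) \<in> cpoly.span T" by (rule cpoly.span_neg)
      moreover have "?F s \<in> {minor (sort l) * minor (sort r), - (minor (sort l) * minor (sort r))}"
        using minor_sort[of l] minor_sort[of r] unfolding F sign_def by auto
      ultimately show ?thesis by auto
    qed
  qed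
  have "0 = (\<Sum>s | s permutes ?W. ?F s)" using sum_shuffle_terms[of i ?q ?p w] i by simp
  also have "\<dots> = (\<Sum>s\<in>?S1. ?F s) + (\<Sum>s\<in>?S2. ?F s)"
    using fin by (subst sum.union_disjoint[symmetric]) (auto intro!: sum.cong)
  also have "(\<Sum>s\<in>?S1. ?F s) = (\<Sum>s\<in>?S1. minor a * minor b)"
  proof (rule sum.cong)
    fix s assume "s \<in> ?S1"
    then have "?F s = ?F id" using shuffle_term_preserving[of s i ?p ?q w] i by blast
    then show "?F s = minor a * minor b" by (simp only: id)
  qed (rule refl)
  also have "\<dots> = cscale (of_nat (card ?S1)) (minor a * minor b)"
    by (simp add: cscale_def cconst_of_nat)
  finally have "cscale (of_nat (card ?S1)) (minor a * minor b) + (\<Sum>s\<in>?S2. ?F s) = 0" by (rule sym)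
  then have eq: "cscale (of_nat (card ?S1)) (minor a * minor b) = - (\<Sum>s\<in>?S2. ?F s)"
    by (simp only: eq_neg_iff_add_eq_0)
  have "(\<Sum>s\<in>?S2. ?F s) \<in> cpoly.span T" using other by (intro cpoly.span_sum) auto
  then have "cscale (of_nat (card ?S1)) (minor a * minor b) \<in> cpoly.span T"
    unfolding eq by (rule cpoly.span_neg)
  then have "cscale (1 / of_nat (card ?S1)) (cscale (of_nat (card ?S1)) (minor a * minor b)) \<in> cpoly.span T"
    by (rule cpoly.span_scale)
  moreover have "card ?S1 \<noteq> 0"
  proof -
    have "id \<in> ?S1" by (simp only: mem_Collect_eq permutes_id image_id id_apply simp_thms)
    moreover have "finite ?S1" using fin by (rule rev_finite_subset) auto
    ultimately show ?thesis by (metis card_0_eq empty_iff)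
  qed
  ultimately show ?thesis by simp
qed


section \<open>Classical straightening\<close>

definition minor_product :: "nat list list \<Rightarrow> (nat \<times> nat) cpoly" where
  "minor_product Y = prod_list (map minor Y)"

definition sorted_tableaux :: "nat \<Rightarrow> nat list \<Rightarrow> nat list list set" where
  "sorted_tableaux n ks =
     {Y. map length Y = ks \<and> (\<forall>c\<in>set Y. sorted_wrt (<) c \<and> set c \<subseteq> {1..n})}"

definition column_le :: "nat list \<Rightarrow> nat list \<Rightarrow> bool" where
  "column_le a b \<longleftrightarrow> length b \<le> length a \<and> (\<forall>j<length b. a ! j \<le> b ! j)"

definition classical_tableaux :: "nat \<Rightarrow> nat list \<Rightarrow> nat list list set" where
  "classical_tableaux n ks = {Y \<in> sorted_tableaux n ks. sorted_wrt column_le Y}"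

text \<open>
  The sum of the partial sums from the left of the column sums: it drops when a part of the sum of one
  column is moved to the next column.
\<close>

fun weighted_sum :: "nat list list \<Rightarrow> nat" where
  "weighted_sum [] = 0"
| "weighted_sum (c # Y) = sum_list c * Suc (length Y) + weighted_sum Y"

lemma weighted_sum_append:
  "length Z = length Z' \<Longrightarrow> weighted_sum Z < weighted_sum Z' \<Longrightarrow> weighted_sum (X @ Z) < weighted_sum (X @ Z')"
  by (induction X) auto

lemma transp_column_le: "transp column_le"
proof (rule transpI)
  fix a b c assume ab: "column_le a b" and bc: "column_le b c"
  have "a ! j \<le> c ! j" if "j < length c" for j
  proof -
    have "j < length b" using that bc by (simp add: column_le_def)
    then have "a ! j \<le> b ! j" using ab by (simp add: column_le_def)
    also have "\<dots> \<le> c ! j" using bc that by (simp add: column_le_def)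
    finally show ?thesis .
  qed
  then show "column_le a c" using ab bc by (simp add: column_le_def)
qed

lemma not_sorted_wrt_adjacent:
  assumes "transp R" "\<not> sorted_wrt R xs"
  obtains ys a b zs where "xs = ys @ a # b # zs" "\<not> R a b"
proof -
  obtain i where i: "Suc i < length xs" "\<not> R (xs ! i) (xs ! Suc i)"
    using assms sorted_wrt_iff_nth_Suc_transp[of R xs] by auto
  have "xs = take i xs @ xs ! i # xs ! Suc i # drop (Suc (Suc i)) xs"
    using i by (simp add: Cons_nth_drop_Suc)
  then show thesis using that i by blast
qed

text \<open>
  An adjacent pair of columns in the wrong order is replaced by the exchange relation; the weighted
  sum decreases, so this terminates.
\<close>

lemma minor_product_in_span_classical:
  assumes "sorted_wrt (\<ge>) ks" "Y \<in> sorted_tableaux n ks"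
  shows "minor_product Y \<in> cpoly.span (minor_product ` classical_tableaux n ks)"
  using assms(2)
proof (induction "weighted_sum Y" arbitrary: Y rule: less_induct)
  case less
  show ?case
  proof (cases "sorted_wrt column_le Y")
    case True
    then show ?thesis using less.prems by (intro cpoly.span_base) (auto simp: classical_tableaux_def)
  next
    case False
    then obtain X a b Z where Y: "Y = X @ a # b # Z" and ab: "\<not> column_le a b"
      using not_sorted_wrt_adjacent[OF transp_column_le] by metis
    have len: "map length Y = ks" using less.prems by (simp add: sorted_tableaux_def)
    have "length b \<le> length a" using assms(1) len by (auto simp: Y sorted_wrt_append)
    moreover from this obtain i where "i < length b" "b ! i < a ! i"
      using ab by (auto simp: column_le_def not_le)
    moreover have sorted: "sorted_wrt (<) a" "sorted_wrt (<) b" "set a \<subseteq> {1..n}" "set b \<subseteq> {1..n}"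
      using less.prems by (auto simp: sorted_tableaux_def Y)
    ultimately have ex: "minor a * minor b \<in> cpoly.span {minor a' * minor b' | a' b'.
      sorted_wrt (<) a' \<and> sorted_wrt (<) b' \<and>
      length a' = length a \<and> length b' = length b \<and> set a' \<union> set b' \<subseteq> set a \<union> set b \<and>
      sum_list a' < sum_list a \<and> sum_list a' + sum_list b' = sum_list a + sum_list b}"
      by (intro minor_exchange)
    have "(minor a * minor b) * (minor_product X * minor_product Z)
        \<in> cpoly.span (minor_product ` classical_tableaux n ks)"
    proof (rule span_mult_right[OF ex], safe)
      fix a' b' assume *: "sorted_wrt (<) a'" "sorted_wrt (<) b'" "length a' = length a"
        "length b' = length b" "set a' \<union> set b' \<subseteq> set a \<union> set b" "sum_list a' < sum_list a"
        "sum_list a' + sum_list b' = sum_list a + sum_list b"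
      let ?Y = "X @ a' # b' # Z"
      have "?Y \<in> sorted_tableaux n ks"
        using less.prems * sorted by (auto simp: sorted_tableaux_def Y)
      moreover have "weighted_sum ?Y < weighted_sum Y"
      proof -
        let ?l = "length Z"
        have eq: "sum_list c * Suc (Suc ?l) + sum_list d * Suc ?l
            = (sum_list c + sum_list d) * Suc ?l + sum_list c" for c d :: "nat list"
          by (simp add: algebra_simps)
        have "sum_list a' * Suc (Suc ?l) + sum_list b' * Suc ?l
            < sum_list a * Suc (Suc ?l) + sum_list b * Suc ?l"
          unfolding eq using * by simp
        then show ?thesis unfolding Y by (intro weighted_sum_append) auto
      qed
      ultimately have "minor_product ?Y \<in> cpoly.span (minor_product ` classical_tableaux n ks)"
        using less.hyps by blast
      then show "minor a' * minor b' * (minor_product X * minor_product Z)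
          \<in> cpoly.span (minor_product ` classical_tableaux n ks)"
        by (simp add: minor_product_def algebra_simps)
    qed
    then show ?thesis by (simp add: minor_product_def Y algebra_simps)
  qed
qed


section \<open>Substitution in polynomials\<close>

definition eval_monomial :: "('v \<Rightarrow> 'w cpoly) \<Rightarrow> ('v \<Rightarrow>\<^sub>0 nat) \<Rightarrow> 'w cpoly" where
  "eval_monomial f m = (\<Prod>v\<in>keys m. f v ^ lookup m v)"

lemma eval_monomial_superset:
  assumes "finite S" "keys m \<subseteq> S"
  shows "eval_monomial f m = (\<Prod>v\<in>S. f v ^ lookup m v)"
  unfolding eval_monomial_def
  using assms by (intro prod.mono_neutral_left) (auto simp: in_keys_iff)

lemma eval_monomial_0 [simp]: "eval_monomial f 0 = 1"
  by (simp add: eval_monomial_def)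

lemma eval_monomial_add: "eval_monomial f (m + m') = eval_monomial f m * eval_monomial f m'"
proof -
  let ?S = "keys m \<union> keys m'"
  show ?thesis
    using Poly_Mapping.keys_add[of m m']
    by (simp add: eval_monomial_superset[of ?S] lookup_add power_add prod.distrib)
qed

lemma poly_subst_superset:
  assumes "finite S" "keys p \<subseteq> S"
  shows "poly_subst f p = (\<Sum>m\<in>S. cconst (lookup p m) * eval_monomial f m)"
  unfolding poly_subst_def eval_monomial_def[symmetric]
  using assms by (intro sum.mono_neutral_left) (auto simp: in_keys_iff)

lemma poly_subst_add: "poly_subst f (p + q) = poly_subst f p + poly_subst f q"
proof -
  let ?S = "keys p \<union> keys q"
  show ?thesis
    using Poly_Mapping.keys_add[of p q]
    by (simp add: poly_subst_superset[of ?S] lookup_add distrib_right sum.distrib)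
qed

lemma poly_subst_0 [simp]: "poly_subst f 0 = 0"
  by (simp add: poly_subst_def)

lemma poly_subst_sum: "poly_subst f (\<Sum>i\<in>I. g i) = (\<Sum>i\<in>I. poly_subst f (g i))"
  by (induction I rule: infinite_finite_induct) (simp_all add: poly_subst_add)

lemma poly_subst_single: "poly_subst f (single m c) = cconst c * eval_monomial f m"
  by (subst poly_subst_superset[of "{m}"]) auto

lemma poly_as_sum: "p = (\<Sum>m\<in>keys p. single m (lookup p m))"
proof (rule poly_mapping_eqI)
  fix k
  have "(\<Sum>m\<in>keys p. lookup p m when m = k) = lookup p k"
  proof (cases "k \<in> keys p")
    case True
    then show ?thesis by (subst sum.remove[of _ k]) (auto intro!: sum.neutral simp: when_def)
  next
    case False
    then show ?thesis by (auto intro!: sum.neutral simp: when_def in_keys_iff)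
  qed
  then show "lookup p k
      = lookup (\<Sum>m\<in>keys p. single m (lookup p m)) k"
    by (simp add: lookup_sum lookup_single)
qed

lemma poly_subst_mult: "poly_subst f (p * q) = poly_subst f p * poly_subst f q"
proof -
  let ?t = "\<lambda>p m. single m (lookup p m)"
  have "p * q = (\<Sum>m\<in>keys p. ?t p m) * (\<Sum>m\<in>keys q. ?t q m)"
    using poly_as_sum[of p] poly_as_sum[of q] by simp
  also have "\<dots> = (\<Sum>m\<in>keys p. \<Sum>m'\<in>keys q. ?t p m * ?t q m')"
    by (simp add: sum_product)
  finally have "poly_subst f (p * q)
      = (\<Sum>m\<in>keys p. \<Sum>m'\<in>keys q. poly_subst f (?t p m * ?t q m'))"
    by (simp add: poly_subst_sum)
  also have "\<dots> = (\<Sum>m\<in>keys p. \<Sum>m'\<in>keys q.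
      (cconst (lookup p m) * eval_monomial f m) *
      (cconst (lookup q m') * eval_monomial f m'))"
    by (simp add: mult_single poly_subst_single eval_monomial_add algebra_simps)
  also have "\<dots> = poly_subst f p * poly_subst f q"
    unfolding poly_subst_def eval_monomial_def by (simp add: sum_product)
  finally show ?thesis .
qed

lemma poly_subst_cconst [simp]: "poly_subst f (cconst c) = cconst c"
  unfolding cconst_def by (subst poly_subst_single) (simp add: cconst_def)

lemma poly_subst_1 [simp]: "poly_subst f 1 = 1"
  using poly_subst_cconst[of f 1] by simp

lemma poly_subst_cvar [simp]: "poly_subst f (cvar v) = f v"
  unfolding cvar_def by (subst poly_subst_single) (simp add: eval_monomial_def)

lemma poly_subst_cscale: "poly_subst f (cscale c p) = cscale c (poly_subst f p)"
  by (simp add: cscale_def poly_subst_mult)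

lemma poly_subst_uminus: "poly_subst f (- p) = - poly_subst f p"
  using poly_subst_add[of f p "- p"] by (simp add: eq_neg_iff_add_eq_0 add.commute)

lemma poly_subst_span: "p \<in> cpoly.span S \<Longrightarrow> poly_subst f p \<in> cpoly.span (poly_subst f ` S)"
proof (induction p rule: cpoly.span_induct_alt)
  case (step c x y)
  then show ?case
    by (auto simp: poly_subst_add poly_subst_cscale
        intro!: cpoly.span_add cpoly.span_scale intro: cpoly.span_base)
qed (simp add: cpoly.span_zero)


section \<open>Polynomial rings and quotients\<close>

lemma poly_ring_simps [simp]:
  "x \<otimes>\<^bsub>poly_ring V\<^esub> y = x * y" "x \<oplus>\<^bsub>poly_ring V\<^esub> y = x + y"
  "\<one>\<^bsub>poly_ring V\<^esub> = 1" "\<zero>\<^bsub>poly_ring V\<^esub> = 0"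
  by (simp_all add: poly_ring_def)

abbreviation polys :: "'v set \<Rightarrow> 'v cpoly set" where
  "polys V \<equiv> carrier (poly_ring V)"

lemma poly_ring_carrier:
  "p \<in> polys V \<longleftrightarrow> (\<forall>m\<in>keys p. keys m \<subseteq> V)"
  by (simp add: poly_ring_def)

lemma poly_ring_single: "keys m \<subseteq> V \<Longrightarrow> single m c \<in> polys V"
  by (auto simp: poly_ring_carrier split: if_splits)

lemma poly_ring_closed:
  shows poly_ring_0: "0 \<in> polys V"
    and poly_ring_1: "1 \<in> polys V"
    and poly_ring_add: "p \<in> polys V \<Longrightarrow> q \<in> polys V \<Longrightarrow> p + q \<in> polys V"
    and poly_ring_mult: "p \<in> polys V \<Longrightarrow> q \<in> polys V \<Longrightarrow> p * q \<in> polys V"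
    and poly_ring_uminus: "p \<in> polys V \<Longrightarrow> - p \<in> polys V"
    and poly_ring_cconst: "cconst c \<in> polys V"
    and poly_ring_cvar: "v \<in> V \<Longrightarrow> cvar v \<in> polys V"
proof -
  show "0 \<in> polys V" "1 \<in> polys V" by (auto simp: poly_ring_carrier)
  show c: "cconst c \<in> polys V" for c
    unfolding cconst_def by (rule poly_ring_single) simp
  show "v \<in> V \<Longrightarrow> cvar v \<in> polys V"
    unfolding cvar_def by (rule poly_ring_single) simp
  show "p + q \<in> polys V"
    if "p \<in> polys V" "q \<in> polys V" for p q
    using that Poly_Mapping.keys_add[of p q] unfolding poly_ring_carrier by blast
  show mult: "p * q \<in> polys V"
    if "p \<in> polys V" "q \<in> polys V" for p q
    unfolding poly_ring_carrier
  proof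
    fix m assume "m \<in> keys (p * q)"
    then obtain a b where "m = a + b" "a \<in> keys p" "b \<in> keys q"
      using Poly_Mapping.keys_mult[of p q] by blast
    then show "keys m \<subseteq> V"
      using that Poly_Mapping.keys_add[of a b] unfolding poly_ring_carrier by blast
  qed
  show "- p \<in> polys V" if "p \<in> polys V"
    using mult[OF c[of "- 1"] that] by simp
qed

lemma poly_ring_of_int: "of_int k \<in> polys V"
  using poly_ring_cconst[of "of_int k"] by (simp only: cconst_of_int)

lemma poly_ring_sum: "(\<And>i. i \<in> I \<Longrightarrow> f i \<in> polys V) \<Longrightarrow> (\<Sum>i\<in>I. f i) \<in> polys V"
  by (induction I rule: infinite_finite_induct) (auto intro: poly_ring_closed)

lemma poly_ring_prod: "(\<And>i. i \<in> I \<Longrightarrow> f i \<in> polys V) \<Longrightarrow> (\<Prod>i\<in>I. f i) \<in> polys V"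
  by (induction I rule: infinite_finite_induct) (auto intro: poly_ring_closed)

lemma poly_ring_power: "p \<in> polys V \<Longrightarrow> p ^ k \<in> polys V"
  by (induction k) (auto intro: poly_ring_closed)

lemma poly_ring_prod_list: "set ps \<subseteq> polys V \<Longrightarrow> prod_list ps \<in> polys V"
  by (induction ps) (auto intro: poly_ring_closed)

lemma poly_ring_cring: "cring (poly_ring V)"
proof (rule cringI)
  show "abelian_group (poly_ring V)"
  proof (rule abelian_groupI)
    fix x assume "x \<in> polys V"
    then show "\<exists>y\<in>polys V. y \<oplus>\<^bsub>poly_ring V\<^esub> x = \<zero>\<^bsub>poly_ring V\<^esub>"
      by (intro bexI[of _ "- x"]) (auto intro: poly_ring_closed)
  qed (auto intro: poly_ring_closed simp: algebra_simps)
  show "Group.comm_monoid (poly_ring V)"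
    by (rule comm_monoidI) (auto intro: poly_ring_closed simp: algebra_simps)
qed (simp add: distrib_right)

lemma poly_ring_span:
  assumes "S \<subseteq> polys V" "p \<in> cpoly.span S"
  shows "p \<in> polys V"
  using assms(2,1)
proof (induction p rule: cpoly.span_induct_alt)
  case (step c x y)
  then show ?case by (auto simp: cscale_def intro!: poly_ring_add poly_ring_mult poly_ring_cconst)
qed (simp add: poly_ring_0)

lemma poly_subst_closed:
  assumes "\<And>v. v \<in> V \<Longrightarrow> f v \<in> polys W" "p \<in> polys V"
  shows "poly_subst f p \<in> polys W"
  unfolding poly_subst_def
  by (intro poly_ring_sum poly_ring_mult poly_ring_prod poly_ring_power poly_ring_cconst assms(1))
    (use assms(2) in \<open>auto simp: poly_ring_carrier\<close>)

lemma poly_subst_ring_hom: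
  assumes "\<And>v. v \<in> V \<Longrightarrow> f v \<in> polys W"
  shows "ring_hom_ring (poly_ring V) (poly_ring W) (poly_subst f)"
proof (rule ring_hom_ringI2)
  show "ring (poly_ring V)" "ring (poly_ring W)"
    using poly_ring_cring cring.axioms(1) by blast+
  show "poly_subst f \<in> Ring.ring_hom (poly_ring V) (poly_ring W)"
    by (rule ring_hom_memI) (auto simp: poly_subst_closed[OF assms] poly_subst_mult poly_subst_add)
qed

locale poly_quotient =
  fixes V :: "'v set" and W :: "'w set" and f :: "'v \<Rightarrow> 'w cpoly"
  assumes f_closed: "v \<in> V \<Longrightarrow> f v \<in> polys W"
begin

abbreviation "R \<equiv> poly_ring V"
abbreviation "I \<equiv> a_kernel R (poly_ring W) (poly_subst f)"
abbreviation "coset p \<equiv> I +>\<^bsub>R\<^esub> p"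
abbreviation "K \<equiv> range (\<lambda>c. coset (cconst c))"

lemma mem_kernel: "p \<in> I \<longleftrightarrow> p \<in> carrier R \<and> poly_subst f p = 0"
  by (auto simp: a_kernel_def' )

lemma kernel_ideal: "ideal I R"
  by (rule ring_hom_ring.kernel_is_ideal[OF poly_subst_ring_hom]) (rule f_closed)

lemma ring_quotient: "ring (R Quot I)"
  by (rule ideal.quotient_is_ring[OF kernel_ideal])

text \<open>Cosets of the kernel are fibres, so equations in the quotient are equations of images.\<close>

lemma coset_eq_fibre:
  assumes "p \<in> carrier R"
  shows "coset p = {x \<in> carrier R. poly_subst f x = poly_subst f p}"
proof (intro subset_antisym subsetI)
  fix x assume "x \<in> coset p"
  then obtain i where "i \<in> I" "x = i + p" by (auto simp: a_r_coset_def')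
  then show "x \<in> {x \<in> carrier R. poly_subst f x = poly_subst f p}"
    using assms by (auto simp: mem_kernel poly_subst_add poly_ring_add)
next
  fix x assume x: "x \<in> {x \<in> carrier R. poly_subst f x = poly_subst f p}"
  have "x + - p \<in> carrier R" using x assms by (intro poly_ring_add poly_ring_uminus) auto
  moreover have "poly_subst f (x + - p) = 0"
    unfolding poly_subst_add poly_subst_uminus using x by simp
  ultimately have "x + - p \<in> I" unfolding mem_kernel by blast
  moreover have "x = (x + - p) + p" by simp
  ultimately show "x \<in> coset p" unfolding a_r_coset_def' poly_ring_simps by blast
qed

lemma coset_eq_iff:
  assumes "p \<in> carrier R" "q \<in> carrier R"
  shows "coset p = coset q \<longleftrightarrow> poly_subst f p = poly_subst f q"
  using assms by (auto simp: coset_eq_fibre)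

lemma quotient_carrier: "carrier (R Quot I) = coset ` carrier R"
  unfolding FactRing_def A_RCOSETS_def' by auto

lemma quotient_zero: "\<zero>\<^bsub>R Quot I\<^esub> = coset 0"
proof -
  have "coset 0 = I"
    unfolding coset_eq_fibre[OF poly_ring_0] by (rule Set.set_eqI) (simp add: mem_kernel)
  then show ?thesis by (simp add: FactRing_def)
qed

lemma quotient_ops:
  assumes "p \<in> carrier R" "q \<in> carrier R"
  shows "(coset p) \<otimes>\<^bsub>R Quot I\<^esub> (coset q) = coset (p * q)"
    and "(coset p) \<oplus>\<^bsub>R Quot I\<^esub> (coset q) = coset (p + q)"
proof -
  interpret ideal I R by (rule kernel_ideal)
  show "(coset p) \<otimes>\<^bsub>R Quot I\<^esub> (coset q) = coset (p * q)"
    using rcoset_mult_add[OF assms] by (simp add: FactRing_def)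
  show "(coset p) \<oplus>\<^bsub>R Quot I\<^esub> (coset q) = coset (p + q)"
    using a_rcos_sum[OF assms] by (simp add: FactRing_def)
qed

lemma quotient_Span:
  assumes "set ps \<subseteq> carrier R"
  shows "ring.Span (R Quot I) K (map coset ps) = coset ` cpoly.span (set ps)"
  using assms
proof (induction ps)
  case Nil
  then show ?case by (simp add: ring.Span.simps[OF ring_quotient] quotient_zero)
next
  case (Cons p ps)
  let ?pr = coset
  have p: "p \<in> carrier R" and ps: "set ps \<subseteq> carrier R" using Cons.prems by auto
  have comb: "?pr (cconst c) \<otimes>\<^bsub>R Quot I\<^esub> ?pr p \<oplus>\<^bsub>R Quot I\<^esub> ?pr q = ?pr (cscale c p + q)"
    if "q \<in> cpoly.span (set ps)" for c q
    using p poly_ring_span[OF ps that]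
    by (simp add: quotient_ops poly_ring_cconst poly_ring_mult cscale_def)
  have lhs: "x \<in> ring.Span (R Quot I) K (map ?pr (p # ps)) \<longleftrightarrow>
      (\<exists>c. \<exists>q\<in>cpoly.span (set ps). x = ?pr (cscale c p + q))" for x
  proof -
    have "x \<in> ring.Span (R Quot I) K (map ?pr (p # ps)) \<longleftrightarrow> (\<exists>k\<in>K. \<exists>v\<in>?pr ` cpoly.span (set ps).
        x = k \<otimes>\<^bsub>R Quot I\<^esub> ?pr p \<oplus>\<^bsub>R Quot I\<^esub> v)"
    proof -
      have "ring.Span (R Quot I) K (u # us)
          = ring.line_extension (R Quot I) K u (ring.Span (R Quot I) K us)" for u us
        by (simp add: ring.Span.simps[OF ring_quotient])
      then show ?thesis
        by (simp only: list.map ring.line_extension_mem_iff[OF ring_quotient] Cons.IH[OF ps])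
    qed
    also have "\<dots> \<longleftrightarrow> (\<exists>c. \<exists>q\<in>cpoly.span (set ps).
        x = ?pr (cconst c) \<otimes>\<^bsub>R Quot I\<^esub> ?pr p \<oplus>\<^bsub>R Quot I\<^esub> ?pr q)"
      by blast
    also have "\<dots> \<longleftrightarrow> (\<exists>c. \<exists>q\<in>cpoly.span (set ps). x = ?pr (cscale c p + q))"
      using comb by (metis (no_types, lifting))
    finally show ?thesis .
  qed
  have rhs: "x \<in> ?pr ` cpoly.span (set (p # ps)) \<longleftrightarrow>
      (\<exists>c. \<exists>q\<in>cpoly.span (set ps). x = ?pr (cscale c p + q))" for x
  proof
    assume "x \<in> ?pr ` cpoly.span (set (p # ps))"
    then obtain y where y: "y \<in> cpoly.span (insert p (set ps))" "x = ?pr y" by auto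
    then obtain c where "y - cscale c p \<in> cpoly.span (set ps)"
      using cpoly.span_breakdown_eq by blast
    then show "\<exists>c. \<exists>q\<in>cpoly.span (set ps). x = ?pr (cscale c p + q)"
      using y by (intro exI[of _ c] bexI[of _ "y - cscale c p"]) auto
  next
    assume "\<exists>c. \<exists>q\<in>cpoly.span (set ps). x = ?pr (cscale c p + q)"
    then obtain c q where q: "q \<in> cpoly.span (set ps)" "x = ?pr (cscale c p + q)" by auto
    then have "q \<in> cpoly.span (insert p (set ps))"
      using cpoly.span_mono[of "set ps" "insert p (set ps)"] by blast
    then have "cscale c p + q \<in> cpoly.span (insert p (set ps))"
      by (intro cpoly.span_add cpoly.span_scale) (simp add: cpoly.span_base)
    then show "x \<in> ?pr ` cpoly.span (set (p # ps))" using q(2) by simp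
  qed
  show ?case by (rule Set.set_eqI) (simp only: lhs rhs)
qed

text \<open>
  The quotient is a copy of the image of the substitution. A set of polynomials therefore represents
  a basis as soon as its image is independent and spans the image.
\<close>

lemma quotient_basis:
  assumes M: "M \<subseteq> carrier R" and inj: "inj_on (poly_subst f) M"
    and indep: "cpoly.independent (poly_subst f ` M)"
    and spans: "poly_subst f ` carrier R \<subseteq> cpoly.span (poly_subst f ` M)"
  shows "inj_on coset M" "vs_basis (R Quot I) K (coset ` M)"
proof -
  let ?pr = coset and ?Q = "R Quot I"
  show inj_pr: "inj_on ?pr M"
    using inj M by (auto simp: inj_on_def coset_eq_iff subset_iff)
  have independent: "ring.independent ?Q K (map ?pr ps)" if "set ps \<subseteq> M" "distinct ps" for ps
    using that
  proof (induction ps)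
    case Nil
    then show ?case by (simp add: ring.li_Nil[OF ring_quotient])
  next
    case (Cons p ps)
    have "?pr p \<notin> ring.Span ?Q K (map ?pr ps)"
    proof
      assume "?pr p \<in> ring.Span ?Q K (map ?pr ps)"
      then obtain q where q: "q \<in> cpoly.span (set ps)" "?pr p = ?pr q"
        using quotient_Span[of ps] Cons.prems M by auto
      have "q \<in> carrier R" "p \<in> carrier R"
        using poly_ring_span[OF _ q(1)] Cons.prems M by auto
      then have "poly_subst f p = poly_subst f q" using q coset_eq_iff by simp
      also have "\<dots> \<in> cpoly.span (poly_subst f ` set ps)" using poly_subst_span q by blast
      also have "\<dots> \<subseteq> cpoly.span (poly_subst f ` M - {poly_subst f p})"
        using Cons.prems inj by (intro cpoly.span_mono) (auto simp: inj_on_def)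
      finally show False using indep Cons.prems unfolding cpoly.dependent_def by auto
    qed
    then show ?case
      using Cons M by (auto intro!: ring.li_Cons[OF ring_quotient] simp: quotient_carrier)
  qed
  show "vs_basis ?Q K (?pr ` M)"
    unfolding vs_basis_def
  proof (intro conjI allI impI)
    show "?pr ` M \<subseteq> carrier ?Q" using M by (auto simp: quotient_carrier)
    fix us assume us: "distinct us \<and> set us \<subseteq> ?pr ` M"
    define ps where "ps = map (inv_into M ?pr) us"
    have "map ?pr ps = us" unfolding ps_def map_map
      by (rule map_idI) (use us in \<open>auto simp: f_inv_into_f\<close>)
    moreover have "set ps \<subseteq> M" using us by (auto simp: ps_def intro: inv_into_into)
    moreover have "distinct ps" using us \<open>map ?pr ps = us\<close> by (metis distinct_map)
    ultimately show "ring.independent ?Q K us" using independent by metis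
  next
    show "carrier ?Q = (\<Union>us\<in>{us. set us \<subseteq> ?pr ` M}. ring.Span ?Q K us)"
    proof (intro subset_antisym subsetI)
      fix x assume "x \<in> carrier ?Q"
      then obtain p where p: "p \<in> carrier R" "x = ?pr p" by (auto simp: quotient_carrier)
      have ex: "\<exists>ps q. set ps \<subseteq> M \<and> q \<in> cpoly.span (set ps) \<and> poly_subst f q = y"
        if "y \<in> cpoly.span (poly_subst f ` M)" for y
        using that
      proof (induction y rule: cpoly.span_induct_alt)
        case base
        show ?case by (rule exI[of _ "[]"], rule exI[of _ 0]) simp
      next
        case (step c s y)
        then obtain r ps q where *: "r \<in> M" "s = poly_subst f r" "set ps \<subseteq> M"
          "q \<in> cpoly.span (set ps)" "poly_subst f q = y" by auto
        have "q \<in> cpoly.span (set (r # ps))"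
          using * cpoly.span_mono[of "set ps" "set (r # ps)"] by auto
        then have "cscale c r + q \<in> cpoly.span (set (r # ps))"
          by (intro cpoly.span_add cpoly.span_scale) (simp add: cpoly.span_base)
        then show ?case using *
          by (intro exI[of _ "r # ps"] exI[of _ "cscale c r + q"])
            (auto simp: poly_subst_add poly_subst_cscale)
      qed
      then obtain ps q where *: "set ps \<subseteq> M" "q \<in> cpoly.span (set ps)" "poly_subst f q = poly_subst f p"
      proof -
        have "poly_subst f p \<in> cpoly.span (poly_subst f ` M)" using spans p by blast
        from ex[OF this] show thesis using that by blast
      qed
      then have "q \<in> carrier R" using poly_ring_span M by (metis order_trans)
      then have "x = ?pr q" using * p coset_eq_iff by simp
      then have "x \<in> ring.Span ?Q K (map ?pr ps)" using * quotient_Span[of ps] M by auto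
      then show "x \<in> (\<Union>us\<in>{us. set us \<subseteq> ?pr ` M}. ring.Span ?Q K us)"
        using * by (intro UN_I[of "map ?pr ps"]) auto
    next
      fix x assume "x \<in> (\<Union>us\<in>{us. set us \<subseteq> ?pr ` M}. ring.Span ?Q K us)"
      then obtain us where us: "set us \<subseteq> ?pr ` M" "x \<in> ring.Span ?Q K us" by auto
      have "K \<subseteq> carrier ?Q" by (auto simp: quotient_carrier poly_ring_cconst)
      moreover have "set us \<subseteq> carrier ?Q" using us M unfolding quotient_carrier by blast
      ultimately show "x \<in> carrier ?Q"
        using ring.Span_in_carrier[OF ring_quotient, of K us] us by blast
    qed
  qed
qed

end

section \<open>Leading monomials\<close>

definition weight :: "('v \<Rightarrow> nat) \<Rightarrow> ('v \<Rightarrow>\<^sub>0 nat) \<Rightarrow> nat" where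
  "weight wt m = (\<Sum>v\<in>keys m. wt v * lookup m v)"

lemma weight_superset:
  "finite S \<Longrightarrow> keys m \<subseteq> S \<Longrightarrow> weight wt m = (\<Sum>v\<in>S. wt v * lookup m v)"
  unfolding weight_def by (intro sum.mono_neutral_left) (auto simp: in_keys_iff)

lemma weight_0 [simp]: "weight wt 0 = 0"
  by (simp add: weight_def)

lemma weight_add [simp]: "weight wt (m + m') = weight wt m + weight wt m'"
proof -
  let ?S = "keys m \<union> keys m'"
  show ?thesis
    using Poly_Mapping.keys_add[of m m']
    by (simp add: weight_superset[of ?S] lookup_add distrib_left sum.distrib)
qed

lemma weight_single [simp]: "weight wt (single v k) = wt v * k"
  by (subst weight_superset[of "{v}"]) auto

lemma weight_sum: "weight wt (\<Sum>i\<in>I. f i) = (\<Sum>i\<in>I. weight wt (f i))"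
  by (induction I rule: infinite_finite_induct) auto

text \<open>
  Only \<open>m\<close> has to be separated from the other monomials by its weight, which may tie among each
  other. So a numerical weight can take the place of a monomial order.
\<close>

definition leads :: "('v \<Rightarrow> nat) \<Rightarrow> 'v cpoly \<Rightarrow> ('v \<Rightarrow>\<^sub>0 nat) \<Rightarrow> bool" where
  "leads wt p m \<longleftrightarrow> (\<exists>c r. c \<noteq> 0 \<and> p = single m c + r \<and>
     (\<forall>k\<in>keys r. weight wt k < weight wt m))"

lemma leads_lookup:
  assumes "leads wt p m"
  shows "lookup p m \<noteq> 0"
    and "lookup p k \<noteq> 0 \<Longrightarrow> k = m \<or> weight wt k < weight wt m"
proof -
  obtain c r where *: "c \<noteq> 0" "p = single m c + r"
    "\<forall>k\<in>keys r. weight wt k < weight wt m"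
    using assms by (auto simp: leads_def)
  have "m \<notin> keys r" using * by blast
  then show "lookup p m \<noteq> 0" using * by (simp add: lookup_add in_keys_iff)
  show "k = m \<or> weight wt k < weight wt m" if "lookup p k \<noteq> 0"
    using that * by (auto simp: lookup_add lookup_single when_def in_keys_iff split: if_splits)
qed

lemma leads_unique: "leads wt p m \<Longrightarrow> leads wt p m' \<Longrightarrow> m = m'"
  using leads_lookup by (metis less_asym)

lemma leads_1: "leads wt 1 0"
  unfolding leads_def by (intro exI[of _ 1] exI[of _ 0]) simp

lemma leads_mult:
  assumes "leads wt p m" "leads wt q m'"
  shows "leads wt (p * q) (m + m')"
proof -
  obtain c r where p: "c \<noteq> 0" "p = single m c + r"
    "\<forall>k\<in>keys r. weight wt k < weight wt m"
    using assms by (auto simp: leads_def)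
  obtain d s where q: "d \<noteq> 0" "q = single m' d + s"
    "\<forall>k\<in>keys s. weight wt k < weight wt m'"
    using assms by (auto simp: leads_def)
  let ?r = "single m c * s + (r * single m' d + r * s)"
  have "weight wt k < weight wt (m + m')" if "k \<in> keys ?r" for k
  proof -
    have le: "weight wt a \<le> weight wt m" if "a \<in> keys (single m c)" for a
      using that by (simp split: if_splits)
    have le': "weight wt a \<le> weight wt m'" if "a \<in> keys (single m' d)" for a
      using that by (simp split: if_splits)
    from that consider "k \<in> keys (single m c * s)"
      | "k \<in> keys (r * single m' d)" | "k \<in> keys (r * s)"
      using Poly_Mapping.keys_add[of "single m c * s" "r * single m' d + r * s"]
        Poly_Mapping.keys_add[of "r * single m' d" "r * s"] by blast
    then show ?thesis
    proof cases
      case 1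
      then obtain a b where "k = a + b" "a \<in> keys (single m c)"
        "b \<in> keys s" using Poly_Mapping.keys_mult by blast
      then show ?thesis using le q(3) by (fastforce intro: add_le_less_mono)
    next
      case 2
      then obtain a b where "k = a + b" "a \<in> keys r"
        "b \<in> keys (single m' d)" using Poly_Mapping.keys_mult by blast
      then show ?thesis using le' p(3) by (fastforce intro: add_less_le_mono)
    next
      case 3
      then obtain a b where "k = a + b" "a \<in> keys r" "b \<in> keys s"
        using Poly_Mapping.keys_mult by blast
      then show ?thesis using p(3) q(3) by (fastforce intro: add_strict_mono)
    qed
  qed
  moreover have "p * q = single (m + m') (c * d) + ?r"
    unfolding p(2) q(2) by (simp add: distrib_left distrib_right mult_single add.assoc)
  ultimately show ?thesis unfolding leads_def using p(1) q(1)
    by (intro exI[of _ "c * d"] exI[of _ ?r]) auto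
qed

lemma leads_uminus: "leads wt p m \<Longrightarrow> leads wt (- p) m"
proof -
  have "leads wt (- 1) 0"
    unfolding leads_def by (intro exI[of _ "- 1"] exI[of _ 0]) (simp add: single_uminus)
  then show "leads wt p m \<Longrightarrow> leads wt (- p) m" using leads_mult[of wt "- 1" 0 p m] by simp
qed

lemma leads_prod_list:
  assumes "\<And>x. x \<in> set xs \<Longrightarrow> leads wt (f x) (e x)"
  shows "leads wt (prod_list (map f xs)) (sum_list (map e xs))"
  using assms by (induction xs) (auto intro: leads_1 leads_mult)

text \<open>
  In a linear relation, consider a leading monomial of maximal weight among the terms with nonzero
  coefficient. No other term contains it.
\<close>

lemma independent_if_distinct_leads:
  assumes leads: "\<And>p. p \<in> S \<Longrightarrow> \<exists>m. leads wt p m"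
    and inj: "\<And>p q m. p \<in> S \<Longrightarrow> q \<in> S \<Longrightarrow> leads wt p m \<Longrightarrow> leads wt q m \<Longrightarrow> p = q"
  shows "cpoly.independent S"
proof
  assume "cpoly.dependent S"
  then obtain T u where T: "finite T" "T \<subseteq> S" "(\<Sum>p\<in>T. cscale (u p) p) = 0" "\<exists>p\<in>T. u p \<noteq> 0"
    unfolding cpoly.dependent_explicit by blast
  define e where "e p = (SOME m. leads wt p m)" for p
  have e: "leads wt p (e p)" if "p \<in> S" for p
    unfolding e_def by (rule someI_ex[OF leads[OF that]])
  let ?T = "{p \<in> T. u p \<noteq> 0}"
  have "finite ?T" "?T \<noteq> {}" using T by auto
  obtain p where p: "p \<in> ?T" "\<And>q. q \<in> ?T \<Longrightarrow> weight wt (e q) \<le> weight wt (e p)"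
  proof -
    let ?W = "(\<lambda>p. weight wt (e p)) ` ?T"
    have "finite ?W" "?W \<noteq> {}" using \<open>finite ?T\<close> \<open>?T \<noteq> {}\<close> by blast+
    then have "Max ?W \<in> ?W" by (rule Max_in)
    then obtain p where "p \<in> ?T" "weight wt (e p) = Max ?W" by fastforce
    moreover from this have "weight wt (e q) \<le> weight wt (e p)" if "q \<in> ?T" for q
      using Max_ge[OF \<open>finite ?W\<close>] that by auto
    ultimately show thesis using that by blast
  qed
  have "u q * lookup q (e p) = 0" if "q \<in> T - {p}" for q
  proof (rule ccontr)
    assume "u q * lookup q (e p) \<noteq> 0"
    then have q: "u q \<noteq> 0" "lookup q (e p) \<noteq> 0" by auto
    then have "e p = e q \<or> weight wt (e p) < weight wt (e q)"
      using leads_lookup(2)[OF e] that T by blast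
    moreover have "weight wt (e q) \<le> weight wt (e p)" using p(2) q that by auto
    ultimately have "e p = e q" by simp
    then have "p = q" using inj[of p q "e p"] e[of p] e[of q] that p T by auto
    then show False using that by simp
  qed
  then have "(\<Sum>q\<in>T - {p}. u q * lookup q (e p)) = 0" by (intro sum.neutral) blast
  then have "(\<Sum>q\<in>T. u q * lookup q (e p)) = u p * lookup p (e p)"
    using p T by (subst sum.remove[of _ p]) auto
  moreover have "\<dots> \<noteq> 0" using leads_lookup(1)[OF e[of p]] p T by auto
  moreover have "(\<Sum>q\<in>T. u q * lookup q (e p))
      = lookup (\<Sum>q\<in>T. cscale (u q) q) (e p)"
    by (simp add: lookup_sum lookup_cscale)
  ultimately show False using T by simp
qed

text \<open>
  A leading monomial of an element of the span is one of the leading monomials of the family: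
  otherwise the enlarged family would still be independent.
\<close>

lemma leads_span:
  assumes leads: "\<And>p. p \<in> S \<Longrightarrow> \<exists>m. leads wt p m"
    and inj: "\<And>p q m. p \<in> S \<Longrightarrow> q \<in> S \<Longrightarrow> leads wt p m \<Longrightarrow> leads wt q m \<Longrightarrow> p = q"
    and f: "f \<in> cpoly.span S" "leads wt f m"
  obtains p where "p \<in> S" "leads wt p m"
proof -
  have "\<exists>p\<in>S. leads wt p m"
  proof (rule ccontr)
    assume none: "\<not> (\<exists>p\<in>S. leads wt p m)"
    have "cpoly.independent (insert f S)"
    proof (rule independent_if_distinct_leads)
      show "\<exists>m. leads wt p m" if "p \<in> insert f S" for p using that leads f by auto
      show "p = q" if "p \<in> insert f S" "q \<in> insert f S" "leads wt p k" "leads wt q k" for p q k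
        using that inj none leads_unique[OF f(2)] by auto
    qed
    moreover have "f \<notin> S" using none f by auto
    ultimately show False using f unfolding cpoly.independent_insert by simp
  qed
  then show thesis using that by blast
qed

lemma prod_cvar:
  "finite I \<Longrightarrow> (\<Prod>i\<in>I. cvar (f i)) = single (\<Sum>i\<in>I. single (f i) 1) 1"
  by (induction I rule: finite_induct) (simp_all add: cvar_def mult_single)

text \<open>
  With weights growing geometrically from row to row, the weight of a term of the expansion is
  compared in the last row first.
\<close>

lemma dominant_diagonal:
  fixes f :: "nat \<Rightarrow> nat \<Rightarrow> nat"
  assumes bound: "\<And>r c. f r c \<le> b" and less: "\<And>r c. c < r \<Longrightarrow> r < k \<Longrightarrow> f r c < f r r"
    and q: "q permutes {0..<k}" "q \<noteq> id"
  shows "(\<Sum>r<k. Suc b ^ r * f r (q r)) < (\<Sum>r<k. Suc b ^ r * f r r)"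
proof -
  let ?D = "{r. r < k \<and> q r \<noteq> r}"
  have fin: "finite ?D" by simp
  have "?D \<noteq> {}"
  proof
    assume "?D = {}"
    then have "q r = r" for r using permutes_not_in[OF q(1), of r] by (cases "r < k") auto
    then show False using q(2) by (auto simp: fun_eq_iff)
  qed
  define s where "s = Max ?D"
  have s: "s < k" "q s \<noteq> s" using Max_in[OF fin \<open>?D \<noteq> {}\<close>] by (auto simp: s_def)
  have above: "q r = r" if "s < r" for r
  proof (cases "r < k")
    case True
    then show ?thesis using Max_ge[OF fin, of r] that by (fastforce simp: s_def)
  next
    case False
    then show ?thesis using permutes_not_in[OF q(1), of r] by simp
  qed
  have "q s < s"
  proof (rule ccontr)
    assume "\<not> q s < s"
    then have "q (q s) = q s" using above[of "q s"] s by simp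
    then show False using permutes_inj[OF q(1)] s by (auto dest: injD)
  qed
  have geometric: "(\<Sum>r<s. Suc b ^ r * b) < Suc b ^ s"
    by (induction s) (simp_all add: algebra_simps)
  have split: "(\<Sum>r<k. g r) = (\<Sum>r<s. g r) + g s + (\<Sum>r\<in>{Suc s..<k}. g r)" for g :: "nat \<Rightarrow> nat"
  proof -
    have "{..<k} = {..<Suc s} \<union> {Suc s..<k}" using s by auto
    show ?thesis unfolding \<open>{..<k} = {..<Suc s} \<union> {Suc s..<k}\<close> by (subst sum.union_disjoint) auto
  qed
  have "(\<Sum>r<s. Suc b ^ r * f r (q r)) \<le> (\<Sum>r<s. Suc b ^ r * b)"
    using bound by (intro sum_mono mult_le_mono) auto
  then have "(\<Sum>r<s. Suc b ^ r * f r (q r)) + Suc b ^ s * f s (q s) < Suc b ^ s * Suc (f s (q s))"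
    using geometric by simp
  also have "\<dots> \<le> Suc b ^ s * f s s" using less[OF \<open>q s < s\<close> s(1)] by (intro mult_le_mono) auto
  finally have "(\<Sum>r<s. Suc b ^ r * f r (q r)) + Suc b ^ s * f s (q s) < (\<Sum>r<s. Suc b ^ r * f r r) + Suc b ^ s * f s s"
    by simp
  moreover have "(\<Sum>r\<in>{Suc s..<k}. Suc b ^ r * f r (q r)) = (\<Sum>r\<in>{Suc s..<k}. Suc b ^ r * f r r)"
    using above by (intro sum.cong) auto
  ultimately show ?thesis unfolding split by simp
qed

definition tuple_monomial :: "nat list \<Rightarrow> (nat \<times> nat) \<Rightarrow>\<^sub>0 nat" where
  "tuple_monomial t = (\<Sum>r<length t. single (r + 1, t ! r) 1)"

definition tableau_exponent :: "nat list list \<Rightarrow> (nat \<times> nat) \<Rightarrow>\<^sub>0 nat" where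
  "tableau_exponent Y = sum_list (map tuple_monomial Y)"

context order_part
begin

text \<open>
  In row \<open>i\<close> the variables \<open>z\<^sub>i\<^sub>,\<^sub>a\<close> with \<open>\<sigma>\<^sub>i(a) \<ge> i\<close> are ranked by increasing \<open>\<sigma>\<^sub>i(a)\<close>, and all
  others come last.
\<close>

definition row_value :: "nat \<Rightarrow> nat \<Rightarrow> nat" where
  "row_value i a = (if i \<le> sigma n U i a then Suc n - sigma n U i a else 0)"

definition var_weight :: "nat \<times> nat \<Rightarrow> nat" where
  "var_weight = (\<lambda>(i, a). Suc (Suc n) ^ (i - 1) * row_value i a)"

text \<open>
  The terms of the minor are indexed by permutations. By \<open>position_tuple_later\<close>, among the first
  \<open>i\<close> entries of the tuple the \<open>i\<close>-th one has the largest value in row \<open>i\<close>, so the identity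
  permutation gives the term of largest weight.
\<close>

lemma leads_minor:
  assumes t: "oc_tuple n U t"
  shows "leads var_weight (minor t) (tuple_monomial t)"
proof -
  let ?k = "length t"
  let ?mono = "\<lambda>p :: nat \<Rightarrow> nat. \<Sum>c<?k. single (p c + 1, t ! c) (1 :: nat)"
  let ?P = "{p. p permutes {0..<?k}}"
  have tuple: "position_tuple t" using t by (simp add: oc_tuple_iff)
  have expand: "minor t = (\<Sum>p\<in>?P. single (?mono p) (of_int (sign p)))"
    unfolding minor_eq_minor_fun minor_fun_expand
  proof (rule sum.cong)
    fix p :: "nat \<Rightarrow> nat"
    have "(of_int (sign p) :: (nat \<times> nat) cpoly) = single 0 (of_int (sign p))"
      by simp
    then show "of_int (sign p) * (\<Prod>c<?k. cvar (p c + 1, t ! c)) = single (?mono p) (of_int (sign p))"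
      by (simp only: prod_cvar[OF finite_lessThan] mult_single) simp
  qed simp
  let ?r = "\<Sum>p\<in>?P - {id}. single (?mono p) (of_int (sign p) :: complex)"
  have fin: "finite ?P" by (simp add: finite_permutations)
  have "minor t = single (?mono id) (of_int (sign (id :: nat \<Rightarrow> nat))) + ?r"
  proof -
    let ?g = "\<lambda>p. single (?mono p) (of_int (sign p) :: complex)"
    have "id \<in> ?P" by (simp only: mem_Collect_eq permutes_id)
    then have "sum ?g ?P = ?g id + sum ?g (?P - {id})" by (rule sum.remove[OF fin])
    then show ?thesis unfolding expand .
  qed
  then have main: "minor t = single (tuple_monomial t) 1 + ?r"
    by (simp add: tuple_monomial_def)
  have mono_weight: "weight var_weight (?mono p) = (\<Sum>c<?k. var_weight (p c + 1, t ! c))" for p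
    by (simp add: weight_sum)
  have value_less: "row_value (r + 1) (t ! c) < row_value (r + 1) (t ! r)" if "c < r" "r < ?k" for c r
  proof -
    let ?i = "r + 1"
    have pos: "?i \<le> pos t ?i" "pos t ?i \<le> n" using oc_tupleD(6,7)[OF t, of ?i] that by auto
    have "sigma n U ?i (t ! c) < ?i \<or> pos t ?i < sigma n U ?i (t ! c)"
      using position_tuple_later[OF tuple, of "Suc c" ?i] that by auto
    then show ?thesis using pos by (auto simp: row_value_def tuple_pos_def)
  qed
  have smaller: "weight var_weight (?mono p) < weight var_weight (tuple_monomial t)"
    if p: "p \<in> ?P - {id}" for p
  proof -
    let ?q = "inv_into UNIV p"
    have perm: "p permutes {0..<?k}" and "p \<noteq> id" using p by auto
    then have q: "?q permutes {0..<?k}" "?q \<noteq> id"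
      using permutes_inv[OF perm] permutes_inv_inv[OF perm] by (auto simp: inv_id)
    have "weight var_weight (?mono p) = (\<Sum>c<?k. var_weight (p c + 1, t ! c))" by (rule mono_weight)
    also have "\<dots> = (\<Sum>r<?k. var_weight (r + 1, t ! (?q r)))"
      by (rule sum.reindex_bij_witness[of _ ?q p])
        (use perm q permutes_in_image[OF perm] permutes_in_image[OF q(1)] in
          \<open>auto simp: permutes_inverses lessThan_atLeast0\<close>)
    also have "\<dots> = (\<Sum>r<?k. Suc (Suc n) ^ r * row_value (r + 1) (t ! (?q r)))"
      by (simp add: var_weight_def)
    also have "\<dots> < (\<Sum>r<?k. Suc (Suc n) ^ r * row_value (r + 1) (t ! r))"
      by (rule dominant_diagonal[where f = "\<lambda>r c. row_value (r + 1) (t ! c)"])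
        (use q value_less in \<open>auto simp: row_value_def\<close>)
    also have "\<dots> = weight var_weight (tuple_monomial t)"
      using mono_weight[of id] by (simp add: tuple_monomial_def var_weight_def)
    finally show ?thesis .
  qed
  have "weight var_weight k < weight var_weight (tuple_monomial t)" if key: "k \<in> keys ?r" for k
  proof -
    obtain p where "p \<in> ?P - {id}" "k \<in> keys (single (?mono p) (of_int (sign p) :: complex))"
      using key Poly_Mapping.keys_sum[of "\<lambda>p. single (?mono p) (of_int (sign p) :: complex)" "?P - {id}"]
      by blast
    then show ?thesis using smaller by (auto split: if_splits)
  qed
  then show ?thesis unfolding leads_def using main by (intro exI[of _ 1] exI[of _ ?r]) simp
qed

lemma leads_minor_product:
  "\<forall>c\<in>set Y. oc_tuple n U c \<Longrightarrow> leads var_weight (minor_product Y) (tableau_exponent Y)"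
  unfolding minor_product_def tableau_exponent_def by (intro leads_prod_list leads_minor) simp


section \<open>Semistandard tableaux as chains of ideals\<close>

lemma tuple_ideal_subset_iff:
  assumes c: "oc_tuple n U c"
  shows "ideal_of c \<subseteq> ideal_of c' \<longleftrightarrow>
    (\<forall>j\<in>{1..length c}. \<exists>j'\<in>{j..length c'}. pos c j \<le> pos c' j')"
proof
  assume sub: "ideal_of c \<subseteq> ideal_of c'"
  show "\<forall>j\<in>{1..length c}. \<exists>j'\<in>{j..length c'}. pos c j \<le> pos c' j'"
  proof
    fix j assume j: "j \<in> {1..length c}"
    then have "(j, pos c j) \<in> ideal_of c"
      using oc_tupleD(6,7)[OF c, of j] by (auto simp: mem_tuple_ideal)
    then have "(j, pos c j) \<in> ideal_of c'" using sub by blast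
    then show "\<exists>j'\<in>{j..length c'}. pos c j \<le> pos c' j'" unfolding mem_tuple_ideal by blast
  qed
next
  assume *: "\<forall>j\<in>{1..length c}. \<exists>j'\<in>{j..length c'}. pos c j \<le> pos c' j'"
  show "ideal_of c \<subseteq> ideal_of c'"
  proof
    fix p assume "p \<in> ideal_of c"
    then obtain i v l where p: "p = (i, v)" "1 \<le> i" "i \<le> v" "v \<le> n" "l \<in> {i..length c}" "v \<le> pos c l"
      by (cases p) (auto simp: mem_tuple_ideal)
    then obtain j' where j': "j' \<in> {l..length c'}" "pos c l \<le> pos c' j'" using * by fastforce
    then have "j' \<in> {i..length c'}" "v \<le> pos c' j'" using p by auto
    then show "p \<in> ideal_of c'" using p by (auto simp: mem_tuple_ideal)
  qed
qed

text \<open>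
  The condition on two columns is the inclusion of their ideals. The heights then decrease by
  themselves, being the numbers of diagonal elements.
\<close>

lemma oc_semistandard_iff:
  "oc_semistandard n U Y \<longleftrightarrow> (\<forall>c\<in>set Y. oc_tuple n U c) \<and>
     sorted_wrt (\<lambda>c c'. ideal_of c' \<subseteq> ideal_of c) Y"
proof (cases "\<forall>c\<in>set Y. oc_tuple n U c")
  case True
  let ?le = "\<lambda>c c'. \<forall>j\<in>{1..length c'}. \<exists>j'\<in>{j..length c}. pos c' j \<le> pos c j'"
  have eq: "(\<forall>j\<in>{1..col_height Y i}. \<exists>j'\<in>{j..col_height Y i'}.
      sigma n U j' (entry Y i' j') \<ge> sigma n U j (entry Y i j)) \<longleftrightarrow> ?le (Y ! (i' - 1)) (Y ! (i - 1))" for i i'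
    by (simp add: col_height_def entry_def tuple_pos_def)
  have rows: "(\<forall>i\<in>{1..length Y}. \<forall>i'\<in>{1..i}. ?le (Y ! (i' - 1)) (Y ! (i - 1))) \<longleftrightarrow> sorted_wrt ?le Y"
  proof
    assume *: "\<forall>i\<in>{1..length Y}. \<forall>i'\<in>{1..i}. ?le (Y ! (i' - 1)) (Y ! (i - 1))"
    show "sorted_wrt ?le Y"
      unfolding sorted_wrt_iff_nth_less
    proof (intro allI impI)
      fix a b assume "a < b" "b < length Y"
      then have "Suc b \<in> {1..length Y}" "Suc a \<in> {1..Suc b}" by auto
      with * have "?le (Y ! (Suc a - 1)) (Y ! (Suc b - 1))" by blast
      then show "?le (Y ! a) (Y ! b)" by simp
    qed
  next
    assume *: "sorted_wrt ?le Y"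
    show "\<forall>i\<in>{1..length Y}. \<forall>i'\<in>{1..i}. ?le (Y ! (i' - 1)) (Y ! (i - 1))"
    proof (intro ballI)
      fix i i' assume i: "i \<in> {1..length Y}" "i' \<in> {1..i}"
      fix j assume j: "j \<in> {1..length (Y ! (i - 1))}"
      show "\<exists>j'\<in>{j..length (Y ! (i' - 1))}. pos (Y ! (i - 1)) j \<le> pos (Y ! (i' - 1)) j'"
      proof (cases "i = i'")
        case True
        then show ?thesis using j by (intro bexI[of _ j]) auto
      next
        case False
        then have "i' - 1 < i - 1" "i - 1 < length Y" using i by auto
        then show ?thesis using * j unfolding sorted_wrt_iff_nth_less by blast
      qed
    qed
  qed
  have chain: "sorted_wrt ?le Y \<longleftrightarrow> sorted_wrt (\<lambda>c c'. ideal_of c' \<subseteq> ideal_of c) Y"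
  proof -
    have "?le (Y ! a) (Y ! b) \<longleftrightarrow> ideal_of (Y ! b) \<subseteq> ideal_of (Y ! a)"
      if "a < b" "b < length Y" for a b
      using tuple_ideal_subset_iff[of "Y ! b" "Y ! a"] True that by auto
    then show ?thesis unfolding sorted_wrt_iff_nth_less by (intro iff_allI imp_cong refl)
  qed
  have young: "young_tableau Y" if sorted: "sorted_wrt (\<lambda>c c'. ideal_of c' \<subseteq> ideal_of c) Y"
  proof -
    have "length c' \<le> length c" if "c \<in> set Y" "c' \<in> set Y" "ideal_of c' \<subseteq> ideal_of c" for c c'
    proof -
      have "(length c', length c') \<in> ideal_of c'"
        using that True oc_tupleD(1)[of c'] diag_tuple_ideal[of c'] by auto
      then show ?thesis using that True diag_tuple_ideal[of c] by blast
    qed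
    then have "sorted_wrt (\<lambda>c c'. length c' \<le> length c) Y"
      using sorted by (rule sorted_wrt_mono_rel)
    moreover have "[] \<notin> set Y" using True oc_tupleD(1)[of "[]"] by auto
    ultimately show ?thesis by (simp add: young_tableau_def sorted_wrt_map)
  qed
  define B where "B \<longleftrightarrow> (\<forall>c\<in>set Y. oc_tuple n U c)"
  define C where "C \<longleftrightarrow> sorted_wrt (\<lambda>c c'. ideal_of c' \<subseteq> ideal_of c) Y"
  have "oc_semistandard n U Y \<longleftrightarrow> young_tableau Y \<and> B \<and> C"
    unfolding oc_semistandard_def eq rows chain B_def C_def by (rule refl)
  moreover have "C \<Longrightarrow> young_tableau Y" unfolding C_def by (rule young)
  ultimately show ?thesis unfolding B_def[symmetric] C_def[symmetric] by blast
qed (auto simp: oc_semistandard_def)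

text \<open>
  This linear map turns the indicator of the cells \<open>(i, t\<^sub>i)\<close> of a tuple into the indicator of the
  marks of its ideal.
\<close>

definition mark_transfer :: "(nat \<times> nat \<Rightarrow> 'a :: semiring_1) \<Rightarrow> nat \<times> nat \<Rightarrow> 'a" where
  "mark_transfer y = (\<lambda>(i, v). if (i, v) \<in> U \<union> diagA n
     then \<Sum>v'\<in>{v..n}. y (i, tau i v') else y (i, tau i v))"

definition column_indicator :: "nat list \<Rightarrow> nat \<times> nat \<Rightarrow> 'a :: semiring_1" where
  "column_indicator c = (\<lambda>(i, a). of_bool (1 \<le> i \<and> i \<le> length c \<and> c ! (i - 1) = a))"

lemma mark_transfer_column:
  assumes c: "oc_tuple n U c" and p: "p \<in> posetP n"
  shows "mark_transfer (column_indicator c) p = (of_bool (p \<in> ideal_marks n U (ideal_of c)) :: 'a :: semiring_1)"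
proof -
  obtain i v where iv: "p = (i, v)" "1 \<le> i" "i \<le> v" "v \<le> n" using p by (auto simp: posetP_def)
  have ind: "column_indicator c (i, tau i v') = (of_bool (i \<le> length c \<and> v' = pos c i) :: 'a)"
    if v': "v' \<in> {1..n}" for v'
  proof -
    have "c ! (i - 1) = tau i v' \<longleftrightarrow> v' = pos c i" if il: "i \<le> length c"
    proof -
      have "c ! (i - 1) \<in> {1..n}" using tuple_nth_range oc_tupleD(5)[OF c] iv il by blast
      then show ?thesis
        using rows_above_sigma[of i "c ! (i - 1)"] sigma_rows_above[of i v'] iv v' by (auto simp: tuple_pos_def)
    qed
    then show ?thesis using iv by (auto simp: column_indicator_def)
  qed
  show ?thesis
  proof (cases "(i, v) \<in> U \<union> diagA n")
    case True
    have "mark_transfer (column_indicator c) p = (\<Sum>v'\<in>{v..n}. of_bool (i \<le> length c \<and> v' = pos c i) :: 'a)"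
      using True iv ind by (auto simp: mark_transfer_def intro!: sum.cong)
    also have "\<dots> = of_bool (i \<le> length c \<and> v \<le> pos c i)"
    proof (cases "i \<le> length c \<and> v \<le> pos c i")
      case True
      then have "pos c i \<in> {v..n}" using oc_tupleD(7)[OF c, of i] iv by auto
      then show ?thesis using True by (subst sum.remove[of _ "pos c i"]) (auto intro!: sum.neutral)
    next
      case False
      have "(\<Sum>v'\<in>{v..n}. of_bool (i \<le> length c \<and> v' = pos c i) :: 'a) = 0"
        by (rule sum.neutral) (use False in auto)
      moreover have "of_bool (i \<le> length c \<and> v \<le> pos c i) = (0 :: 'a)" using False by simp
      ultimately show ?thesis by (rule trans[OF _ sym])
    qed
    finally show ?thesis using True iv by (auto simp: marks_tuple_ideal[OF c])
  next
    case False
    then show ?thesis using iv ind[of v] by (auto simp: mark_transfer_def marks_tuple_ideal[OF c])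
  qed
qed

lemma mark_transfer_sum_list:
  fixes f :: "nat list \<Rightarrow> nat \<times> nat \<Rightarrow> 'b :: semiring_1"
  shows "mark_transfer (\<lambda>p. sum_list (map (\<lambda>c. f c p) Y)) q = sum_list (map (\<lambda>c. mark_transfer (f c) q) Y)"
proof -
  have "mark_transfer (\<lambda>p. x p + y p) q = mark_transfer x q + mark_transfer y q" for x y :: "nat \<times> nat \<Rightarrow> 'b"
    by (auto simp: mark_transfer_def sum.distrib split: prod.splits)
  moreover have "mark_transfer (\<lambda>p. 0) q = (0 :: 'b)" by (auto simp: mark_transfer_def split: prod.splits)
  ultimately show ?thesis by (induction Y) simp_all
qed

lemma lookup_tuple_monomial: "lookup (tuple_monomial c) p = column_indicator c p"
proof (cases p)
  case (Pair i a)
  have "lookup (tuple_monomial c) p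
      = (\<Sum>r<length c. if r = i - 1 then of_bool (1 \<le> i \<and> c ! (i - 1) = a) else 0)"
    unfolding tuple_monomial_def lookup_sum lookup_single Pair
    by (rule sum.cong) (auto simp: when_def)
  also have "\<dots> = (if i - 1 \<in> {..<length c} then of_bool (1 \<le> i \<and> c ! (i - 1) = a) else 0)"
    by (rule sum.delta[OF finite_lessThan])
  also have "\<dots> = column_indicator c (i, a)"
    unfolding column_indicator_def prod.case by (cases "1 \<le> i \<and> i \<le> length c") auto
  finally show ?thesis unfolding Pair .
qed

lemma lookup_tableau_exponent:
  "lookup (tableau_exponent Y) p = sum_list (map (\<lambda>c. column_indicator c p) Y)"
  by (induction Y) (simp_all add: tableau_exponent_def lookup_add lookup_tuple_monomial)

lemma mark_count:
  assumes "\<forall>c\<in>set Y. oc_tuple n U c" "p \<in> posetP n"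
  shows "mark_transfer (lookup (tableau_exponent Y)) p
    = sum_list (map (\<lambda>c. of_bool (p \<in> ideal_marks n U (ideal_of c))) Y)"
proof -
  have "lookup (tableau_exponent Y) = (\<lambda>p. sum_list (map (\<lambda>c. column_indicator c p) Y))"
    using lookup_tableau_exponent by auto
  then have "mark_transfer (lookup (tableau_exponent Y)) p
      = sum_list (map (\<lambda>c. mark_transfer (column_indicator c) p) Y)"
    by (simp only: mark_transfer_sum_list)
  also have "\<dots> = sum_list (map (\<lambda>c. of_bool (p \<in> ideal_marks n U (ideal_of c))) Y)"
    using assms by (intro arg_cong[where f = sum_list] map_cong refl mark_transfer_column) auto
  finally show ?thesis .
qed

end

text \<open>
  The members of a decreasing chain that contain a given element form an initial segment, so the chain
  is encoded by the lengths of these segments.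
\<close>

lemma chain_membership:
  assumes "sorted_wrt (\<lambda>J J'. J' \<subseteq> J) Js" "c < length Js"
  shows "p \<in> Js ! c \<longleftrightarrow> c < length (filter (\<lambda>J. p \<in> J) Js)"
  using assms
proof (induction Js arbitrary: c)
  case (Cons J Js)
  show ?case
  proof (cases "p \<in> J")
    case True
    show ?thesis
    proof (cases c)
      case (Suc c')
      then have "p \<in> Js ! c' \<longleftrightarrow> c' < length (filter (\<lambda>J. p \<in> J) Js)"
        using Cons.prems by (intro Cons.IH) auto
      then show ?thesis using True Suc by simp
    qed (use True in simp)
  next
    case False
    then have "\<forall>J'\<in>set (J # Js). p \<notin> J'" using Cons.prems by auto
    then have none: "filter (\<lambda>J. p \<in> J) (J # Js) = []" unfolding filter_empty_conv by blast
    have "p \<notin> (J # Js) ! c"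
      using \<open>\<forall>J'\<in>set (J # Js). p \<notin> J'\<close> nth_mem[OF Cons.prems(2)] by blast
    then show ?thesis unfolding none by simp
  qed
qed simp

lemma chain_count:
  assumes sorted: "sorted_wrt (\<lambda>J J'. J' \<subseteq> J) Js"
  defines "N \<equiv> \<lambda>p. length (filter (\<lambda>J. p \<in> J) Js)"
  shows "length (filter (\<lambda>J. p \<in> J \<and> q \<notin> J \<and> r \<notin> J) Js) = N p - max (N q) (N r)"
proof -
  have "length (filter (\<lambda>J. p \<in> J \<and> q \<notin> J \<and> r \<notin> J) Js)
      = card {c. c < length Js \<and> (p \<in> Js ! c \<and> q \<notin> Js ! c \<and> r \<notin> Js ! c)}"
    by (rule length_filter_conv_card)
  also have "{c. c < length Js \<and> (p \<in> Js ! c \<and> q \<notin> Js ! c \<and> r \<notin> Js ! c)} = {max (N q) (N r)..<N p}"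
  proof -
    have "N p \<le> length Js" unfolding N_def by (rule length_filter_le)
    have "c < length Js \<and> (p \<in> Js ! c \<and> q \<notin> Js ! c \<and> r \<notin> Js ! c) \<longleftrightarrow> max (N q) (N r) \<le> c \<and> c < N p" for c
    proof (cases "c < length Js")
      case True
      then show ?thesis
        using chain_membership[OF sorted True, of p] chain_membership[OF sorted True, of q]
          chain_membership[OF sorted True, of r] by (auto simp: N_def not_less)
    qed (use \<open>N p \<le> length Js\<close> in simp)
    then show ?thesis by (simp add: atLeastLessThan_def atLeast_def lessThan_def Int_def)
  qed
  finally show ?thesis by simp
qed

context order_part
begin

text \<open>
  Away from the order and diagonal elements, a mark is a maximal element, and maximality needs to be
  tested on the two upper covers only; the element \<open>(Suc i, v)\<close> lies in the poset since \<open>i < v\<close>.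
\<close>

lemma mark_iff_no_cover:
  assumes J: "J \<in> order_ideals n" and iv: "(i, v) \<in> posetP n" "(i, v) \<notin> U \<union> diagA n"
  shows "(i, v) \<in> ideal_marks n U J \<longleftrightarrow> (i, v) \<in> J \<and> (i, Suc v) \<notin> J \<and> (Suc i, v) \<notin> J"
proof -
  have lt: "1 \<le> i" "i < v" "v \<le> n" using iv by (auto simp: posetP_def diagA_def)
  have "(i, v) \<in> max_elems J" if *: "(i, v) \<in> J" "(i, Suc v) \<notin> J" "(Suc i, v) \<notin> J"
  proof -
    have "q = (i, v)" if q: "q \<in> J" "(i, v) \<preceq>\<^sub>P q" for q
    proof (rule ccontr)
      assume "q \<noteq> (i, v)"
      then consider "Suc i \<le> fst q" | "Suc v \<le> snd q"
        using q by (cases q) (auto simp: pleq_def)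
      then show False
        using * q lt order_ideal_down[OF J, of "fst q" "snd q" "Suc i" v]
          order_ideal_down[OF J, of "fst q" "snd q" i "Suc v"]
        by cases (auto simp: pleq_def)
    qed
    then show ?thesis using * by (auto simp: max_elems_def)
  qed
  moreover have "(i, v) \<in> J \<and> (i, Suc v) \<notin> J \<and> (Suc i, v) \<notin> J" if "(i, v) \<in> max_elems J"
    using that by (auto simp: max_elems_def pleq_def)
  ultimately show ?thesis using iv(2) by (auto simp: ideal_marks_def)
qed

text \<open>
  At an order or diagonal element the number of marks counts the members of the chain that contain
  the element, elsewhere those that contain it but neither of its upper covers. So the numbers of
  members that contain a given element can be computed from the top of the poset downwards.
\<close>

lemma chain_determined_by_marks:
  assumes Js: "sorted_wrt (\<lambda>J J'. J' \<subseteq> J) Js" "set Js \<subseteq> order_ideals n"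
    and Js': "sorted_wrt (\<lambda>J J'. J' \<subseteq> J) Js'" "set Js' \<subseteq> order_ideals n"
    and eq: "\<And>p. p \<in> posetP n \<Longrightarrow> length (filter (\<lambda>J. p \<in> ideal_marks n U J) Js)
      = length (filter (\<lambda>J. p \<in> ideal_marks n U J) Js')"
  shows "length (filter (\<lambda>J. p \<in> J) Js) = length (filter (\<lambda>J. p \<in> J) Js')"
proof (induction "2 * n - (fst p + snd p)" arbitrary: p rule: less_induct)
  case less
  show ?case
  proof (cases "p \<in> posetP n")
    case False
    then have "filter (\<lambda>J. p \<in> J) Js = []" "filter (\<lambda>J. p \<in> J) Js' = []"
      using Js(2) Js'(2) by (auto simp: filter_empty_conv order_ideals_def)
    then show ?thesis by simp
  next
    case P: True
    obtain i v where iv: "p = (i, v)" by (cases p)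
    show ?thesis
    proof (cases "p \<in> U \<union> diagA n")
      case True
      then have "p \<in> ideal_marks n U J \<longleftrightarrow> p \<in> J" for J by (auto simp: ideal_marks_def max_elems_def)
      then show ?thesis using eq[OF P] by simp
    next
      case False
      let ?N = "\<lambda>p. length (filter (\<lambda>J. p \<in> J) Js)" and ?N' = "\<lambda>p. length (filter (\<lambda>J. p \<in> J) Js')"
      have lt: "i < v" "v \<le> n" using P False iv by (auto simp: posetP_def diagA_def)
      have count: "length (filter (\<lambda>J. p \<in> ideal_marks n U J) Ks)
          = length (filter (\<lambda>J. p \<in> J) Ks) - max (length (filter (\<lambda>J. (i, Suc v) \<in> J) Ks))
              (length (filter (\<lambda>J. (Suc i, v) \<in> J) Ks))"
        if "sorted_wrt (\<lambda>J J'. J' \<subseteq> J) Ks" "set Ks \<subseteq> order_ideals n" for Ks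
      proof -
        have "filter (\<lambda>J. p \<in> ideal_marks n U J) Ks
            = filter (\<lambda>J. p \<in> J \<and> (i, Suc v) \<notin> J \<and> (Suc i, v) \<notin> J) Ks"
          using that(2) mark_iff_no_cover[of _ i v] P False iv by (intro filter_cong) auto
        then show ?thesis using chain_count[OF that(1)] by simp
      qed
      have right: "?N (i, Suc v) = ?N' (i, Suc v)" and down: "?N (Suc i, v) = ?N' (Suc i, v)"
        using lt by (intro less.hyps; simp add: iv)+
      have le: "length (filter (\<lambda>J. q \<in> J) Ks) \<le> length (filter (\<lambda>J. p \<in> J) Ks)"
        if Ks: "set Ks \<subseteq> order_ideals n" and q: "q \<in> {(i, Suc v), (Suc i, v)}" for Ks q
      proof -
        have "p \<in> J" if "J \<in> set Ks" "q \<in> J" for J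
          using that Ks q iv P order_ideal_down[of J "fst q" "snd q" i v] by (auto simp: posetP_def)
        then show ?thesis
        proof (induction Ks)
          case (Cons J Ks)
          then show ?case by (auto simp: le_SucI)
        qed simp
      qed
      show ?thesis
        using eq[OF P] count[OF Js] count[OF Js'] right down
          le[OF Js(2), of "(i, Suc v)"] le[OF Js(2), of "(Suc i, v)"]
          le[OF Js'(2), of "(i, Suc v)"] le[OF Js'(2), of "(Suc i, v)"]
        by (simp add: max_def split: if_splits)
    qed
  qed
qed

text \<open>
  The exponents give the numbers of marks, these give the chain of ideals, and the ideals give the
  columns.
\<close>

lemma tableau_exponent_inj:
  assumes Y: "oc_semistandard n U Y" and Y': "oc_semistandard n U Y'"
    and eq: "tableau_exponent Y = tableau_exponent Y'"
  shows "Y = Y'"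
proof -
  have oc: "\<forall>c\<in>set Y. oc_tuple n U c" "\<forall>c\<in>set Y'. oc_tuple n U c"
    using Y Y' by (auto simp: oc_semistandard_iff)
  let ?J = "ideal_of"
  let ?N = "\<lambda>Y p. length (filter (\<lambda>J. p \<in> J) (map ?J Y))"
  have chain: "sorted_wrt (\<lambda>J J'. J' \<subseteq> J) (map ?J Y)" "sorted_wrt (\<lambda>J J'. J' \<subseteq> J) (map ?J Y')"
    using Y Y' by (simp_all add: oc_semistandard_iff sorted_wrt_map)
  have ideals: "set (map ?J Y) \<subseteq> order_ideals n" "set (map ?J Y') \<subseteq> order_ideals n"
    using oc tuple_ideal_mem by (auto simp: order_ideals_k_def)
  have marks: "sum_list (map (\<lambda>c. of_bool (p \<in> ideal_marks n U (?J c))) Z)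
      = length (filter (\<lambda>J. p \<in> ideal_marks n U J) (map ?J Z))" for p Z
    by (induction Z) auto
  have N: "?N Y p = ?N Y' p" for p
  proof (rule chain_determined_by_marks[OF chain(1) ideals(1) chain(2) ideals(2)])
    fix p assume "p \<in> posetP n"
    then show "length (filter (\<lambda>J. p \<in> ideal_marks n U J) (map ?J Y))
      = length (filter (\<lambda>J. p \<in> ideal_marks n U J) (map ?J Y'))"
      using mark_count[OF oc(1)] mark_count[OF oc(2)] eq unfolding marks[symmetric] by metis
  qed
  have "(1, 1) \<in> ?J c" if "oc_tuple n U c" for c
    using diag_tuple_ideal[OF that, of 1] oc_tupleD(1)[OF that] by simp
  then have "filter (\<lambda>J. (1, 1) \<in> J) (map ?J Y) = map ?J Y" "filter (\<lambda>J. (1, 1) \<in> J) (map ?J Y') = map ?J Y'"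
    using oc by (auto intro!: filter_True)
  then have len: "length Y = length Y'" using N[of "(1, 1)"] by (metis length_map)
  show ?thesis
  proof (rule nth_equalityI[OF len])
    fix c assume c: "c < length Y"
    have "p \<in> ?J (Y ! c) \<longleftrightarrow> p \<in> ?J (Y' ! c)" for p
      using chain_membership[OF chain(1), of c p] chain_membership[OF chain(2), of c p] N[of p] c len by simp
    then have "?J (Y ! c) = ?J (Y' ! c)" by blast
    then show "Y ! c = Y' ! c" using tuple_ideal_inj oc c len by auto
  qed
qed

end

section \<open>Counting tableaux\<close>

context order_part
begin

definition standard_tableaux :: "nat list \<Rightarrow> nat list list set" where
  "standard_tableaux ks = {Y. oc_semistandard n U Y \<and> map length Y = ks}"

text \<open>
  The ideal whose row \<open>i\<close> ends \<open>t\<^sub>i - i\<close> steps before column \<open>n\<close>. Comparing columns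
  entrywise amounts to comparing these ideals.
\<close>

definition column_ideal :: "nat list \<Rightarrow> (nat \<times> nat) set" where
  "column_ideal t = {(i, v) \<in> posetP n. i \<le> length t \<and> v + t ! (i - 1) \<le> n + i}"

lemma mem_column_ideal:
  "(i, v) \<in> column_ideal t \<longleftrightarrow> 1 \<le> i \<and> i \<le> v \<and> v \<le> n \<and> i \<le> length t \<and> v + t ! (i - 1) \<le> n + i"
  by (auto simp: column_ideal_def posetP_def)

lemma strict_sorted_gap:
  assumes "sorted_wrt (<) (t :: nat list)" "i \<le> j" "j < length t"
  shows "t ! i + (j - i) \<le> t ! j"
  using assms(2,3)
proof (induction j rule: dec_induct)
  case (step j)
  have "t ! j < t ! Suc j" using assms(1) step by (auto simp: sorted_wrt_iff_nth_less)
  then show ?case using step by simp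
qed simp

lemma strict_sorted_ge:
  assumes "sorted_wrt (<) t" "set t \<subseteq> {1..n}" "1 \<le> i" "i \<le> length t"
  shows "i \<le> t ! (i - 1)" "t ! (i - 1) \<le> n"
proof -
  have "t ! 0 \<in> set t" "t ! (i - 1) \<in> set t" using assms(3,4) by (auto intro!: nth_mem)
  then have "1 \<le> t ! 0" "t ! (i - 1) \<le> n" using assms(2) by auto
  moreover have "i - 1 < length t" using assms(3,4) by linarith
  then have "t ! 0 + (i - 1 - 0) \<le> t ! (i - 1)" by (rule strict_sorted_gap[OF assms(1) le0])
  ultimately show "i \<le> t ! (i - 1)" "t ! (i - 1) \<le> n" by linarith+
qed

lemma column_ideal_mem:
  assumes t: "sorted_wrt (<) t" "set t \<subseteq> {1..n}" "length t \<le> n - 1"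
  shows "column_ideal t \<in> order_ideals_k n (length t)"
proof (rule order_ideals_kI)
  show "column_ideal t \<subseteq> posetP n" by (auto simp: column_ideal_def)
  show "(i, i) \<in> column_ideal t \<longleftrightarrow> 1 \<le> i \<and> i \<le> length t" for i
    using strict_sorted_ge(2)[OF t(1,2), of i] t(3) by (auto simp: mem_column_ideal)
  show "length t \<le> n" using t(3) by simp
  fix i v i' v' assume iv: "(i, v) \<in> column_ideal t" and le: "1 \<le> i'" "i' \<le> v'" "i' \<le> i" "v' \<le> v"
  have "i \<le> length t" using iv by (simp add: mem_column_ideal)
  then have "i' - 1 \<le> i - 1" "i - 1 < length t" "i - 1 - (i' - 1) = i - i'" using le by linarith+
  then have "t ! (i' - 1) + (i - i') \<le> t ! (i - 1)" using strict_sorted_gap[OF t(1)] by metis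
  then show "(i', v') \<in> column_ideal t" using iv le by (auto simp: mem_column_ideal)
qed

lemma column_ideal_antimono:
  assumes "column_le a b"
  shows "column_ideal b \<subseteq> column_ideal a"
proof
  fix p assume p: "p \<in> column_ideal b"
  obtain i v where iv: "p = (i, v)" by (cases p)
  have r: "1 \<le> i" "i \<le> length b" "v + b ! (i - 1) \<le> n + i" "i \<le> v" "v \<le> n"
    using p by (auto simp: iv mem_column_ideal)
  have "a ! (i - 1) \<le> b ! (i - 1)" "length b \<le> length a" using assms r by (auto simp: column_le_def)
  then show "p \<in> column_ideal a" using r by (simp add: iv mem_column_ideal)
qed

lemma column_ideal_inj:
  assumes t: "sorted_wrt (<) t" "set t \<subseteq> {1..n}" and t': "sorted_wrt (<) t'" "set t' \<subseteq> {1..n}"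
    and eq: "length t = length t'" "column_ideal t = column_ideal t'"
  shows "t = t'"
proof -
  have le: "b ! j \<le> a ! j"
    if "sorted_wrt (<) a" "set a \<subseteq> {1..n}" "column_ideal a = column_ideal b" "j < length a" for a b j
  proof -
    let ?i = "Suc j"
    let ?v = "n + ?i - a ! j"
    have "?i \<le> a ! j" "a ! j \<le> n" using strict_sorted_ge[OF that(1,2), of ?i] that(4) by auto
    then have "?i \<le> ?v" "?v \<le> n" "?v + a ! j = n + ?i" by arith+
    then have "(?i, ?v) \<in> column_ideal a" using that(4) by (simp add: mem_column_ideal)
    then have "?v + b ! j \<le> n + ?i" unfolding that(3) by (simp add: mem_column_ideal)
    then show ?thesis using \<open>a ! j \<le> n\<close> by simp
  qed
  show ?thesis
    using le[OF t eq(2)] le[OF t' eq(2)[symmetric]] eq(1)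
    by (intro nth_equalityI) (auto intro: antisym)
qed

lemma finite_sorted_tableaux: "finite (sorted_tableaux n ks)"
proof (rule finite_subset)
  let ?C = "{c :: nat list. set c \<subseteq> {1..n} \<and> length c \<le> Max (set (0 # ks))}"
  show "sorted_tableaux n ks \<subseteq> {Y. set Y \<subseteq> ?C \<and> length Y = length ks}"
  proof
    fix Y assume Y: "Y \<in> sorted_tableaux n ks"
    have "length c \<le> Max (set (0 # ks))" if "c \<in> set Y" for c
    proof (rule Max_ge)
      have "ks = map length Y" using Y by (auto simp: sorted_tableaux_def)
      then show "length c \<in> set (0 # ks)" using that by simp
    qed simp
    moreover have "length Y = length ks" using Y by (auto simp: sorted_tableaux_def)
    ultimately show "Y \<in> {Y. set Y \<subseteq> ?C \<and> length Y = length ks}"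
      using Y by (auto simp: sorted_tableaux_def)
  qed
  show "finite {Y. set Y \<subseteq> ?C \<and> length Y = length ks}"
    by (intro finite_lists_length_eq finite_lists_length_le) simp
qed

text \<open>
  The columns of a classical tableau give a decreasing chain of ideals, and each of these ideals is
  the ideal of a tuple of the same length. So there are at least as many standard as classical
  tableaux.
\<close>

lemma classical_to_standard:
  assumes ks: "set ks \<subseteq> {1..n - 1}"
  obtains g where "inj_on g (classical_tableaux n ks)" "g ` classical_tableaux n ks \<subseteq> standard_tableaux ks"
proof -
  define col where "col t = (SOME c. oc_tuple n U c \<and> length c = length t \<and> ideal_of c = column_ideal t)" for t
  have col: "oc_tuple n U (col t)" "length (col t) = length t" "ideal_of (col t) = column_ideal t"
    if t: "sorted_wrt (<) t" "set t \<subseteq> {1..n}" "length t \<in> {1..n - 1}" for t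
  proof -
    have "column_ideal t \<in> order_ideals_k n (length t)" using t by (intro column_ideal_mem) auto
    then obtain c where "oc_tuple n U c \<and> length c = length t \<and> ideal_of c = column_ideal t"
      using order_ideal_tuple[of "column_ideal t" "length t"] t(3) by (metis atLeastAtMost_iff)
    then have "oc_tuple n U (col t) \<and> length (col t) = length t \<and> ideal_of (col t) = column_ideal t"
      unfolding col_def by (rule someI)
    then show "oc_tuple n U (col t)" "length (col t) = length t" "ideal_of (col t) = column_ideal t" by auto
  qed
  have column: "sorted_wrt (<) c" "set c \<subseteq> {1..n}" "length c \<in> {1..n - 1}"
    if "Y \<in> classical_tableaux n ks" "c \<in> set Y" for Y c
  proof -
    have "ks = map length Y" using that(1) by (auto simp: classical_tableaux_def sorted_tableaux_def)
    then have "length c \<in> set ks" using that(2) by simp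
    then show "length c \<in> {1..n - 1}" using ks by blast
  qed (use that in \<open>auto simp: classical_tableaux_def sorted_tableaux_def\<close>)
  show thesis
  proof
    show "inj_on (map col) (classical_tableaux n ks)"
    proof (rule inj_onI)
      fix Y Y' assume Y: "Y \<in> classical_tableaux n ks" and Y': "Y' \<in> classical_tableaux n ks"
        and eq: "map col Y = map col Y'"
      have len: "map length Y = map length Y'" using Y Y' by (simp add: classical_tableaux_def sorted_tableaux_def)
      show "Y = Y'"
      proof (rule nth_equalityI)
        show lY: "length Y = length Y'" using eq by (rule map_eq_imp_length_eq)
        fix j assume j: "j < length Y"
        have "Y ! j \<in> set Y" "Y' ! j \<in> set Y'" using j lY by auto
        note c = column[OF Y this(1)] and c' = column[OF Y' this(2)]
        have "col (Y ! j) = col (Y' ! j)" using arg_cong[OF eq, of "\<lambda>l. l ! j"] j lY by simp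
        then have "column_ideal (Y ! j) = column_ideal (Y' ! j)"
          using col(3)[OF c] col(3)[OF c'] by simp
        moreover have "length (Y ! j) = length (Y' ! j)"
          using arg_cong[OF len, of "\<lambda>l. l ! j"] j lY by simp
        ultimately show "Y ! j = Y' ! j" using column_ideal_inj c c' by blast
      qed
    qed
    show "map col ` classical_tableaux n ks \<subseteq> standard_tableaux ks"
    proof
      fix Z assume "Z \<in> map col ` classical_tableaux n ks"
      then obtain Y where Y: "Y \<in> classical_tableaux n ks" "Z = map col Y" by auto
      have "map length Z = ks"
      proof -
        have "map length Z = map length Y" unfolding Y(2) map_map
          by (rule map_cong) (use col(2) column[OF Y(1)] in auto)
        also have "\<dots> = ks" using Y(1) by (simp add: classical_tableaux_def sorted_tableaux_def)
        finally show ?thesis .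
      qed
      moreover have "sorted_wrt (\<lambda>c c'. ideal_of (col c') \<subseteq> ideal_of (col c)) Y"
      proof (rule sorted_wrt_mono_rel)
        show "sorted_wrt column_le Y" using Y by (simp add: classical_tableaux_def)
        show "ideal_of (col c') \<subseteq> ideal_of (col c)"
          if "c \<in> set Y" "c' \<in> set Y" "column_le c c'" for c c'
          using column_ideal_antimono[OF that(3)] col(3) column[OF Y(1)] that by auto
      qed
      then have "oc_semistandard n U Z"
        unfolding oc_semistandard_iff Y(2) sorted_wrt_map using col(1) column[OF Y(1)] by auto
      ultimately show "Z \<in> standard_tableaux ks" by (simp add: standard_tableaux_def)
    qed
  qed
qed


section \<open>The basis of standard monomials\<close>

lemma standard_leads:
  "oc_semistandard n U Y \<Longrightarrow> leads var_weight (minor_product Y) (tableau_exponent Y)"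
  by (rule leads_minor_product) (simp add: oc_semistandard_iff)

lemma minor_product_inj:
  assumes "oc_semistandard n U Y" "oc_semistandard n U Y'"
    "leads var_weight (minor_product Y) m" "leads var_weight (minor_product Y') m"
  shows "Y = Y'"
  using assms leads_unique standard_leads tableau_exponent_inj by metis

lemma minor_product_sort_columns:
  "minor_product Y \<in> {minor_product (map sort Y), - minor_product (map sort Y)}"
proof (induction Y)
  case (Cons c Y)
  then show ?case using minor_sort[of c] by (auto simp: minor_product_def)
qed (simp add: minor_product_def)

lemma oc_product_in_span_classical:
  assumes "sorted_wrt (\<ge>) ks" "\<forall>c\<in>set Y. oc_tuple n U c" "map length Y = ks"
  shows "minor_product Y \<in> cpoly.span (minor_product ` classical_tableaux n ks)"
proof -
  have "map sort Y \<in> sorted_tableaux n ks"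
    using assms oc_tupleD(4,5) by (auto simp: sorted_tableaux_def strict_sorted_iff)
  then have "minor_product (map sort Y) \<in> cpoly.span (minor_product ` classical_tableaux n ks)"
    by (rule minor_product_in_span_classical[OF assms(1)])
  then show ?thesis using minor_product_sort_columns[of Y] by (auto dest: cpoly.span_neg)
qed

lemma independent_standard:
  assumes "\<And>Y. Y \<in> S \<Longrightarrow> oc_semistandard n U Y"
  shows "cpoly.independent (minor_product ` S)" "inj_on minor_product S"
proof -
  show "cpoly.independent (minor_product ` S)"
  proof (rule independent_if_distinct_leads)
    show "\<exists>m. leads var_weight p m" if "p \<in> minor_product ` S" for p
      using that assms standard_leads by blast
    show "p = q" if "p \<in> minor_product ` S" "q \<in> minor_product ` S" "leads var_weight p m" "leads var_weight q m" for p q m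
      using that assms minor_product_inj by blast
  qed
  show "inj_on minor_product S"
    using assms standard_leads minor_product_inj unfolding inj_on_def by metis
qed

text \<open>
  The standard products are independent, they lie in the span of the classical products, and there
  are at least as many of them. This replaces a straightening algorithm for the standard products.
\<close>

lemma span_classical_subset_standard:
  assumes ks: "sorted_wrt (\<ge>) ks" "set ks \<subseteq> {1..n - 1}"
  shows "cpoly.span (minor_product ` classical_tableaux n ks) \<subseteq> cpoly.span (minor_product ` standard_tableaux ks)"
proof
  let ?A = "minor_product ` classical_tableaux n ks" and ?B = "minor_product ` standard_tableaux ks"
  have ss: "oc_semistandard n U Y" if "Y \<in> standard_tableaux ks" for Y
    using that by (simp add: standard_tableaux_def)
  have finC: "finite (classical_tableaux n ks)"
    by (rule finite_subset[OF _ finite_sorted_tableaux]) (auto simp: classical_tableaux_def)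
  have BA: "?B \<subseteq> cpoly.span ?A"
    using oc_product_in_span_classical[OF ks(1)] by (auto simp: standard_tableaux_def oc_semistandard_iff)
  have indep: "cpoly.independent ?B" and inj: "inj_on minor_product (standard_tableaux ks)"
    using independent_standard[of "standard_tableaux ks"] ss by auto
  have finB: "finite ?B"
    using cpoly.independent_span_bound[OF finite_imageI[OF finC] indep BA] by simp
  then have finS: "finite (standard_tableaux ks)" using inj by (rule finite_imageD)
  fix x assume x: "x \<in> cpoly.span ?A"
  show "x \<in> cpoly.span ?B"
  proof (rule ccontr)
    assume notin: "x \<notin> cpoly.span ?B"
    then have "cpoly.independent (insert x ?B)" using indep by (intro cpoly.independent_insertI)
    then have "card (insert x ?B) \<le> card ?A"
      using cpoly.independent_span_bound[OF finite_imageI[OF finC], of "insert x ?B"] BA x by auto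
    moreover have "x \<notin> ?B" using notin cpoly.span_base by blast
    ultimately have "Suc (card ?B) \<le> card ?A" using finB by simp
    also have "\<dots> \<le> card (classical_tableaux n ks)" using finC by (rule card_image_le)
    also have "\<dots> \<le> card (standard_tableaux ks)"
      using classical_to_standard[OF ks(2)] finS by (metis card_inj_on_le)
    also have "\<dots> = card ?B" using inj by (simp add: card_image)
    finally show False by simp
  qed
qed

text \<open>
  A product of minors of arbitrary tuples lies in the span of the standard products of its shape, so
  its leading monomial is one of theirs. On exponents, this rewrites any sum of vertices as the sum
  over a chain, without a combinatorial algorithm.
\<close>

lemma exponent_is_standard:
  assumes ks: "sorted_wrt (\<ge>) ks" and Y: "\<forall>c\<in>set Y. oc_tuple n U c" "map length Y = ks"
  obtains Z where "Z \<in> standard_tableaux ks" "tableau_exponent Z = tableau_exponent Y"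
proof -
  have "set ks \<subseteq> {1..n - 1}" using Y oc_tupleD(1,2) by fastforce
  then have span: "minor_product Y \<in> cpoly.span (minor_product ` standard_tableaux ks)"
    using oc_product_in_span_classical[OF ks Y] span_classical_subset_standard[OF ks] by blast
  have ss: "oc_semistandard n U Z" if "Z \<in> standard_tableaux ks" for Z
    using that by (simp add: standard_tableaux_def)
  obtain p where "p \<in> minor_product ` standard_tableaux ks" "leads var_weight p (tableau_exponent Y)"
  proof (rule leads_span)
    show "\<exists>m. leads var_weight p m" if p: "p \<in> minor_product ` standard_tableaux ks" for p
      using p standard_leads ss by blast
    show "p = q" if pq: "p \<in> minor_product ` standard_tableaux ks" "q \<in> minor_product ` standard_tableaux ks"
      "leads var_weight p m" "leads var_weight q m" for p q m
    proof -
      obtain A B where AB: "A \<in> standard_tableaux ks" "p = minor_product A"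
        "B \<in> standard_tableaux ks" "q = minor_product B" using pq(1,2) by blast
      then have "A = B" using minor_product_inj[OF ss ss] pq(3,4) by blast
      then show ?thesis using AB by simp
    qed
    show "leads var_weight (minor_product Y) (tableau_exponent Y)" by (rule leads_minor_product[OF Y(1)])
    show "minor_product Y \<in> cpoly.span (minor_product ` standard_tableaux ks)" by (rule span)
  qed (rule that)
  then obtain Z where "Z \<in> standard_tableaux ks" "leads var_weight (minor_product Z) (tableau_exponent Y)" by blast
  then show thesis using that leads_unique[OF standard_leads[OF ss]] by blast
qed

end

lemma minor_closed:
  assumes "set t \<subseteq> {1..n}" "length t \<le> n - 1"
  shows "minor t \<in> carrier (matrix_poly_ring n)"
  unfolding minor_eq_minor_fun minor_fun_expand matrix_poly_ring_def
proof (intro poly_ring_sum poly_ring_mult poly_ring_of_int poly_ring_prod poly_ring_cvar)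
  fix p c assume p: "p \<in> {p. p permutes {0..<length t}}" and c: "c \<in> {..<length t}"
  have "p c < length t" using p c permutes_in_image[of p "{0..<length t}" c] by auto
  moreover have "t ! c \<in> {1..n}" using assms(1) c nth_mem by blast
  ultimately show "(p c + 1, t ! c) \<in> {1..n - 1} \<times> {1..n}" using assms(2) by auto
qed

lemma pluecker_map_tableau:
  assumes "\<forall>c\<in>set Y. distinct c"
  shows "pluecker_map (tableau_monomial Y) \<in> {minor_product Y, - minor_product Y}"
  using assms
proof (induction Y)
  case Nil
  then show ?case by (simp add: tableau_monomial_def minor_product_def pluecker_map_def)
next
  case (Cons c Y)
  have "pluecker_var c \<in> {cvar (sort c), - cvar (sort c)}"
    using Cons.prems by (simp add: pluecker_var_def sign_def)
  then have "pluecker_map (pluecker_var c) \<in> {minor c, - minor c}"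
    using minor_sort[of c] by (auto simp: pluecker_map_def poly_subst_uminus)
  moreover have "pluecker_map (tableau_monomial (c # Y))
      = pluecker_map (pluecker_var c) * pluecker_map (tableau_monomial Y)"
    by (simp add: tableau_monomial_def pluecker_map_def poly_subst_mult)
  ultimately show ?case using Cons by (auto simp: minor_product_def)
qed

lemma eval_monomial_minor_product:
  obtains Y where "set Y \<subseteq> keys m" "sorted_wrt (\<ge>) (map length Y)"
    "eval_monomial minor m = minor_product Y"
proof -
  have powers: "\<exists>Y. set Y \<subseteq> S \<and> (\<Prod>v\<in>S. minor v ^ k v) = minor_product Y" if "finite S" for S and k :: "nat list \<Rightarrow> nat"
    using that
  proof (induction S rule: finite_induct)
    case empty
    then show ?case by (intro exI[of _ "[]"]) (simp add: minor_product_def)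
  next
    case (insert v S)
    then obtain Y where "set Y \<subseteq> S" "(\<Prod>v\<in>S. minor v ^ k v) = minor_product Y" by blast
    then show ?case using insert(1,2)
      by (intro exI[of _ "replicate (k v) v @ Y"]) (auto simp: minor_product_def prod_list_replicate)
  qed
  obtain Y where Y: "set Y \<subseteq> keys m" "eval_monomial minor m = minor_product Y"
    using powers[OF finite_keys, of m "lookup m"] unfolding eval_monomial_def[symmetric] by blast
  let ?Z = "rev (sort_key length Y)"
  have "sorted_wrt (\<ge>) (map length ?Z)" by (simp add: sorted_wrt_rev rev_map[symmetric])
  moreover have "minor_product ?Z = minor_product Y"
    unfolding minor_product_def prod_mset_prod_list[symmetric] by simp
  ultimately show thesis using that[of ?Z] Y by simp
qed

context order_part
begin

lemma standard_monomial_basis: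
  assumes d: "set d \<subseteq> {1..n - 1}"
  defines "M \<equiv> semistandard_monomials n U d"
  shows "M \<subseteq> carrier (pluecker_ring n d)" "inj_on (pluecker_proj n d) M"
    "vs_basis (pluecker_algebra n d) (pluecker_scalars n d) (pluecker_proj n d ` M)"
proof -
  let ?V = "{t. sorted_wrt (<) t \<and> set t \<subseteq> {1..n} \<and> length t \<in> set d}"
  let ?W = "{1..n - 1} \<times> {1..n}"
  interpret poly_quotient ?V ?W minor
  proof
    fix t assume "t \<in> ?V"
    then show "minor t \<in> polys ?W"
      using minor_closed[of t n] d by (auto simp: matrix_poly_ring_def)
  qed
  have map: "pluecker_map = poly_subst minor" by (simp add: pluecker_map_def)
  have defs: "pluecker_ring n d = R" "pluecker_ideal n d = I" "pluecker_algebra n d = R Quot I"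
    "pluecker_proj n d = coset" "pluecker_scalars n d = K"
    by (simp_all add: pluecker_ring_def pluecker_ideal_def pluecker_algebra_def pluecker_scalars_def
        pluecker_proj_def matrix_poly_ring_def map fun_eq_iff)
  have ME: "\<exists>Y. p = tableau_monomial Y \<and> oc_semistandard n U Y \<and> length ` set Y \<subseteq> set d" if "p \<in> M" for p
    using that by (auto simp: M_def semistandard_monomials_def)
  have distinct: "\<forall>c\<in>set Y. distinct c" if "oc_semistandard n U Y" for Y
    using that oc_tupleD(4) by (auto simp: oc_semistandard_iff)
  have MR: "M \<subseteq> carrier R"
  proof
    fix p assume "p \<in> M"
    then obtain Y where Y: "p = tableau_monomial Y" "oc_semistandard n U Y" "length ` set Y \<subseteq> set d"
      using ME by blast
    have "pluecker_var c \<in> carrier R" if c: "c \<in> set Y" for c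
    proof -
      have oc: "oc_tuple n U c" using Y c by (simp add: oc_semistandard_iff)
      then have "sort c \<in> ?V"
        using oc_tupleD(4,5)[OF oc] Y(3) c by (auto simp: strict_sorted_iff)
      then show ?thesis
        unfolding pluecker_var_def using oc_tupleD(4)[OF oc]
        by (auto intro!: poly_ring_mult poly_ring_of_int poly_ring_cvar)
    qed
    then show "p \<in> carrier R" unfolding Y(1) tableau_monomial_def by (intro poly_ring_prod_list) auto
  qed
  have leads_M: "leads var_weight (poly_subst minor (tableau_monomial Y)) (tableau_exponent Y)"
    if Y: "oc_semistandard n U Y" for Y
    using pluecker_map_tableau[OF distinct[OF Y]] standard_leads[OF Y] leads_uminus unfolding map by auto
  have eq_leads: "p = q" if pq: "p \<in> M" "q \<in> M" "leads var_weight (poly_subst minor p) m"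
    "leads var_weight (poly_subst minor q) m" for p q m
  proof -
    obtain Y Z where "p = tableau_monomial Y" "oc_semistandard n U Y" "q = tableau_monomial Z" "oc_semistandard n U Z"
      using ME[OF pq(1)] ME[OF pq(2)] by blast
    then show ?thesis using pq leads_M leads_unique tableau_exponent_inj by metis
  qed
  have ex_leads: "\<exists>m. leads var_weight (poly_subst minor p) m" if "p \<in> M" for p
    using ME[OF that] leads_M by blast
  have inj: "inj_on (poly_subst minor) M"
  proof (rule inj_onI)
    fix p q assume "p \<in> M" "q \<in> M" "poly_subst minor p = poly_subst minor q"
    then show "p = q" using ex_leads[of p] eq_leads[of p q] by auto
  qed
  have indep: "cpoly.independent (poly_subst minor ` M)"
    by (rule independent_if_distinct_leads[where wt = var_weight]) (use ex_leads eq_leads in blast)+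
  have spans: "poly_subst minor ` carrier R \<subseteq> cpoly.span (poly_subst minor ` M)"
  proof
    fix x assume "x \<in> poly_subst minor ` carrier R"
    then obtain p where p: "p \<in> carrier R" "x = poly_subst minor p" by blast
    have x: "x = (\<Sum>m\<in>keys p. cscale (lookup p m) (eval_monomial minor m))"
      unfolding p(2) poly_subst_def eval_monomial_def cscale_def ..
    have "eval_monomial minor m \<in> cpoly.span (poly_subst minor ` M)" if m: "m \<in> keys p" for m
    proof -
      obtain Y where Y: "set Y \<subseteq> keys m" "sorted_wrt (\<ge>) (map length Y)"
        "eval_monomial minor m = minor_product Y" by (rule eval_monomial_minor_product)
      have YV: "set Y \<subseteq> ?V" using Y(1) p(1) m unfolding poly_ring_carrier by blast
      have ks: "set (map length Y) \<subseteq> set d" using YV by auto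
      have "Y \<in> sorted_tableaux n (map length Y)" using YV by (auto simp: sorted_tableaux_def)
      then have "minor_product Y \<in> cpoly.span (minor_product ` standard_tableaux (map length Y))"
        using minor_product_in_span_classical[OF Y(2)] span_classical_subset_standard[OF Y(2)] ks d by blast
      also have "\<dots> \<subseteq> cpoly.span (poly_subst minor ` M)"
      proof (rule cpoly.span_minimal)
        show "minor_product ` standard_tableaux (map length Y) \<subseteq> cpoly.span (poly_subst minor ` M)"
        proof
          fix y assume "y \<in> minor_product ` standard_tableaux (map length Y)"
          then obtain Z where Z: "oc_semistandard n U Z" "map length Z = map length Y" "y = minor_product Z"
            by (auto simp: standard_tableaux_def)
          have "length ` set Z = set (map length Z)" by simp
          then have "tableau_monomial Z \<in> M"
            using Z ks unfolding M_def semistandard_monomials_def by (metis (mono_tags, lifting) mem_Collect_eq)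
          then have mem: "poly_subst minor (tableau_monomial Z) \<in> cpoly.span (poly_subst minor ` M)"
            by (intro cpoly.span_base imageI)
          show "y \<in> cpoly.span (poly_subst minor ` M)"
            using pluecker_map_tableau[OF distinct[OF Z(1)]] mem cpoly.span_neg[OF mem]
            unfolding map Z(3) by auto
        qed
      qed (rule cpoly.subspace_span)
      finally show ?thesis unfolding Y(3) .
    qed
    then show "x \<in> cpoly.span (poly_subst minor ` M)"
      unfolding x by (intro cpoly.span_sum cpoly.span_scale)
  qed
  show "M \<subseteq> carrier (pluecker_ring n d)" using MR by (simp only: defs)
  show "inj_on (pluecker_proj n d) M" unfolding defs by (rule quotient_basis(1)[OF MR inj indep spans])
  show "vs_basis (pluecker_algebra n d) (pluecker_scalars n d) (pluecker_proj n d ` M)"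
    unfolding defs by (rule quotient_basis(2)[OF MR inj indep spans])
qed

end

section \<open>Unimodular equivalence\<close>

text \<open>
  The subspace \<open>W\<close> contains the affine hull of \<open>Q'\<close>. The equivalence is the inverse of \<open>G\<close> on this
  affine hull.
\<close>

lemma unimodularly_equivalent_linear_image:
  fixes G :: "('b \<Rightarrow>\<^sub>0 real) \<Rightarrow> ('a \<Rightarrow>\<^sub>0 real)"
  assumes G: "linear G" and W: "subspace W" "Q' \<subseteq> W" and inj: "inj_on G W"
    and int: "\<And>y. y \<in> W \<Longrightarrow> G y \<in> integer_points \<longleftrightarrow> y \<in> integer_points"
    and Q: "Q = G ` Q'"
  shows "unimodularly_equivalent Q Q'"
proof -
  let ?H = "affine hull Q'"
  have HW: "?H \<subseteq> W" using W by (intro hull_minimal) (auto intro: subspace_imp_affine)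
  have comb: "G ((1 - u) *\<^sub>R x + u *\<^sub>R y) = (1 - u) *\<^sub>R G x + u *\<^sub>R G y" for u x y
    using G by (simp add: linear_add linear_scale)
  have H_comb: "(1 - u) *\<^sub>R x + u *\<^sub>R y \<in> ?H" if "x \<in> ?H" "y \<in> ?H" for u x y
    using affine_affine_hull[of Q'] that unfolding affine_alt by blast
  have hull: "affine hull Q = G ` ?H"
  proof (rule subset_antisym)
    show "affine hull Q \<subseteq> G ` ?H"
    proof (rule hull_minimal)
      show "Q \<subseteq> G ` ?H" unfolding Q by (intro image_mono hull_subset)
      have "(1 - u) *\<^sub>R x + u *\<^sub>R y \<in> G ` ?H" if xy: "x \<in> G ` ?H" "y \<in> G ` ?H" for x y u
      proof -
        obtain p q where "p \<in> ?H" "q \<in> ?H" "x = G p" "y = G q" using xy by blast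
        then show ?thesis using H_comb[of p q u] comb[of u p q] by (metis imageI)
      qed
      then show "affine (G ` ?H)" unfolding affine_alt by blast
    qed
    have "?H \<subseteq> {y. G y \<in> affine hull Q}"
    proof (rule hull_minimal)
      show "Q' \<subseteq> {y. G y \<in> affine hull Q}" using hull_subset[of Q affine] by (auto simp: Q)
      show "affine {y. G y \<in> affine hull Q}"
        using affine_affine_hull[of Q] unfolding affine_alt mem_Collect_eq comb by blast
    qed
    then show "G ` ?H \<subseteq> affine hull Q" by blast
  qed
  have injH: "inj_on G ?H" using inj HW by (rule inj_on_subset)
  let ?f = "inv_into ?H G"
  have f: "?f (G y) = y" if "y \<in> ?H" for y using injH that by (rule inv_into_f_f)
  have sub: "Q' \<subseteq> ?H" by (rule hull_subset)
  have bij: "bij_betw ?f (affine hull Q) ?H"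
    unfolding hull by (rule bij_betw_inv_into) (use injH in \<open>simp add: bij_betw_def\<close>)
  have affine: "?f ((1 - u) *\<^sub>R x + u *\<^sub>R y) = (1 - u) *\<^sub>R ?f x + u *\<^sub>R ?f y"
    if xy: "x \<in> affine hull Q" "y \<in> affine hull Q" for x y u
  proof -
    obtain p q where pq: "p \<in> ?H" "q \<in> ?H" "x = G p" "y = G q" using xy unfolding hull by blast
    have "?f (G ((1 - u) *\<^sub>R p + u *\<^sub>R q)) = (1 - u) *\<^sub>R p + u *\<^sub>R q"
      using H_comb[OF pq(1,2)] by (rule f)
    then show ?thesis unfolding pq(3,4) f[OF pq(1)] f[OF pq(2)] comb .
  qed
  have image: "?f ` Q = Q'"
  proof -
    have "?f ` G ` Q' = id ` Q'" unfolding image_image by (rule image_cong) (use f sub in auto)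
    then show ?thesis unfolding Q by simp
  qed
  have integers: "?f ` (affine hull Q \<inter> integer_points) = ?H \<inter> integer_points"
  proof (rule subset_antisym)
    show "?f ` (affine hull Q \<inter> integer_points) \<subseteq> ?H \<inter> integer_points"
      unfolding hull using f int HW by auto
    show "?H \<inter> integer_points \<subseteq> ?f ` (affine hull Q \<inter> integer_points)"
    proof
      fix y assume y: "y \<in> ?H \<inter> integer_points"
      then have "G y \<in> affine hull Q \<inter> integer_points" using int HW unfolding hull by blast
      moreover have "y = ?f (G y)" using f y by simp
      ultimately show "y \<in> ?f ` (affine hull Q \<inter> integer_points)" by (metis imageI)
    qed
  qed
  show ?thesis
    unfolding unimodularly_equivalent_def
    by (rule exI[of _ ?f]) (intro conjI ballI allI bij affine image integers)
qed

lemma sum_list_convex: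
  assumes "convex C" "C \<noteq> {}" "set xs \<subseteq> C"
  shows "sum_list xs \<in> (\<lambda>x. real (length xs) *\<^sub>R x) ` C"
  using assms(3)
proof (induction xs)
  case Nil
  then show ?case using assms(2) by (auto simp: image_iff)
next
  case (Cons x xs)
  let ?m = "real (length xs)"
  obtain y where y: "y \<in> C" "sum_list xs = ?m *\<^sub>R y" using Cons by auto
  let ?z = "(1 / (?m + 1)) *\<^sub>R x + (?m / (?m + 1)) *\<^sub>R y"
  have "?z \<in> C"
    by (rule convexD[OF assms(1)]) (use y Cons.prems in \<open>auto simp: field_simps\<close>)
  moreover have "(?m + 1) *\<^sub>R ?z = x + ?m *\<^sub>R y"
    by (simp add: scaleR_add_right add_nonneg_eq_0_iff)
  then have "sum_list (x # xs) = real (length (x # xs)) *\<^sub>R ?z" using y by (simp add: add.commute)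
  ultimately show ?case by blast
qed


section \<open>The polytopes\<close>

context order_part
begin

definition point_transfer :: "((nat \<times> nat) \<Rightarrow>\<^sub>0 real) \<Rightarrow> (nat \<times> nat) \<Rightarrow>\<^sub>0 real" where
  "point_transfer y = coord_vec (posetP n) (mark_transfer (lookup y))"

text \<open>
  The transfer forgets the coordinates \<open>(i, a)\<close> with \<open>\<sigma>\<^sub>i(a) < i\<close>. These vanish on all points of
  tableaux.
\<close>

definition admissible_points :: "((nat \<times> nat) \<Rightarrow>\<^sub>0 real) set" where
  "admissible_points = {y. \<forall>i a. lookup y (i, a) \<noteq> 0 \<longrightarrow>
     1 \<le> i \<and> i \<le> n \<and> a \<in> {1..n} \<and> i \<le> sigma n U i a}"

lemma finite_posetP: "finite (posetP n)"
  by (rule finite_subset[of _ "{1..n} \<times> {1..n}"]) (auto simp: posetP_def)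

lemma lookup_point_transfer:
  "lookup (point_transfer y) p
    = (if p \<in> posetP n then mark_transfer (lookup y) p else 0)"
  by (simp add: point_transfer_def lookup_coord_vec[OF finite_posetP])

lemma lookup_scaleR: "lookup (c *\<^sub>R (y :: 'b \<Rightarrow>\<^sub>0 real)) p = c * lookup y p"
  by (simp add: scaleR_poly_mapping_def)

lemma linear_point_transfer: "linear point_transfer"
proof (rule linearI)
  fix x y :: "(nat \<times> nat) \<Rightarrow>\<^sub>0 real" and c :: real
  show "point_transfer (x + y) = point_transfer x + point_transfer y"
    by (rule poly_mapping_eqI)
      (auto simp: lookup_point_transfer lookup_add mark_transfer_def sum.distrib split: prod.splits)
  show "point_transfer (c *\<^sub>R x) = c *\<^sub>R point_transfer x"
    by (rule poly_mapping_eqI)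
      (auto simp: lookup_point_transfer lookup_scaleR mark_transfer_def sum_distrib_left split: prod.splits)
qed

lemma subspace_admissible: "subspace admissible_points"
  by (rule subspaceI) (auto simp: admissible_points_def lookup_add lookup_scaleR; metis add_0)+

text \<open>The transfer is unitriangular: a row is recovered from its right end.\<close>

lemma recover_coordinate:
  assumes "1 \<le> i" "i \<le> v" "v \<le> n"
  shows "lookup y (i, tau i v) = lookup (point_transfer y) (i, v) -
    (if (i, v) \<in> U \<union> diagA n then \<Sum>v'\<in>{Suc v..n}. lookup y (i, tau i v') else 0)"
proof -
  have "(i, v) \<in> posetP n" using assms by (simp add: posetP_def)
  moreover have "{v..n} = insert v {Suc v..n}" using assms by auto
  ultimately show ?thesis by (simp add: lookup_point_transfer mark_transfer_def)
qed

lemma admissible_support: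
  assumes "y \<in> admissible_points" "lookup y (i, a) \<noteq> 0"
  obtains v where "1 \<le> i" "i \<le> v" "v \<le> n" "a = tau i v"
proof -
  have *: "1 \<le> i" "i \<le> n" "a \<in> {1..n}" "i \<le> sigma n U i a"
    using assms by (auto simp: admissible_points_def)
  then show thesis using that[of "sigma n U i a"] rows_above_sigma[of i a] sigma_range[of i a] by auto
qed

text \<open>
  With \<open>Z = {0}\<close> this says that the transfer is injective on admissible points, and with the integers
  that it reflects integrality.
\<close>

lemma lookup_in_subgroup:
  assumes y: "y \<in> admissible_points"
    and Z: "0 \<in> Z" "\<And>a b. a \<in> Z \<Longrightarrow> b \<in> Z \<Longrightarrow> a - b \<in> Z"
    and G: "\<And>p. lookup (point_transfer y) p \<in> Z"
  shows "lookup y p \<in> Z"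
proof -
  have "a + b \<in> Z" if "a \<in> Z" "b \<in> Z" for a b
    using Z(2)[OF that(1) Z(2)[OF Z(1) that(2)]] by simp
  then have sum: "sum f A \<in> Z" if "\<And>x. x \<in> A \<Longrightarrow> f x \<in> Z" for f and A :: "nat set"
    using that Z(1) by (induction A rule: infinite_finite_induct) auto
  have row: "lookup y (i, tau i v) \<in> Z" if "1 \<le> i" "i \<le> v" "v \<le> n" for i v
    using that(2,3)
  proof (induction "n - v" arbitrary: v rule: less_induct)
    case less
    have "(\<Sum>v'\<in>{Suc v..n}. lookup y (i, tau i v')) \<in> Z"
      using less by (intro sum) auto
    then show ?case
      unfolding recover_coordinate[OF that(1) less.prems, of y] using G Z by auto
  qed
  obtain i a where p: "p = (i, a)" by (cases p)
  show ?thesis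
  proof (cases "lookup y p = 0")
    case False
    then obtain v where "1 \<le> i" "i \<le> v" "v \<le> n" "a = tau i v"
      using admissible_support[OF y, of i a] unfolding p by blast
    then show ?thesis using row p by simp
  qed (use Z in simp)
qed

lemma inj_point_transfer: "inj_on point_transfer admissible_points"
proof (rule inj_onI)
  fix x y assume xy: "x \<in> admissible_points" "y \<in> admissible_points" "point_transfer x = point_transfer y"
  then have diff: "x - y \<in> admissible_points" using subspace_diff[OF subspace_admissible] by blast
  have "point_transfer (x - y) = 0" using xy(3) by (simp add: linear_diff[OF linear_point_transfer])
  then have "lookup (x - y) p \<in> {0}" for p
    using lookup_in_subgroup[OF diff, of "{0}" p] by simp
  then show "x = y" by (intro poly_mapping_eqI) (simp add: lookup_minus)
qed

lemma integer_point_transfer: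
  assumes y: "y \<in> admissible_points"
  shows "point_transfer y \<in> integer_points \<longleftrightarrow> y \<in> integer_points"
proof
  assume "y \<in> integer_points"
  then have int: "lookup y q \<in> \<int>" for q unfolding integer_points_def by blast
  have "mark_transfer (lookup y) p \<in> \<int>" for p
    using int by (cases p) (auto simp: mark_transfer_def intro!: Ints_sum)
  then show "point_transfer y \<in> integer_points" by (simp add: integer_points_def lookup_point_transfer)
next
  assume "point_transfer y \<in> integer_points"
  then have "lookup (point_transfer y) q \<in> \<int>" for q unfolding integer_points_def by blast
  then have "lookup y p \<in> \<int>" for p by (intro lookup_in_subgroup[OF y]) auto
  then show "y \<in> integer_points" unfolding integer_points_def by blast
qed

lemma lookup_tableau_point:
  assumes Y: "\<forall>c\<in>set Y. oc_tuple n U c"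
  shows "lookup (tableau_point n Y) p = sum_list (map (\<lambda>c. column_indicator c p) Y)"
proof -
  obtain i a where p: "p = (i, a)" by (cases p)
  let ?P = "\<lambda>c. 1 \<le> i \<and> i \<le> length c \<and> c ! (i - 1) = a"
  have ind: "sum_list (map (\<lambda>c. column_indicator c p) Y) = real (length (filter ?P Y))"
    unfolding p column_indicator_def by (induction Y) auto
  show ?thesis
  proof (cases "i \<in> {1..n - 1} \<and> a \<in> {1..n}")
    case True
    have "card {c \<in> {1..length Y}. i \<le> col_height Y c \<and> entry Y c i = a}
        = card {c. c < length Y \<and> ?P (Y ! c)}"
      by (rule bij_betw_same_card[of "\<lambda>c. c - 1"], rule bij_betw_byWitness[of _ Suc])
        (use True in \<open>auto simp: col_height_def entry_def\<close>)
    also have "\<dots> = length (filter ?P Y)" by (rule length_filter_conv_card[symmetric])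
    finally show ?thesis using True unfolding ind by (simp add: tableau_point_def p lookup_coord_vec)
  next
    case False
    have "\<not> ?P c" if "c \<in> set Y" for c
    proof
      assume P: "?P c"
      have "oc_tuple n U c" using Y that by blast
      then have "i \<le> n - 1" "a \<in> {1..n}"
        using P oc_tupleD(2) tuple_nth_range[OF oc_tupleD(5)] by fastforce+
      then show False using False P by simp
    qed
    then have "filter ?P Y = []" by (simp add: filter_empty_conv)
    then show ?thesis using False unfolding ind by (auto simp: tableau_point_def p lookup_coord_vec)
  qed
qed

lemma tableau_point_cong:
  assumes "\<forall>c\<in>set Y. oc_tuple n U c" "\<forall>c\<in>set Z. oc_tuple n U c" "tableau_exponent Y = tableau_exponent Z"
  shows "tableau_point n Y = tableau_point n Z"
proof (rule poly_mapping_eqI)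
  have real: "sum_list (map (\<lambda>c. column_indicator c p) X) = real (lookup (tableau_exponent X) p)" for X p
    unfolding lookup_tableau_exponent by (induction X) (auto simp: column_indicator_def split: prod.splits)
  show "lookup (tableau_point n Y) p = lookup (tableau_point n Z) p" for p
    using assms by (simp add: lookup_tableau_point real)
qed

lemma tableau_point_admissible:
  assumes Y: "\<forall>c\<in>set Y. oc_tuple n U c"
  shows "tableau_point n Y \<in> admissible_points"
  unfolding admissible_points_def
proof (intro CollectI allI impI)
  fix i a assume "lookup (tableau_point n Y) (i, a) \<noteq> 0"
  then have "sum_list (map (\<lambda>c. column_indicator c (i, a)) Y) \<noteq> (0 :: real)"
    by (simp add: lookup_tableau_point[OF Y])
  then have "\<exists>c\<in>set Y. column_indicator c (i, a) \<noteq> (0 :: real)"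
    by (induction Y) auto
  then obtain c where c: "c \<in> set Y" "1 \<le> i" "i \<le> length c" "c ! (i - 1) = a"
    by (auto simp: column_indicator_def)
  then have oc: "oc_tuple n U c" using Y by blast
  show "1 \<le> i \<and> i \<le> n \<and> a \<in> {1..n} \<and> i \<le> sigma n U i a"
    using c oc_tupleD(3)[OF oc] oc_tupleD(6)[OF oc, of i] tuple_nth_range[OF oc_tupleD(5)[OF oc], of i]
    by (auto simp: tuple_pos_def)
qed

lemma point_transfer_tableau:
  assumes Y: "\<forall>c\<in>set Y. oc_tuple n U c"
  shows "point_transfer (tableau_point n Y) = sum_list (map (\<lambda>c. ideal_point n U (ideal_of c)) Y)"
proof (rule poly_mapping_eqI)
  fix p
  have lookup_sum_list: "lookup (sum_list (map f Y)) p = sum_list (map (\<lambda>c. lookup (f c) p) Y)"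
    for f :: "nat list \<Rightarrow> (nat \<times> nat) \<Rightarrow>\<^sub>0 real" and Y
    by (induction Y) (simp_all add: lookup_add)
  have ideal_point: "lookup (ideal_point n U J) p = (if p \<in> posetP n then of_bool (p \<in> ideal_marks n U J) else 0)" for J
    by (simp add: ideal_point_def lookup_coord_vec[OF finite_posetP])
  show "lookup (point_transfer (tableau_point n Y)) p
      = lookup (sum_list (map (\<lambda>c. ideal_point n U (ideal_of c)) Y)) p"
  proof (cases "p \<in> posetP n")
    case True
    have "lookup (tableau_point n Y) = (\<lambda>p. sum_list (map (\<lambda>c. column_indicator c p) Y))"
      using lookup_tableau_point[OF Y] by auto
    then have "lookup (point_transfer (tableau_point n Y)) p
        = sum_list (map (\<lambda>c. mark_transfer (column_indicator c) p) Y)"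
      using True by (simp only: lookup_point_transfer mark_transfer_sum_list if_True)
    also have "\<dots> = sum_list (map (\<lambda>c. lookup (ideal_point n U (ideal_of c)) p) Y)"
      using Y True
      by (intro arg_cong[where f = sum_list] map_cong refl) (simp add: ideal_point mark_transfer_column)
    finally show ?thesis by (simp only: lookup_sum_list)
  next
    case False
    then show ?thesis by (simp add: lookup_point_transfer lookup_sum_list ideal_point sum_list_0)
  qed
qed

lemma sum_list_by_length:
  fixes x :: "nat list \<Rightarrow> 'b :: comm_monoid_add"
  assumes "\<forall>c\<in>set Y. length c \<in> A" "finite A"
  shows "sum_list (map x Y) = (\<Sum>k\<in>A. sum_list (map x (filter (\<lambda>c. length c = k) Y)))"
  using assms(1)
proof (induction Y)
  case (Cons c Y)
  have "(\<Sum>k\<in>A. sum_list (map x (filter (\<lambda>c. length c = k) (c # Y))))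
      = (\<Sum>k\<in>A. (if k = length c then x c else 0) + sum_list (map x (filter (\<lambda>c. length c = k) Y)))"
    by (rule sum.cong) auto
  also have "\<dots> = x c + sum_list (map x Y)"
    using Cons assms(2) by (simp add: sum.distrib sum.delta)
  finally show ?case by simp
qed simp

lemma order_ideals_k_nonempty:
  assumes "1 \<le> k" "k \<le> n - 1"
  shows "order_ideals_k n k \<noteq> {}"
proof -
  have "column_ideal [1..<Suc k] \<in> order_ideals_k n (length [1..<Suc k])"
    using assms by (intro column_ideal_mem) (auto simp del: upt_Suc)
  then show ?thesis using assms by (auto simp del: upt_Suc)
qed

text \<open>
  The columns of height \<open>k\<close> contribute the \<open>a k\<close>-fold multiple of their mean, a point of the
  fundamental polytope.
\<close>

lemma ideal_sum_in_polytope: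
  assumes Y: "\<forall>c\<in>set Y. oc_tuple n U c" and shape: "has_shape n a Y"
  shows "sum_list (map (\<lambda>c. ideal_point n U (ideal_of c)) Y) \<in> marked_chain_order_polytope n U a"
proof -
  let ?x = "\<lambda>c. ideal_point n U (ideal_of c)"
  let ?s = "\<lambda>k. sum_list (map ?x (filter (\<lambda>c. length c = k) Y))"
  have "?s k \<in> (\<lambda>x. real (a k) *\<^sub>R x) ` fundamental_polytope n U k" if k: "k \<in> {1..n - 1}" for k
  proof -
    let ?xs = "map ?x (filter (\<lambda>c. length c = k) Y)"
    have "length ?xs = count_list (map length Y) k" by (induction Y) auto
    then have "length ?xs = a k" using shape k by (simp add: has_shape_def)
    moreover have "sum_list ?xs \<in> (\<lambda>x. real (length ?xs) *\<^sub>R x) ` fundamental_polytope n U k"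
    proof (rule sum_list_convex)
      show "convex (fundamental_polytope n U k)" by (simp add: fundamental_polytope_def)
      show "fundamental_polytope n U k \<noteq> {}"
        using order_ideals_k_nonempty[of k] k hull_subset[of "ideal_point n U ` order_ideals_k n k" convex]
        unfolding fundamental_polytope_def by auto
      show "set ?xs \<subseteq> fundamental_polytope n U k"
        using Y tuple_ideal_mem unfolding fundamental_polytope_def by (auto intro!: hull_inc imageI)
    qed
    ultimately show ?thesis by metis
  qed
  moreover have "sum_list (map ?x Y) = (\<Sum>k\<in>{1..n - 1}. ?s k)"
    by (rule sum_list_by_length) (use Y oc_tupleD(1,2) in auto)
  ultimately show ?thesis
    unfolding marked_chain_order_polytope_def set_sum_alt[OF finite_atLeastAtMost] by blast
qed

text \<open>
  The vertices of a Minkowski sum are among the sums of vertices. Such a sum, read as a tableau with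
  \<open>a k\<close> equal columns of each height \<open>k\<close>, can be replaced by a semistandard one with the same
  exponents.
\<close>

lemma vertex_sum_is_standard:
  assumes J: "\<And>k. k \<in> {1..n - 1} \<Longrightarrow> J k \<in> order_ideals_k n k"
  obtains Z where "oc_semistandard n U Z" "has_shape n a Z"
    "(\<Sum>k\<in>{1..n - 1}. real (a k) *\<^sub>R ideal_point n U (J k)) = point_transfer (tableau_point n Z)"
proof -
  have "\<exists>t. oc_tuple n U t \<and> length t = k \<and> ideal_of t = J k" if "k \<in> {1..n - 1}" for k
    using order_ideal_tuple[OF J[OF that]] that by (metis atLeastAtMost_iff)
  then obtain t where t: "\<And>k. k \<in> {1..n - 1} \<Longrightarrow> oc_tuple n U (t k) \<and> length (t k) = k \<and> ideal_of (t k) = J k"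
    by metis
  let ?ks = "rev [1..<n]"
  have ks: "set ?ks = {1..n - 1}" "distinct ?ks" "sorted_wrt (\<ge>) ?ks"
    using n_gt_1 by (auto simp: sorted_wrt_rev)
  let ?Y = "concat (map (\<lambda>k. replicate (a k) (t k)) ?ks)"
  have oc: "\<forall>c\<in>set ?Y. oc_tuple n U c" using t n_gt_1 by auto
  have lens: "map length ?Y = concat (map (\<lambda>k. replicate (a k) k) ?ks)"
    unfolding map_concat map_map by (intro arg_cong[where f = concat] map_cong refl) (use t ks(1) in auto)
  have "sorted_wrt (\<ge>) (concat (map (\<lambda>k. replicate (a k) k) xs))" if "sorted_wrt (\<ge>) xs" for xs :: "nat list"
    using that
  proof (induction xs)
    case (Cons k xs)
    have "sorted_wrt (\<ge>) (replicate m k)" for m by (induction m) auto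
    then show ?case using Cons by (auto simp: sorted_wrt_append)
  qed simp
  then have "sorted_wrt (\<ge>) (map length ?Y)" unfolding lens using ks(3) by blast
  then obtain Z where Z: "Z \<in> standard_tableaux (map length ?Y)" "tableau_exponent Z = tableau_exponent ?Y"
    using exponent_is_standard[OF _ oc] by blast
  have count: "count_list (concat (map (\<lambda>k. replicate (a k) k) xs)) j = (if j \<in> set xs then a j else 0)"
    if "distinct xs" for xs j
  proof -
    have "count_list (replicate m k) j = (if j = k then m else 0)" for m k :: nat
      by (induction m) auto
    then show ?thesis using that by (induction xs) auto
  qed
  have ss: "oc_semistandard n U Z" using Z(1) by (simp add: standard_tableaux_def)
  have ocZ: "\<forall>c\<in>set Z. oc_tuple n U c" using ss by (simp add: oc_semistandard_iff)
  have "map length Z = concat (map (\<lambda>k. replicate (a k) k) ?ks)"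
    using Z(1) unfolding lens standard_tableaux_def by blast
  then have "has_shape n a Z"
    unfolding has_shape_def by (intro ballI) (simp only: count[OF ks(2)] ks(1) if_True)
  moreover have "(\<Sum>k\<in>{1..n - 1}. real (a k) *\<^sub>R ideal_point n U (J k)) = point_transfer (tableau_point n Z)"
  proof -
    let ?x = "\<lambda>c. ideal_point n U (ideal_of c)"
    have "sum_list (replicate m y) = real m *\<^sub>R y" for m and y :: "(nat \<times> nat) \<Rightarrow>\<^sub>0 real"
      by (induction m) (simp_all add: scaleR_left_distrib)
    then have "sum_list (map ?x (concat (map (\<lambda>k. replicate (a k) (t k)) xs)))
        = sum_list (map (\<lambda>k. real (a k) *\<^sub>R ?x (t k)) xs)" for xs
      by (induction xs) simp_all
    then have "sum_list (map ?x ?Y) = (\<Sum>k\<in>{1..n - 1}. real (a k) *\<^sub>R ?x (t k))"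
      using ks(1,2) by (metis (no_types, lifting) sum_list_distinct_conv_sum_set)
    also have "\<dots> = (\<Sum>k\<in>{1..n - 1}. real (a k) *\<^sub>R ideal_point n U (J k))"
      using t by (intro sum.cong) auto
    finally show ?thesis
      using point_transfer_tableau[OF oc] tableau_point_cong[OF oc ocZ] Z(2) by simp
  qed
  ultimately show thesis using that ss by blast
qed

lemma polytopes_equivalent:
  "unimodularly_equivalent (marked_chain_order_polytope n U a) (tableau_polytope n U a)"
proof (rule unimodularly_equivalent_linear_image[OF linear_point_transfer subspace_admissible _ inj_point_transfer])
  let ?S = "{tableau_point n Y | Y. oc_semistandard n U Y \<and> has_shape n a Y}"
  have oc: "\<forall>c\<in>set Y. oc_tuple n U c" if "oc_semistandard n U Y" for Y
    using that by (simp add: oc_semistandard_iff)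
  have "?S \<subseteq> admissible_points" using tableau_point_admissible oc by auto
  then show "tableau_polytope n U a \<subseteq> admissible_points"
    unfolding tableau_polytope_def
    by (rule hull_minimal) (rule subspace_imp_convex[OF subspace_admissible])
  show "point_transfer y \<in> integer_points \<longleftrightarrow> y \<in> integer_points" if "y \<in> admissible_points" for y
    using that by (rule integer_point_transfer)
  let ?B = "\<Sum>k\<in>{1..n - 1}. (\<lambda>x. real (a k) *\<^sub>R x) ` ideal_point n U ` order_ideals_k n k"
  have hull: "marked_chain_order_polytope n U a = convex hull ?B"
    unfolding marked_chain_order_polytope_def fundamental_polytope_def convex_hull_set_sum convex_hull_scaling ..
  have "?B \<subseteq> point_transfer ` ?S"
  proof
    fix x assume "x \<in> ?B"
    then obtain s where s: "x = (\<Sum>k\<in>{1..n - 1}. s k)"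
      "\<forall>k\<in>{1..n - 1}. s k \<in> (\<lambda>x. real (a k) *\<^sub>R x) ` ideal_point n U ` order_ideals_k n k"
      unfolding set_sum_alt[OF finite_atLeastAtMost] by blast
    then have "\<forall>k\<in>{1..n - 1}. \<exists>J. J \<in> order_ideals_k n k \<and> s k = real (a k) *\<^sub>R ideal_point n U J" by blast
    then obtain J where J: "\<And>k. k \<in> {1..n - 1} \<Longrightarrow> J k \<in> order_ideals_k n k"
      "\<And>k. k \<in> {1..n - 1} \<Longrightarrow> s k = real (a k) *\<^sub>R ideal_point n U (J k)" by metis
    obtain Z where "oc_semistandard n U Z" "has_shape n a Z"
      "(\<Sum>k\<in>{1..n - 1}. real (a k) *\<^sub>R ideal_point n U (J k)) = point_transfer (tableau_point n Z)"
      using vertex_sum_is_standard[where a = a, OF J(1)] by blast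
    moreover have "x = (\<Sum>k\<in>{1..n - 1}. real (a k) *\<^sub>R ideal_point n U (J k))"
      unfolding s(1) using J(2) by (intro sum.cong) auto
    ultimately show "x \<in> point_transfer ` ?S" by auto
  qed
  moreover have "point_transfer ` ?S \<subseteq> convex hull ?B"
    unfolding hull[symmetric] using ideal_sum_in_polytope point_transfer_tableau oc by auto
  ultimately have "convex hull ?B = convex hull (point_transfer ` ?S)"
    by (intro subset_antisym hull_mono hull_minimal convex_convex_hull) auto
  then show "marked_chain_order_polytope n U a = point_transfer ` tableau_polytope n U a"
    unfolding hull tableau_polytope_def by (simp add: convex_hull_linear_image[OF linear_point_transfer])
qed

end


theorem theoremB:
  fixes n :: nat and U V :: "(nat \<times> nat) set"
  assumes "n > 1"
    and "U \<union> V = posetP n - diagA n"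
    and "U \<inter> V = {}"
  shows "(\<forall>d. sorted_wrt (<) d \<and> set d \<subseteq> {1..n - 1} \<longrightarrow>
            semistandard_monomials n U d \<subseteq> carrier (pluecker_ring n d) \<and>
            inj_on (pluecker_proj n d) (semistandard_monomials n U d) \<and>
            vs_basis (pluecker_algebra n d) (pluecker_scalars n d)
              (pluecker_proj n d ` semistandard_monomials n U d)) \<and>
         (\<forall>a :: nat \<Rightarrow> nat.
            unimodularly_equivalent (marked_chain_order_polytope n U a) (tableau_polytope n U a))"
proof -
  interpret order_part n U
    by unfold_locales (use assms in auto)
  show ?thesis
    using standard_monomial_basis polytopes_equivalent by blast
qed

end
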